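(* Let $(M,m)$ be a compact weighted Riemannian manifold with (non-empty) boundary, let $k\ge1$ be an integer and let $p\in[1,\infty)$. For any sequence $\{A_\alpha\}_{\alpha=1}^{k}$ of Borel subsets of $M$, $$\nu^{D}_{k,p}(M,m)^{\frac1p}\le\frac{2}{\mathcal{D}^{\partial}(\{A_\alpha\})}\max_{\alpha=1,\dots,k}\log\frac{e\left(1-\sum_{\beta\ne\alpha}m(A_\beta)\right)}{m(A_\alpha)}.$$
   Context: A compact weighted Riemannian manifold with boundary $(M,m)$ is a connected compact Riemannian manifold $(M,g)$ with non-empty boundary $\partial M$, with Riemannian distance $d$ and Riemannian volume measure $v_g$, together with the probability measure $m=e^{-f}v_g$, where $f\in C^\infty(M)$ satisfies $\int_M e^{-f}\,dv_g=1$. $\nabla$ and $\|\cdot\|$ are the gradient and norm induced from $g$; $W^{1,p}_0(M,m)$ is the $(1,p)$-Sobolev space of functions vanishing on $\partial M$ (the $W^{1,p}$-closure of smooth functions compactly supported in the interior of $M$). The $k$-th Dirichlet $p$-Poincaré constant is $$\nu^{D}_{k,p}(M,m):=\inf_{L_k}\sup_{\phi\in L_k\setminus\{0\}}\frac{\int_M\|\nabla\phi\|^p\,dm}{\int_M|\phi|^p\,dm},$$ where the infimum is over all $k$-dimensional subspaces $L_k$ of $W^{1,p}_0(M,m)$. $\mathcal{D}^{\partial}(\{A_\alpha\}):=\min\{\min_{\alpha\ne\beta}d(A_\alpha,A_\beta),\ \min_\alpha d(A_\alpha,\partial M)\}$, where $d(A,B):=\inf\{d(x,y)\mid x\in A,\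 y\in B\}$ (a minimum over an empty index set is ignored). Convention: if $\mathcal{D}^{\partial}(\{A_\alpha\})=0$ or $m(A_\alpha)=0$ for some $\alpha$, the right-hand side is understood as $+\infty$. $\log$ is the natural logarithm. *)

theory Defs
  imports "HOL-Analysis.Analysis"
begin

section \<open>Smooth functions on subsets of Euclidean space\<close>

primrec Ck_on :: "nat \<Rightarrow> 'b::real_normed_vector set \<Rightarrow> ('b \<Rightarrow> 'c::real_normed_vector) \<Rightarrow> bool" where
  "Ck_on 0 S f \<longleftrightarrow> continuous_on S f"
| "Ck_on (Suc k) S f \<longleftrightarrow>
     (\<forall>x\<in>S. f differentiable (at x)) \<and> (\<forall>v. Ck_on k S (\<lambda>x. frechet_derivative f (at x) v))"

definition smooth_on_open :: "'b::real_normed_vector set \<Rightarrow> ('b \<Rightarrow> 'c::real_normed_vector) \<Rightarrow> bool" where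
  "smooth_on_open S f \<longleftrightarrow> open S \<and> (\<forall>k. Ck_on k S f)"

text \<open>Smoothness on an arbitrary subset (here: relatively open subsets of the half space) means
  that there are local smooth extensions to open subsets of the full Euclidean space.\<close>

definition smooth_on_set :: "'b::real_normed_vector set \<Rightarrow> ('b \<Rightarrow> 'c::real_normed_vector) \<Rightarrow> bool" where
  "smooth_on_set S f \<longleftrightarrow>
     (\<forall>x\<in>S. \<exists>W F. x \<in> W \<and> smooth_on_open W F \<and> (\<forall>z\<in>W \<inter> S. F z = f z))"


section \<open>Smooth manifolds with boundary\<close>

text \<open>The index type \<open>'n\<close> plays the role of \<open>{1,\<dots>,n}\<close>, where \<open>n = CARD('n)\<close> is the dimension;
  the half space is cut out by the first coordinate.\<close>

definition bdry_index :: "'n::{finite,wellorder}" where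
  "bdry_index = (LEAST i. True)"

definition half_space :: "(real^'n::{finite,wellorder}) set" where
  "half_space = {y. 0 \<le> y $ bdry_index}"

text \<open>A chart is a pair of its domain and its coordinate map; the values of the coordinate map
  outside the domain are irrelevant.\<close>

type_synonym ('a, 'n) chart = "'a set \<times> ('a \<Rightarrow> real^'n)"

abbreviation chart_dom :: "('a, 'n) chart \<Rightarrow> 'a set" where
  "chart_dom c \<equiv> fst c"

abbreviation chart_img :: "('a, 'n) chart \<Rightarrow> (real^'n) set" where
  "chart_img c \<equiv> snd c ` fst c"

definition chart_inv :: "('a, 'n::finite) chart \<Rightarrow> real^'n::_ \<Rightarrow> 'a" where
  "chart_inv c = inv_into (fst c) (snd c)"

definition is_chart :: "('a::topological_space, 'n::{finite,wellorder}) chart \<Rightarrow> bool" where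
  "is_chart c \<longleftrightarrow> open (chart_dom c) \<and> openin (top_of_set half_space) (chart_img c) \<and>
     homeomorphism (chart_dom c) (chart_img c) (snd c) (chart_inv c)"

definition transition :: "('a, 'n) chart \<Rightarrow> ('a, 'n) chart \<Rightarrow> real^'n \<Rightarrow> real^'n" where
  "transition c c' = snd c' \<circ> chart_inv c"

definition is_smooth_atlas :: "('a::topological_space, 'n::{finite,wellorder}) chart set \<Rightarrow> bool" where
  "is_smooth_atlas \<A> \<longleftrightarrow> (\<forall>c\<in>\<A>. is_chart c) \<and> (\<Union>c\<in>\<A>. chart_dom c) = UNIV \<and>
     (\<forall>c\<in>\<A>. \<forall>c'\<in>\<A>. smooth_on_set (snd c ` (chart_dom c \<inter> chart_dom c')) (transition c c'))"

text \<open>The differential of the transition map at the point \<open>x\<close> of the manifold. At boundary points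
  it is the derivative within the half space, which is unique.\<close>

definition dtransition ::
  "('a, 'n) chart \<Rightarrow> ('a, 'n) chart \<Rightarrow> 'a \<Rightarrow> real^'n \<Rightarrow> real^'n" where
  "dtransition c c' x =
     frechet_derivative (transition c c') (at (snd c x) within snd c ` (chart_dom c \<inter> chart_dom c'))"


section \<open>Weighted Riemannian manifolds with boundary\<close>

text \<open>The manifold is the whole type \<open>'a\<close>. A tensor field is given by its components in all charts
  of the atlas, subject to the transformation law under changes of charts: \<open>metric M c x\<close> is the
  matrix of the coefficients of the Riemannian metric at \<open>x\<close> in the chart \<open>c\<close>.\<close>

record ('a, 'n) weighted_mfd =
  atlas :: "('a, 'n) chart set"
  metric :: "('a, 'n) chart \<Rightarrow> 'a \<Rightarrow> real^'n^'n"
  vol :: "'a measure"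
  weight :: "'a \<Rightarrow> real"

definition mfd_boundary ::
  "('a::topological_space, 'n::{finite,wellorder}) weighted_mfd \<Rightarrow> 'a set" where
  "mfd_boundary M = {x. \<exists>c\<in>atlas M. x \<in> chart_dom c \<and> snd c x $ bdry_index = 0}"

definition is_riemannian_metric ::
  "('a::topological_space, 'n::{finite,wellorder}) chart set \<Rightarrow>
     (('a, 'n) chart \<Rightarrow> 'a \<Rightarrow> real^'n::_^'n::_) \<Rightarrow> bool" where
  "is_riemannian_metric \<A> g \<longleftrightarrow>
     (\<forall>c\<in>\<A>. smooth_on_set (chart_img c) (\<lambda>y. g c (chart_inv c y))) \<and>
     (\<forall>c\<in>\<A>. \<forall>x\<in>chart_dom c. transpose (g c x) = g c x \<and> (\<forall>v. v \<noteq> 0 \<longrightarrow> v \<bullet> (g c x *v v) > 0)) \<and>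
     (\<forall>c\<in>\<A>. \<forall>c'\<in>\<A>. \<forall>x\<in>chart_dom c \<inter> chart_dom c'. \<forall>v w.
        v \<bullet> (g c x *v w) = dtransition c c' x v \<bullet> (g c' x *v dtransition c c' x w))"

text \<open>A Borel measure is the Riemannian volume measure iff it is given by
  \<open>sqrt (det g) dy\<close> in every chart. Since countably many charts cover the manifold, this
  determines the measure uniquely.\<close>

definition is_riemannian_volume ::
  "('a::topological_space, 'n::{finite,wellorder}) chart set \<Rightarrow>
     (('a, 'n) chart \<Rightarrow> 'a \<Rightarrow> real^'n::_^'n::_) \<Rightarrow> 'a measure \<Rightarrow> bool" where
  "is_riemannian_volume \<A> g v \<longleftrightarrow> sets v = sets borel \<and>
     (\<forall>c\<in>\<A>. \<forall>B\<in>sets borel. B \<subseteq> chart_dom c \<longrightarrow>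
        emeasure v B =
          (\<integral>\<^sup>+y\<in>snd c ` B. ennreal (sqrt (det (g c (chart_inv c y)))) \<partial>lborel))"

definition smooth_function ::
  "('a::topological_space, 'n::{finite,wellorder}) weighted_mfd \<Rightarrow> ('a \<Rightarrow> real) \<Rightarrow> bool" where
  "smooth_function M u \<longleftrightarrow> (\<forall>c\<in>atlas M. smooth_on_set (chart_img c) (\<lambda>y. u (chart_inv c y)))"

definition compact_weighted_riemannian_manifold_with_boundary ::
  "('a::{second_countable_topology,t2_space}, 'n::{finite,wellorder}) weighted_mfd \<Rightarrow> bool" where
  "compact_weighted_riemannian_manifold_with_boundary M \<longleftrightarrow>
     compact (UNIV :: 'a set) \<and> connected (UNIV :: 'a set) \<and>
     is_smooth_atlas (atlas M) \<and> mfd_boundary M \<noteq> {} \<and>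
     is_riemannian_metric (atlas M) (metric M) \<and>
     is_riemannian_volume (atlas M) (metric M) (vol M) \<and>
     smooth_function M (weight M) \<and> (\<integral>\<^sup>+x. ennreal (exp (- weight M x)) \<partial>vol M) = 1"

definition wmeasure :: "('a, 'n::finite) weighted_mfd \<Rightarrow> 'a measure" where
  "wmeasure M = density (vol M) (\<lambda>x. ennreal (exp (- weight M x)))"


section \<open>Tangent vectors and Riemannian distance\<close>

definition chart_at :: "('a, 'n::finite) weighted_mfd \<Rightarrow> 'a \<Rightarrow> ('a, 'n) chart" where
  "chart_at M x = (SOME c. c \<in> atlas M \<and> x \<in> chart_dom c)"

text \<open>The norm of a tangent vector at \<open>x\<close> which has components \<open>V c\<close> in the chart \<open>c\<close>;
  by the transformation laws it does not depend on the choice of the chart around \<open>x\<close>.\<close>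

definition tangent_norm ::
  "('a, 'n::{finite,wellorder}) weighted_mfd \<Rightarrow> 'a \<Rightarrow> (('a, 'n) chart \<Rightarrow> real^'n::_) \<Rightarrow> real" where
  "tangent_norm M x V =
     (let c = chart_at M x in sqrt (V c \<bullet> (metric M c x *v V c)))"

definition velocity :: "(real \<Rightarrow> 'a) \<Rightarrow> real \<Rightarrow> ('a, 'n::finite) chart \<Rightarrow> real^'n::_" where
  "velocity \<gamma> t c = vector_derivative (snd c \<circ> \<gamma>) (at t)"

text \<open>As in the library's notion of a piecewise \<open>C\<^sup>1\<close> path, one-sided limits of the
  velocity at the finitely many exceptional parameters are not required. The lengths of such paths
  are limits of lengths of \<open>C\<^sup>1\<close> pieces, so this does not affect the distance.\<close>

definition piecewise_C1_curve ::
  "('a::topological_space, 'n::{finite,wellorder}) weighted_mfd \<Rightarrow> (real \<Rightarrow> 'a) \<Rightarrow> bool" where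
  "piecewise_C1_curve M \<gamma> \<longleftrightarrow> continuous_on {0..1} \<gamma> \<and>
     (\<exists>S. finite S \<and> {0, 1} \<subseteq> S \<and>
        (\<forall>c\<in>atlas M. (snd c \<circ> \<gamma>) C1_differentiable_on {t \<in> {0..1} - S. \<gamma> t \<in> chart_dom c}))"

definition curve_length ::
  "('a, 'n::{finite,wellorder}) weighted_mfd \<Rightarrow> (real \<Rightarrow> 'a) \<Rightarrow> ennreal" where
  "curve_length M \<gamma> =
     (\<integral>\<^sup>+t\<in>{0..1}. ennreal (tangent_norm M (\<gamma> t) (velocity \<gamma> t)) \<partial>lborel)"

definition rdist ::
  "('a::topological_space, 'n::{finite,wellorder}) weighted_mfd \<Rightarrow> 'a \<Rightarrow> 'a \<Rightarrow> ennreal" where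
  "rdist M x y =
     (INF \<gamma>\<in>{\<gamma>. piecewise_C1_curve M \<gamma> \<and> \<gamma> 0 = x \<and> \<gamma> 1 = y}. curve_length M \<gamma>)"

definition rsetdist ::
  "('a::topological_space, 'n::{finite,wellorder}) weighted_mfd \<Rightarrow> 'a set \<Rightarrow> 'a set \<Rightarrow> ennreal" where
  "rsetdist M A B = (INF x\<in>A. INF y\<in>B. rdist M x y)"

text \<open>The infimum over the empty set is \<open>\<infinity>\<close>; so the first term is ignored if \<open>k = 1\<close>.\<close>

definition sep_boundary ::
  "('a::topological_space, 'n::{finite,wellorder}) weighted_mfd \<Rightarrow> nat \<Rightarrow> (nat \<Rightarrow> 'a set) \<Rightarrow> ennreal" where
  "sep_boundary M k A =
     min (INF \<alpha>\<in>{1..k}. INF \<beta>\<in>{1..k} - {\<alpha>}. rsetdist M (A \<alpha>) (A \<beta>))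
         (INF \<alpha>\<in>{1..k}. rsetdist M (A \<alpha>) (mfd_boundary M))"


section \<open>Sobolev spaces\<close>

text \<open>A vector field assigns to each chart its component functions, with the transformation law
  holding at every point.\<close>

definition measurable_vector_field ::
  "('a::topological_space, 'n::{finite,wellorder}) weighted_mfd \<Rightarrow>
     (('a, 'n) chart \<Rightarrow> 'a \<Rightarrow> real^'n::_) \<Rightarrow> bool" where
  "measurable_vector_field M X \<longleftrightarrow>
     (\<forall>c\<in>atlas M. X c \<in> borel_measurable (restrict_space borel (chart_dom c))) \<and>
     (\<forall>c\<in>atlas M. \<forall>c'\<in>atlas M. \<forall>x\<in>chart_dom c \<inter> chart_dom c'.
        X c' x = dtransition c c' x (X c x))"

definition test_functions :: "('a, 'n::{finite,wellorder}) chart \<Rightarrow> (real^'n::_ \<Rightarrow> real) set" where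
  "test_functions c = {\<psi>. smooth_on_open UNIV \<psi> \<and> compact (closure {y. \<psi> y \<noteq> 0}) \<and>
     closure {y. \<psi> y \<noteq> 0} \<subseteq> chart_img c \<inter> {y. 0 < y $ bdry_index}}"

text \<open>In a chart, the differential of \<open>u\<close> has the components \<open>(metric M c x *v X c x) $ j\<close> if \<open>X\<close>
  is the gradient of \<open>u\<close>; these have to be the weak partial derivatives of \<open>u\<close>
  with respect to Lebesgue measure.\<close>

definition is_weak_gradient ::
  "('a::topological_space, 'n::{finite,wellorder}) weighted_mfd \<Rightarrow> ('a \<Rightarrow> real) \<Rightarrow>
     (('a, 'n) chart \<Rightarrow> 'a \<Rightarrow> real^'n::_) \<Rightarrow> bool" where
  "is_weak_gradient M u X \<longleftrightarrow> measurable_vector_field M X \<and>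
     (\<forall>c\<in>atlas M. \<forall>\<psi>\<in>test_functions c. \<forall>j.
        let du = (\<lambda>y. (metric M c (chart_inv c y) *v X c (chart_inv c y)) $ j);
            d\<psi> = (\<lambda>y. frechet_derivative \<psi> (at y) (axis j 1))
        in integrable lborel (\<lambda>y. u (chart_inv c y) * d\<psi> y) \<and>
           integrable lborel (\<lambda>y. du y * \<psi> y) \<and>
           (\<integral>y. u (chart_inv c y) * d\<psi> y \<partial>lborel) = - (\<integral>y. du y * \<psi> y \<partial>lborel))"

text \<open>The weak gradient is unique up to null sets.\<close>

definition grad ::
  "('a::topological_space, 'n::{finite,wellorder}) weighted_mfd \<Rightarrow> ('a \<Rightarrow> real) \<Rightarrow>
     ('a, 'n) chart \<Rightarrow> 'a \<Rightarrow> real^'n::_" where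
  "grad M u = (SOME X. is_weak_gradient M u X)"

definition grad_norm ::
  "('a::topological_space, 'n::{finite,wellorder}) weighted_mfd \<Rightarrow> ('a \<Rightarrow> real) \<Rightarrow> 'a \<Rightarrow> real" where
  "grad_norm M u x = tangent_norm M x (\<lambda>c. grad M u c x)"

definition Lp_energy ::
  "('a, 'n::{finite,wellorder}) weighted_mfd \<Rightarrow> real \<Rightarrow> ('a \<Rightarrow> real) \<Rightarrow> ennreal" where
  "Lp_energy M p u = (\<integral>\<^sup>+x. ennreal (\<bar>u x\<bar> powr p) \<partial>wmeasure M)"

text \<open>The elements of the Sobolev spaces are represented by functions; the identification of
  functions that agree almost everywhere is taken into account in the definition of
  \<open>kdim_subspaces\<close>.\<close>

definition W1p ::
  "('a::topological_space, 'n::{finite,wellorder}) weighted_mfd \<Rightarrow> real \<Rightarrow> ('a \<Rightarrow> real) set" where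
  "W1p M p = {u. u \<in> borel_measurable borel \<and> Lp_energy M p u < \<infinity> \<and>
     (\<exists>X. is_weak_gradient M u X) \<and> Lp_energy M p (grad_norm M u) < \<infinity>}"

definition test_functions_interior ::
  "('a::topological_space, 'n::{finite,wellorder}) weighted_mfd \<Rightarrow> ('a \<Rightarrow> real) set" where
  "test_functions_interior M = {u. smooth_function M u \<and>
     compact (closure {x. u x \<noteq> 0}) \<and> closure {x. u x \<noteq> 0} \<inter> mfd_boundary M = {}}"

definition W1p0 ::
  "('a::topological_space, 'n::{finite,wellorder}) weighted_mfd \<Rightarrow> real \<Rightarrow> ('a \<Rightarrow> real) set" where
  "W1p0 M p = {u \<in> W1p M p. \<exists>w :: nat \<Rightarrow> 'a \<Rightarrow> real.
     (\<forall>i. w i \<in> test_functions_interior M) \<and>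
     (\<lambda>i. Lp_energy M p (\<lambda>x. w i x - u x) + Lp_energy M p (grad_norm M (\<lambda>x. w i x - u x)))
       \<longlonglongrightarrow> 0}"


section \<open>Dirichlet \<open>p\<close>-Poincare constants\<close>

text \<open>The \<open>k\<close>-dimensional linear subspaces of the quotient of \<open>V\<close> by almost everywhere equality,
  each represented by the set of all representatives of its elements.\<close>

definition kdim_subspaces ::
  "'a measure \<Rightarrow> ('a \<Rightarrow> real) set \<Rightarrow> nat \<Rightarrow> ('a \<Rightarrow> real) set set" where
  "kdim_subspaces m V k = {L. \<exists>u :: nat \<Rightarrow> 'a \<Rightarrow> real.
     (\<forall>i\<in>{1..k}. u i \<in> V) \<and>
     (\<forall>a :: nat \<Rightarrow> real. (AE x in m. (\<Sum>i=1..k. a i * u i x) = 0) \<longrightarrow> (\<forall>i\<in>{1..k}. a i = 0)) \<and>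
     L = {\<phi> \<in> V. \<exists>a :: nat \<Rightarrow> real. AE x in m. \<phi> x = (\<Sum>i=1..k. a i * u i x)}}"

definition dirichlet_poincare ::
  "('a::topological_space, 'n::{finite,wellorder}) weighted_mfd \<Rightarrow> nat \<Rightarrow> real \<Rightarrow> ennreal" where
  "dirichlet_poincare M k p =
     (INF L\<in>kdim_subspaces (wmeasure M) (W1p0 M p) k.
        SUP \<phi>\<in>{\<phi> \<in> L. \<not> (AE x in wmeasure M. \<phi> x = 0)}.
          Lp_energy M p (grad_norm M \<phi>) / Lp_energy M p \<phi>)"

definition ennreal_root :: "real \<Rightarrow> ennreal \<Rightarrow> ennreal" where
  "ennreal_root p x = (if x = \<infinity> then \<infinity> else ennreal (enn2real x powr (1 / p)))"

definition separation_bound ::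
  "('a::topological_space, 'n::{finite,wellorder}) weighted_mfd \<Rightarrow> nat \<Rightarrow> (nat \<Rightarrow> 'a set) \<Rightarrow> ereal" where
  "separation_bound M k A =
     (if sep_boundary M k A = 0 \<or> (\<exists>\<alpha>\<in>{1..k}. measure (wmeasure M) (A \<alpha>) = 0) then \<infinity>
      else 2 / enn2ereal (sep_boundary M k A) *
        ereal (MAX \<alpha>\<in>{1..k}.
          ln (exp 1 * (1 - (\<Sum>\<beta>\<in>{1..k} - {\<alpha>}. measure (wmeasure M) (A \<beta>)))
                / measure (wmeasure M) (A \<alpha>))))"

end

theory Submission
  imports Defs
begin

text \<open>Let \<open>a\<close> be the measure of \<open>A \<alpha>\<close>, let \<open>b\<close> be the measure which the other sets leave to it, and
  put \<open>L = ln (e * b / a)\<close>. The infimum in the Poincare constant is tested with the span of one function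
  for each set, where the functions have disjoint supports. For these, numerator and denominator of the
  Rayleigh quotient of a linear combination are sums over the summands, so it is at most the largest
  of the individual quotients (\<open>dirichlet_poincare_le_disjoint\<close>).

  Let \<open>T\<close> be less than half of the separation. Then the neighbourhoods of radius \<open>T\<close> of the sets are
  disjoint, they do not meet the boundary, and the one of \<open>A \<alpha>\<close> has measure at most \<open>b\<close>. The test
  function is the profile \<open>\<phi> = exp (- \<mu> * \<psi>) - exp (- \<mu> * T)\<close> of the distance \<open>\<psi>\<close> from \<open>A \<alpha>\<close>, cut off at
  \<open>T\<close>, with \<open>\<mu> = L / (p * T)\<close>. The elementary inequality \<open>z powr p \<le> (p * (z - 1)) powr p + e\<close> for
  \<open>z \<ge> 1\<close> turns into a pointwise comparison of the gradient of \<open>\<phi>\<close> with \<open>\<phi>\<close>, up to an additive error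
  whose integral is at most \<open>a\<close>. This error is paid for by the set \<open>A \<alpha>\<close> itself, where \<open>\<phi>\<close> is constant.
  The Rayleigh quotient is thus at most \<open>(L / T) powr p\<close> (\<open>exponential_profile\<close>), and the factor 2 in the
  theorem comes from \<open>T\<close> tending to half of the separation.

  The distance has to be replaced by a smooth function with gradient of norm at most \<open>1 + \<delta>\<close>. In a small
  cube of a chart the metric is nearly constant, so the distance is Lipschitz with a constant close to
  1 for a fixed norm there, and mollification preserves this. The local mollifications are glued with weights that are
  fixed before the mollification parameter, so that the derivatives of the weights do no harm
  (\<open>smooth_lipschitz_approximation\<close>). The connection between the distance and charts consists of the
  triangle inequality for \<open>rdist\<close> and the length of segments (\<open>rdist_triangle_less\<close>,
  \<open>rdist_chart_segment\<close>).

  The test functions obtained in this way are smooth and vanish near the boundary, so they belong to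
  the Sobolev space. The gradient of a Sobolev function is an arbitrarily chosen weak gradient; it is
  compared with the classical one by means of integration by parts (\<open>weak_gradient_cgrad\<close>) and of the
  uniqueness of weak gradients almost everywhere (\<open>weak_gradient_unique\<close>), a consequence of the
  fundamental lemma of the calculus of variations.\<close>

section \<open>Calculus of smooth functions\<close>

lemma Ck_on_cong:
  assumes "open S" "\<forall>x\<in>S. f x = g x" "Ck_on k S f"
  shows "Ck_on k S g"
  using assms
proof (induction k arbitrary: f g)
  case 0
  then show ?case by (auto cong: continuous_on_cong)
next
  case (Suc k)
  have d: "(g has_derivative frechet_derivative f (at x)) (at x)" if "x \<in> S" for x
  proof (rule has_derivative_transform_within_open[OF _ Suc.prems(1) that])
    show "(f has_derivative frechet_derivative f (at x)) (at x)"
      using Suc.prems(3) that by (auto simp: frechet_derivative_works)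
  qed (use Suc.prems in auto)
  show ?case
    unfolding Ck_on.simps
  proof (intro conjI ballI allI)
    show "g differentiable at x" if "x \<in> S" for x
      using d[OF that] by (auto simp: differentiable_def)
    show "Ck_on k S (\<lambda>x. frechet_derivative g (at x) v)" for v
    proof (rule Suc.IH[OF Suc.prems(1)])
      show "\<forall>x\<in>S. frechet_derivative f (at x) v = frechet_derivative g (at x) v"
        by (metis d frechet_derivative_at)
      show "Ck_on k S (\<lambda>x. frechet_derivative f (at x) v)"
        using Suc.prems(3) by simp
    qed
  qed
qed

lemma Ck_on_SucI':
  assumes "open S" "\<And>x. x \<in> S \<Longrightarrow> (f has_derivative f' x) (at x)"
    and "\<And>v. Ck_on k S (\<lambda>x. f' x v)"
  shows "Ck_on (Suc k) S f"
  unfolding Ck_on.simps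
proof (intro conjI ballI allI)
  show "f differentiable at x" if "x \<in> S" for x
    using assms(2)[OF that] by (auto simp: differentiable_def)
  show "Ck_on k S (\<lambda>x. frechet_derivative f (at x) v)" for v
    by (rule Ck_on_cong[OF assms(1) _ assms(3)[of v]]) (metis assms(2) frechet_derivative_at)
qed

lemma Ck_on_SucD:
  assumes "Ck_on (Suc k) S f"
  shows "x \<in> S \<Longrightarrow> (f has_derivative frechet_derivative f (at x)) (at x)"
    and "Ck_on k S (\<lambda>x. frechet_derivative f (at x) v)"
  using assms by (auto simp: frechet_derivative_works)

lemma Ck_on_mono: "Ck_on (Suc k) S f \<Longrightarrow> Ck_on k S f"
proof (induction k arbitrary: f)
  case 0
  then have "f differentiable (at x within S)" if "x \<in> S" for x
    using that by (auto intro: differentiable_at_withinI)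
  then show ?case
    using differentiable_imp_continuous_within by (auto simp: continuous_on_eq_continuous_within)
next
  case (Suc k)
  show ?case
    unfolding Ck_on.simps(2)[of k] using Suc by (auto simp del: Ck_on.simps simp: Ck_on.simps(2)[of "Suc k"])
qed

lemma Ck_on_continuous: "Ck_on k S f \<Longrightarrow> continuous_on S f"
  by (induction k) (use Ck_on_mono in auto)

lemma Ck_on_subset: "Ck_on k S f \<Longrightarrow> T \<subseteq> S \<Longrightarrow> Ck_on k T f"
  by (induction k arbitrary: f) (auto intro: continuous_on_subset)

lemma Ck_on_const: "open S \<Longrightarrow> Ck_on k S (\<lambda>x. c)"
proof (induction k arbitrary: c)
  case (Suc k)
  show ?case by (rule Ck_on_SucI'[where f' = "\<lambda>x v. 0"]) (use Suc in auto)
qed auto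

lemma Ck_on_linear: "open S \<Longrightarrow> bounded_linear f \<Longrightarrow> Ck_on k S f"
proof (induction k)
  case (Suc k)
  show ?case
    by (rule Ck_on_SucI'[where f' = "\<lambda>x. f"]) (use Suc Ck_on_const in \<open>auto intro: bounded_linear_imp_has_derivative\<close>)
qed (auto intro: linear_continuous_on)

lemma Ck_on_bounded_linear:
  "open S \<Longrightarrow> bounded_linear h \<Longrightarrow> Ck_on k S f \<Longrightarrow> Ck_on k S (\<lambda>x. h (f x))"
proof (induction k arbitrary: f)
  case 0
  then show ?case by (auto intro: bounded_linear.continuous_on)
next
  case (Suc k)
  show ?case
    by (rule Ck_on_SucI'[where f' = "\<lambda>x v. h (frechet_derivative f (at x) v)"])
      (use Suc Ck_on_SucD[OF Suc.prems(3)] in \<open>auto intro!: bounded_linear.has_derivative[of h]\<close>)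
qed

lemma Ck_on_add: "open S \<Longrightarrow> Ck_on k S f \<Longrightarrow> Ck_on k S g \<Longrightarrow> Ck_on k S (\<lambda>x. f x + g x)"
proof (induction k arbitrary: f g)
  case 0
  then show ?case by (auto intro: continuous_intros)
next
  case (Suc k)
  show ?case
    by (rule Ck_on_SucI'[where f' = "\<lambda>x v. frechet_derivative f (at x) v + frechet_derivative g (at x) v"])
      (use Suc Ck_on_SucD[OF Suc.prems(2)] Ck_on_SucD[OF Suc.prems(3)] in \<open>auto intro!: has_derivative_add\<close>)
qed

lemma Ck_on_bilinear:
  assumes "bounded_bilinear bp" "open S"
  shows "Ck_on k S f \<Longrightarrow> Ck_on k S g \<Longrightarrow> Ck_on k S (\<lambda>x. bp (f x) (g x))"
proof (induction k arbitrary: f g)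
  case 0
  then show ?case by (auto intro: bounded_bilinear.continuous_on[OF assms(1)])
next
  case (Suc k)
  have fk: "Ck_on k S f" "Ck_on k S g" using Suc.prems by (simp_all add: Ck_on_mono del: Ck_on.simps)
  show ?case
  proof (rule Ck_on_SucI'[where f' = "\<lambda>x v. bp (f x) (frechet_derivative g (at x) v) + bp (frechet_derivative f (at x) v) (g x)"])
    show "Ck_on k S (\<lambda>x. bp (f x) (frechet_derivative g (at x) v) + bp (frechet_derivative f (at x) v) (g x))" for v
      by (intro Ck_on_add assms(2) Suc.IH[OF fk(1)] Suc.IH[OF _ fk(2)] Ck_on_SucD(2)[OF Suc.prems(1)] Ck_on_SucD(2)[OF Suc.prems(2)])
  qed (use Ck_on_SucD[OF Suc.prems(1)] Ck_on_SucD[OF Suc.prems(2)] assms in \<open>auto intro!: bounded_bilinear.FDERIV[OF assms(1)]\<close>)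
qed

lemmas Ck_on_scaleR = Ck_on_bilinear[OF bounded_bilinear_scaleR]

lemma Ck_on_sum: "open S \<Longrightarrow> (\<And>i. i \<in> I \<Longrightarrow> Ck_on k S (f i)) \<Longrightarrow> Ck_on k S (\<lambda>x. \<Sum>i\<in>I. f i x)"
  by (induction I rule: infinite_finite_induct) (auto intro: Ck_on_add Ck_on_const)

lemma linear_sum_Basis:
  assumes "bounded_linear (h :: 'c::euclidean_space \<Rightarrow> 'd::real_normed_vector)"
  shows "h v = (\<Sum>i\<in>Basis. (v \<bullet> i) *\<^sub>R h i)"
proof -
  have "h v = h (\<Sum>i\<in>Basis. (v \<bullet> i) *\<^sub>R i)" by (simp add: euclidean_representation)
  then show ?thesis
    using assms by (simp add: linear_sum linear_simps bounded_linear.linear linear_cmul)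
qed

text \<open>By the chain rule, a directional derivative of \<open>g \<circ> f\<close> is a combination of the
  directional derivatives of \<open>g\<close> along a basis, composed with \<open>f\<close>. These lose one order of
  differentiability, so the induction has to range over all \<open>g\<close>.\<close>

lemma Ck_on_compose:
  fixes f :: "'b::real_normed_vector \<Rightarrow> 'c::euclidean_space" and g :: "'c \<Rightarrow> 'd::real_normed_vector"
  assumes "open S" "open T" "f ` S \<subseteq> T"
  shows "Ck_on k T g \<Longrightarrow> Ck_on k S f \<Longrightarrow> Ck_on k S (\<lambda>x. g (f x))"
proof (induction k arbitrary: g)
  case 0
  then show ?case using assms by (auto intro: continuous_on_compose2)
next
  case (Suc k)
  have fk: "Ck_on k S f" using Suc.prems by (rule_tac Ck_on_mono)
  let ?f' = "\<lambda>x. frechet_derivative f (at x)" and ?g' = "\<lambda>x. frechet_derivative g (at x)"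
  have dg: "(g has_derivative ?g' (f x)) (at (f x))" if "x \<in> S" for x
    using that assms(3) by (intro Ck_on_SucD[OF Suc.prems(1)]) auto
  have df: "(f has_derivative ?f' x) (at x)" if "x \<in> S" for x
    by (intro Ck_on_SucD[OF Suc.prems(2)] that)
  have *: "?g' (f x) (?f' x v) = (\<Sum>i\<in>Basis. (?f' x v \<bullet> i) *\<^sub>R ?g' (f x) i)" if "x \<in> S" for x v
    using linear_sum_Basis[OF has_derivative_bounded_linear[OF dg[OF that]]] by blast
  show ?case
  proof (rule Ck_on_SucI'[where f' = "\<lambda>x v. ?g' (f x) (?f' x v)", OF assms(1)])
    show "((\<lambda>x. g (f x)) has_derivative (\<lambda>v. ?g' (f x) (?f' x v))) (at x)" if "x \<in> S" for x
      using has_derivative_compose[OF df[OF that] dg[OF that]] .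
    show "Ck_on k S (\<lambda>x. ?g' (f x) (?f' x v))" for v
    proof (rule Ck_on_cong[OF assms(1), of "\<lambda>x. (\<Sum>i\<in>Basis. (?f' x v \<bullet> i) *\<^sub>R ?g' (f x) i)"])
      show "Ck_on k S (\<lambda>x. (\<Sum>i\<in>Basis. (?f' x v \<bullet> i) *\<^sub>R ?g' (f x) i))"
        by (intro Ck_on_sum Ck_on_scaleR assms(1) Suc.IH fk Ck_on_SucD(2)[OF Suc.prems(1)]
            Ck_on_bounded_linear[OF _ bounded_linear_inner_left] Ck_on_SucD(2)[OF Suc.prems(2)])
    qed (use * in auto)
  qed
qed

lemma smooth_on_open_Ck: "smooth_on_open S f \<Longrightarrow> Ck_on k S f"
  and smooth_on_open_open: "smooth_on_open S f \<Longrightarrow> open S"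
  by (auto simp: smooth_on_open_def)

lemma smooth_on_open_has_derivative:
  "smooth_on_open S f \<Longrightarrow> x \<in> S \<Longrightarrow> (f has_derivative frechet_derivative f (at x)) (at x)"
  using Ck_on_SucD smooth_on_open_Ck by blast

lemma smooth_on_open_continuous_derivative:
  "smooth_on_open S f \<Longrightarrow> continuous_on S (\<lambda>x. frechet_derivative f (at x) v)"
  using Ck_on_continuous Ck_on_SucD(2) smooth_on_open_Ck by blast

lemma smooth_on_open_continuous: "smooth_on_open S f \<Longrightarrow> continuous_on S f"
  using Ck_on_continuous smooth_on_open_Ck by blast

lemma smooth_on_open_subset: "smooth_on_open S f \<Longrightarrow> open T \<Longrightarrow> T \<subseteq> S \<Longrightarrow> smooth_on_open T f"
  by (auto simp: smooth_on_open_def intro: Ck_on_subset)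

lemma smooth_on_open_cong:
  "smooth_on_open S f \<Longrightarrow> (\<And>x. x \<in> S \<Longrightarrow> f x = g x) \<Longrightarrow> smooth_on_open S g"
  by (auto simp: smooth_on_open_def intro: Ck_on_cong)

lemma smooth_on_open_compose:
  fixes f :: "'b::real_normed_vector \<Rightarrow> 'c::euclidean_space" and g :: "'c \<Rightarrow> 'd::real_normed_vector"
  shows "smooth_on_open T g \<Longrightarrow> smooth_on_open S f \<Longrightarrow> f ` S \<subseteq> T \<Longrightarrow> smooth_on_open S (\<lambda>x. g (f x))"
  by (auto simp: smooth_on_open_def intro: Ck_on_compose)

lemma smooth_on_open_const: "open S \<Longrightarrow> smooth_on_open S (\<lambda>x. c)"
  by (auto simp: smooth_on_open_def Ck_on_const)

lemma smooth_on_open_linear: "open S \<Longrightarrow> bounded_linear f \<Longrightarrow> smooth_on_open S f"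
  by (auto simp: smooth_on_open_def Ck_on_linear)

lemma smooth_on_open_id: "open S \<Longrightarrow> smooth_on_open S (\<lambda>x. x)"
  by (auto simp: smooth_on_open_def Ck_on_linear)

lemma smooth_on_open_add: "smooth_on_open S f \<Longrightarrow> smooth_on_open S g \<Longrightarrow> smooth_on_open S (\<lambda>x. f x + g x)"
  by (auto simp: smooth_on_open_def Ck_on_add)

lemma smooth_on_open_mult:
  fixes f g :: "'b::real_normed_vector \<Rightarrow> real"
  shows "smooth_on_open S f \<Longrightarrow> smooth_on_open S g \<Longrightarrow> smooth_on_open S (\<lambda>x. f x * g x)"
  by (auto simp: smooth_on_open_def intro: Ck_on_bilinear[OF bounded_bilinear_mult])

lemma smooth_on_open_diff:
  fixes f g :: "'b::real_normed_vector \<Rightarrow> real"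
  shows "smooth_on_open S f \<Longrightarrow> smooth_on_open S g \<Longrightarrow> smooth_on_open S (\<lambda>x. f x - g x)"
  using smooth_on_open_add[of S f "\<lambda>x. (-1) * g x"] smooth_on_open_mult[OF smooth_on_open_const, of S g "-1"]
  by (simp add: smooth_on_open_open)

lemma smooth_on_open_prod:
  fixes f :: "'i \<Rightarrow> 'b::real_normed_vector \<Rightarrow> real"
  shows "open S \<Longrightarrow> (\<And>i. i \<in> I \<Longrightarrow> smooth_on_open S (f i)) \<Longrightarrow> smooth_on_open S (\<lambda>x. \<Prod>i\<in>I. f i x)"
  by (induction I rule: infinite_finite_induct) (auto intro: smooth_on_open_mult smooth_on_open_const)

lemma smooth_on_open_inverse: "smooth_on_open (- {0}) (\<lambda>t::real. inverse t)"
  unfolding smooth_on_open_def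
proof (intro conjI allI)
  show "open (- {0::real})" by (simp add: open_Compl)
  show "Ck_on k (- {0}) (\<lambda>t::real. inverse t)" for k
  proof (induction k)
    case (Suc k)
    show ?case
    proof (rule Ck_on_SucI'[where f' = "\<lambda>x v. (- inverse x) * (v * inverse x)"])
      show "Ck_on k (- {0}) (\<lambda>x::real. - inverse x * (v * inverse x))" for v
        by (intro Ck_on_bilinear[OF bounded_bilinear_mult] Suc Ck_on_const
          Ck_on_bounded_linear[of _ uminus] bounded_linear_minus bounded_linear_ident)
          (auto simp: open_Compl)
    qed (auto intro!: derivative_eq_intros)
  qed (auto intro!: continuous_intros)
qed

lemma smooth_on_open_exp: "smooth_on_open UNIV (\<lambda>t::real. exp t)"
  unfolding smooth_on_open_def
proof (intro conjI allI)
  show "Ck_on k UNIV (\<lambda>t::real. exp t)" for k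
  proof (induction k)
    case (Suc k)
    show ?case
    proof (rule Ck_on_SucI'[where f' = "\<lambda>x v. v * exp x"])
      show "Ck_on k UNIV (\<lambda>x::real. v * exp x)" for v
        by (intro Ck_on_bilinear[OF bounded_bilinear_mult] Suc Ck_on_const) auto
    qed (auto intro!: derivative_eq_intros)
  qed (auto intro!: continuous_intros)
qed auto

section \<open>Bump functions and mollification\<close>

text \<open>The family consists of \<open>exp (- 1 / t)\<close>, extended by zero to \<open>t \<le> 0\<close>, and its products with the
  powers of \<open>1 / t\<close>. The derivative of a member is a linear combination of members, so all of them
  are smooth.\<close>

definition flat_exp :: "nat \<Rightarrow> real \<Rightarrow> real" where
  "flat_exp n t = (if t \<le> 0 then 0 else inverse t ^ n * exp (- inverse t))"

lemma flat_exp_tendsto: "((\<lambda>t. inverse t ^ n * exp (- inverse t)) \<longlongrightarrow> 0) (at_right (0::real))"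
proof -
  have "((\<lambda>x. x ^ n / exp x) \<longlongrightarrow> 0) (at_top :: real filter)"
    by (rule tendsto_power_div_exp_0)
  from filterlim_compose[OF this filterlim_inverse_at_top_right]
  show ?thesis by (simp add: exp_minus field_simps)
qed

lemma flat_exp_has_derivative:
  "(flat_exp n has_derivative (\<lambda>v. v * (flat_exp (n + 2) t - real n * flat_exp (n + 1) t))) (at t)"
proof -
  consider "t < 0" | "t = 0" | "t > 0" by linarith
  then show ?thesis
  proof cases
    case 1
    have "((\<lambda>x. 0) has_derivative (\<lambda>v. v * (flat_exp (n + 2) t - real n * flat_exp (n + 1) t))) (at t)"
      using 1 by (auto simp: flat_exp_def)
    then show ?thesis
      by (rule has_derivative_transform_within_open[of _ _ _ _ "{..<0}"]) (use 1 in \<open>auto simp: flat_exp_def\<close>)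
  next
    case 2
    have "((\<lambda>h. flat_exp n h / h) \<longlongrightarrow> 0) (at 0)"
    proof (rule filterlim_split_at)
      show "((\<lambda>h. flat_exp n h / h) \<longlongrightarrow> 0) (at_left 0)"
        by (rule tendsto_eventually) (auto simp: flat_exp_def eventually_at_filter)
      show "((\<lambda>h. flat_exp n h / h) \<longlongrightarrow> 0) (at_right 0)"
        by (rule Lim_transform_eventually[OF flat_exp_tendsto[of "Suc n"]])
          (auto simp: flat_exp_def eventually_at_filter field_simps)
    qed
    then have "(flat_exp n has_field_derivative 0) (at 0)"
      by (simp add: has_field_derivative_iff flat_exp_def)
    then show ?thesis
      using 2 by (simp add: has_field_derivative_def flat_exp_def lambda_zero mult_commute_abs)
  next
    case 3
    have "((\<lambda>t. inverse t ^ n * exp (- inverse t)) has_real_derivative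
       (inverse t ^ (n + 2) * exp (- inverse t) - real n * (inverse t ^ (n + 1) * exp (- inverse t)))) (at t)"
    proof (cases n)
      case (Suc m)
      have "t * t ^ (j - Suc 0) = t ^ j" if "j \<noteq> 0" for j
        using that by (cases j) auto
      then show ?thesis using 3 Suc
        by (cases m; cases "m - 1 = 0") (auto intro!: derivative_eq_intros simp: field_simps power2_eq_square)
    qed (use 3 in \<open>auto intro!: derivative_eq_intros simp: field_simps power2_eq_square\<close>)
    then have "((\<lambda>t. inverse t ^ n * exp (- inverse t)) has_derivative
       (\<lambda>v. v * (flat_exp (n + 2) t - real n * flat_exp (n + 1) t))) (at t)"
      using 3 by (simp add: has_field_derivative_def flat_exp_def mult_commute_abs)
    then show ?thesis
      by (rule has_derivative_transform_within_open[of _ _ _ _ "{0<..}"]) (use 3 in \<open>auto simp: flat_exp_def\<close>)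
  qed
qed

lemma smooth_flat_exp: "smooth_on_open UNIV (flat_exp n)"
  unfolding smooth_on_open_def
proof (intro conjI allI)
  show "Ck_on k UNIV (flat_exp n)" for k
  proof (induction k arbitrary: n)
    case 0
    show ?case
      by (auto simp: continuous_on_eq_continuous_at intro!: has_derivative_continuous[OF flat_exp_has_derivative])
  next
    case (Suc k)
    show ?case
    proof (rule Ck_on_SucI'[OF open_UNIV flat_exp_has_derivative])
      have "Ck_on k UNIV (\<lambda>x. v * (flat_exp (n + 2) x + (- real n) * flat_exp (n + 1) x))" for v
        by (intro Ck_on_bilinear[OF bounded_bilinear_mult] Ck_on_add Ck_on_const Suc open_UNIV)
      then show "Ck_on k UNIV (\<lambda>x. v * (flat_exp (n + 2) x - real n * flat_exp (n + 1) x))" for v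
        by simp
    qed
  qed
qed simp

lemma flat_exp_bounds: "0 \<le> flat_exp 0 t" "flat_exp 0 t \<le> 1" "0 < flat_exp 0 t \<longleftrightarrow> 0 < t"
  by (auto simp: flat_exp_def)

text \<open>These functions are positive exactly on the open box; with growing steepness \<open>s\<close> they converge
  to its indicator function.\<close>

definition box_bump :: "real \<Rightarrow> 'b::euclidean_space \<Rightarrow> 'b \<Rightarrow> 'b \<Rightarrow> real" where
  "box_bump s a b x = (\<Prod>i\<in>Basis. flat_exp 0 (s * (x \<bullet> i - a \<bullet> i)) * flat_exp 0 (s * (b \<bullet> i - x \<bullet> i)))"

lemma smooth_box_bump: "smooth_on_open UNIV (box_bump s a b)"
proof -
  have "smooth_on_open UNIV (\<lambda>x. s * (x \<bullet> i - a \<bullet> i))" "smooth_on_open UNIV (\<lambda>x. s * (b \<bullet> i - x \<bullet> i))" for i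
    by (intro smooth_on_open_mult smooth_on_open_diff smooth_on_open_const smooth_on_open_linear
      bounded_linear_inner_left open_UNIV)+
  then show ?thesis
    unfolding box_bump_def[abs_def]
    by (intro smooth_on_open_prod smooth_on_open_mult[OF
        smooth_on_open_compose[OF smooth_flat_exp] smooth_on_open_compose[OF smooth_flat_exp]]) auto
qed

lemma box_bump_nonneg: "0 \<le> box_bump s a b x"
  unfolding box_bump_def by (intro prod_nonneg mult_nonneg_nonneg ballI) (simp_all add: flat_exp_bounds)

lemma box_bump_le_1: "box_bump s a b x \<le> 1"
  unfolding box_bump_def by (intro prod_le_1 conjI mult_nonneg_nonneg mult_le_one) (simp_all add: flat_exp_bounds)

lemma box_bump_pos:
  assumes "0 < s" "x \<in> box a b"
  shows "0 < box_bump s a b x"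
  unfolding box_bump_def
  by (intro prod_pos mult_pos_pos ballI) (use assms in \<open>simp_all add: flat_exp_bounds mem_box\<close>)

lemma box_bump_zero:
  assumes "0 < s" "x \<notin> box a b"
  shows "box_bump s a b x = 0"
proof -
  obtain i where i: "i \<in> Basis" "\<not> (a \<bullet> i < x \<bullet> i \<and> x \<bullet> i < b \<bullet> i)"
    using assms by (auto simp: mem_box)
  then have "flat_exp 0 (s * (x \<bullet> i - a \<bullet> i)) * flat_exp 0 (s * (b \<bullet> i - x \<bullet> i)) = 0"
    using assms(1) by (auto simp: flat_exp_def mult_le_0_iff not_less)
  then show ?thesis
    unfolding box_bump_def using i(1) by (intro prod_zero) auto
qed

lemma box_bump_pos_iff: "0 < s \<Longrightarrow> 0 < box_bump s a b x \<longleftrightarrow> x \<in> box a b"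
  using box_bump_pos box_bump_zero by (metis less_irrefl)

lemma box_bump_tendsto_indicator:
  "(\<lambda>n. box_bump (real n) a b x) \<longlonglongrightarrow> indicator (box a b) x"
proof (cases "x \<in> box a b")
  case True
  have *: "(\<lambda>n. flat_exp 0 (real n * t)) \<longlonglongrightarrow> 1" if "t > 0" for t
  proof -
    have "(\<lambda>n. exp (- inverse (real n * t))) \<longlonglongrightarrow> exp (- 0)"
    proof (intro tendsto_exp tendsto_minus)
      have "(\<lambda>n. inverse (real n) * inverse t) \<longlonglongrightarrow> 0 * inverse t"
        by (intro tendsto_mult tendsto_const lim_inverse_n)
      then show "(\<lambda>n. inverse (real n * t)) \<longlonglongrightarrow> 0" by simp
    qed
    moreover have "eventually (\<lambda>n. exp (- inverse (real n * t)) = flat_exp 0 (real n * t)) sequentially"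
      using eventually_gt_at_top[of 0] by eventually_elim (use that in \<open>auto simp: flat_exp_def mult_le_0_iff\<close>)
    ultimately have "(\<lambda>n. flat_exp 0 (real n * t)) \<longlonglongrightarrow> exp (- 0)" by (rule Lim_transform_eventually)
    then show ?thesis by simp
  qed
  have "(\<lambda>n. box_bump (real n) a b x) \<longlonglongrightarrow> (\<Prod>i\<in>(Basis::'a set). 1 * 1)"
    unfolding box_bump_def
    by (intro tendsto_prod tendsto_mult *) (use True in \<open>auto simp: mem_box\<close>)
  then show ?thesis using True by simp
next
  case False
  have "eventually (\<lambda>n. box_bump (real n) a b x = 0) sequentially"
    using eventually_gt_at_top[of 0] by eventually_elim (use False in \<open>simp add: box_bump_zero\<close>)
  then show ?thesis using False by (simp add: tendsto_eventually)
qed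

lemma closure_support_subset:
  assumes "\<And>x. f x \<noteq> 0 \<Longrightarrow> x \<in> cbox a b"
  shows "closure {x. f x \<noteq> (0::real)} \<subseteq> cbox a b" "compact (closure {x. f x \<noteq> 0})"
proof -
  show *: "closure {x. f x \<noteq> (0::real)} \<subseteq> cbox a b"
    by (rule closure_minimal) (use assms in auto)
  show "compact (closure {x. f x \<noteq> 0})"
    using compact_Int_closed[of "cbox a b" "closure {x. f x \<noteq> 0}"] * by (simp add: Int_absorb1)
qed

text \<open>All derivatives fall on the kernel: differentiating under the integral sign replaces \<open>k\<close> by one of
  its directional derivatives, to which the same statement applies.\<close>

lemma smooth_convolution:
  fixes f k :: "'b::euclidean_space \<Rightarrow> real"
  assumes f: "continuous_on (cbox a b) f" and k: "smooth_on_open UNIV k"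
  shows "smooth_on_open UNIV (\<lambda>y. integral (cbox a b) (\<lambda>z. f z * k (y - z)))"
proof -
  have cont: "continuous_on (U \<times> cbox a b) (\<lambda>(y, z). f z * h (y - z))"
    if "continuous_on UNIV h" for h :: "'b \<Rightarrow> real" and U
    unfolding split_beta
    by (intro continuous_intros continuous_on_compose2[OF f] continuous_on_compose2[OF that]) auto
  have cont1: "continuous_on (cbox a b) (\<lambda>z. f z * h (y - z))"
    if "continuous_on UNIV h" for h :: "'b \<Rightarrow> real" and y
    by (intro continuous_intros f continuous_on_compose2[OF that]) auto
  have "Ck_on m UNIV (\<lambda>y. integral (cbox a b) (\<lambda>z. f z * k (y - z)))" if "\<forall>m. Ck_on m UNIV k" for m k
    using that
  proof (induction m arbitrary: k)
    case 0
    then have "continuous_on UNIV k" using Ck_on_continuous by blast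
    then show ?case by (simp add: integral_continuous_on_param cont)
  next
    case (Suc m)
    define k' where "k' = (\<lambda>x. Blinfun (frechet_derivative k (at x)))"
    have dk: "(k has_derivative frechet_derivative k (at x)) (at x)" for x
      using Ck_on_SucD Suc.prems by blast
    have k': "blinfun_apply (k' x) = frechet_derivative k (at x)" for x
      unfolding k'_def by (rule bounded_linear_Blinfun_apply[OF has_derivative_bounded_linear[OF dk]])
    have ck': "Ck_on m UNIV (\<lambda>x. frechet_derivative k (at x) v)" for m v
      using Ck_on_SucD(2) Suc.prems by blast
    then have "continuous_on UNIV (\<lambda>x. frechet_derivative k (at x) v)" for v
      using Ck_on_continuous by blast
    then have k'cont: "continuous_on UNIV k'"
      by (intro continuous_on_blinfun_componentwise) (simp add: k')
    have ck: "continuous_on UNIV k" using Suc.prems Ck_on_continuous by blast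
    let ?fx = "\<lambda>y z. f z *\<^sub>R k' (y - z)"
    have cfx1: "continuous_on (cbox a b) (?fx y)" for y
      by (intro continuous_intros f continuous_on_compose2[OF k'cont]) auto
    have der: "((\<lambda>y. integral (cbox a b) (\<lambda>z. f z * k (y - z))) has_derivative
        integral (cbox a b) (?fx y)) (at y within UNIV)" for y
    proof (rule leibniz_rule)
      fix x t
      have "((\<lambda>x. k (x - t)) has_derivative (\<lambda>v. frechet_derivative k (at (x - t)) v)) (at x)"
        by (rule has_derivative_compose[OF _ dk, of "\<lambda>x. x - t" "\<lambda>v. v"]) (auto intro!: derivative_eq_intros)
      from has_derivative_mult_right[OF this, of "f t"]
      show "((\<lambda>x. f t * k (x - t)) has_derivative blinfun_apply (f t *\<^sub>R k' (x - t))) (at x within UNIV)"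
        by (simp add: scaleR_blinfun.rep_eq k' fun_eq_iff[symmetric])
    next
      show "(\<lambda>z. f z * k (x - z)) integrable_on cbox a b" for x
        by (intro integrable_continuous cont1 ck)
      show "continuous_on (UNIV \<times> cbox a b) (\<lambda>(y, z). f z *\<^sub>R k' (y - z))"
        unfolding split_beta
        by (intro continuous_intros continuous_on_compose2[OF f] continuous_on_compose2[OF k'cont]) auto
    qed auto
    have app: "blinfun_apply (integral (cbox a b) (?fx y)) v
       = integral (cbox a b) (\<lambda>z. f z * frechet_derivative k (at (y - z)) v)" for y v
      using integral_linear[OF integrable_continuous[OF cfx1[of y]] blinfun.bounded_linear_left[of v]]
      by (simp add: o_def scaleR_blinfun.rep_eq k')
    show ?case
    proof (rule Ck_on_SucI')
      show "((\<lambda>y. integral (cbox a b) (\<lambda>z. f z * k (y - z))) has_derivative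
        blinfun_apply (integral (cbox a b) (?fx y))) (at y)" for y
        using der by simp
      show "Ck_on m UNIV (\<lambda>y. blinfun_apply (integral (cbox a b) (?fx y)) v)" for v
        unfolding app by (rule Suc.IH) (use ck' in blast)
    qed simp
  qed
  then show ?thesis
    using k by (simp add: smooth_on_open_def)
qed

lemma has_integral_cbox_shift:
  fixes f :: "'b::euclidean_space \<Rightarrow> real"
  assumes "(f has_integral i) (cbox a b)"
  shows "((\<lambda>z. f (z - x)) has_integral i) (cbox (a + x) (b + x))"
proof -
  have "((\<lambda>z. f (1 *\<^sub>R z + (- x))) has_integral (1 / (\<bar>1\<bar> ^ DIM('b))) *\<^sub>R i)
    ((\<lambda>z. (1 / 1) *\<^sub>R z + - ((1 / 1) *\<^sub>R (- x))) ` cbox a b)"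
    by (rule has_integral_affinity[OF assms]) simp
  moreover have "(\<lambda>z. z + x) ` cbox a b = cbox (a + x) (b + x)"
    using cbox_translation[of x a b] by (simp add: add.commute image_def)
  ultimately show ?thesis by simp
qed

abbreviation cube :: "'b::euclidean_space \<Rightarrow> real \<Rightarrow> 'b set" where
  "cube x r \<equiv> cbox (x - r *\<^sub>R One) (x + r *\<^sub>R One)"

text \<open>The value of \<open>F\<close> is an average of the values of \<open>f\<close> over the cube around the point, with weights
  that depend on the offset only. Upper and lower bounds are therefore inherited, and so is a bound on
  the difference of the values of \<open>f\<close> at two points shifted by the same offset; this is how Lipschitz
  estimates with respect to an arbitrary norm survive. The integration extends over one fixed box,
  which makes \<open>F\<close> smooth everywhere; it is an average only where the cube lies inside that box.\<close>

lemma mollify: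
  fixes f :: "'b::euclidean_space \<Rightarrow> real"
  assumes f: "continuous_on (cbox a b) f" and e: "0 < e"
  obtains F where "smooth_on_open UNIV F"
    and "\<And>x u. cube x e \<subseteq> cbox a b \<Longrightarrow>
          (\<And>z. z \<in> cube x e \<Longrightarrow> f z \<le> u) \<Longrightarrow> F x \<le> u"
    and "\<And>x u. cube x e \<subseteq> cbox a b \<Longrightarrow>
          (\<And>z. z \<in> cube x e \<Longrightarrow> u \<le> f z) \<Longrightarrow> u \<le> F x"
    and "\<And>x y u. cube x e \<subseteq> cbox a b \<Longrightarrow>
          cube y e \<subseteq> cbox a b \<Longrightarrow>
          (\<And>w. w \<in> cbox (- e *\<^sub>R One) (e *\<^sub>R One) \<Longrightarrow> f (x + w) - f (y + w) \<le> u) \<Longrightarrow> F x - F y \<le> u"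
proof -
  let ?Q = "cbox (- e *\<^sub>R One) (e *\<^sub>R One :: 'b)"
  let ?C = "\<lambda>x :: 'b. cube x e"
  define k where "k = box_bump 1 (- e *\<^sub>R One) (e *\<^sub>R One :: 'b)"
  have k: "smooth_on_open UNIV k" unfolding k_def by (rule smooth_box_bump)
  have k0: "0 \<le> k w" for w unfolding k_def by (rule box_bump_nonneg)
  have kz: "k w = 0" if "w \<notin> ?Q" for w
    unfolding k_def using that box_subset_cbox by (intro box_bump_zero) auto
  \<comment> \<open>The symmetry of the kernel allows to substitute by a translation alone.\<close>
  have ksym: "k (- w) = k w" for w
    unfolding k_def box_bump_def by (intro prod.cong) (auto simp: algebra_simps)
  have kc: "continuous_on S k" for S
    using smooth_on_open_continuous[OF k] continuous_on_subset by blast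
  define c where "c = integral ?Q k"
  have ki: "(k has_integral c) ?Q" unfolding c_def
    by (intro integrable_integral integrable_continuous kc)
  have "c \<ge> 0" unfolding c_def by (intro integral_nonneg integrable_continuous kc) (simp add: k0)
  \<comment> \<open>The kernel is positive at the origin, hence its integral cannot vanish.\<close>
  moreover have "c \<noteq> 0"
  proof
    assume "c = 0"
    have 0: "(0::'b) \<in> box (- e *\<^sub>R One) (e *\<^sub>R One)" using e by (simp add: mem_box)
    then have "k 0 = 0"
      using has_integral_0_cbox_imp_0[OF kc k0, of "- e *\<^sub>R One" "e *\<^sub>R One" 0] ki \<open>c = 0\<close> box_subset_cbox
      by auto
    then show False using box_bump_pos[OF _ 0, of 1] by (simp add: k_def)
  qed
  ultimately have c: "c > 0" by simp
  define F where "F = (\<lambda>y. integral (cbox a b) (\<lambda>z. f z * k (y - z)) * inverse c)"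
  have sub: "x + w \<in> ?C x" if "w \<in> ?Q" for x w
    using that by (auto simp: mem_box algebra_simps)
  have fc: "continuous_on ?Q (\<lambda>w. f (x + w) * k w)" if "?C x \<subseteq> cbox a b" for x
    using sub that by (intro continuous_intros continuous_on_compose2[OF f] kc) auto
  have Feq: "F x * c = integral ?Q (\<lambda>w. f (x + w) * k w)" if "?C x \<subseteq> cbox a b" for x
  proof -
    have 1: "((\<lambda>w. f (x + w) * k w) has_integral integral ?Q (\<lambda>w. f (x + w) * k w)) ?Q"
      by (intro integrable_integral integrable_continuous fc that)
    have 2: "((\<lambda>z. f (x + (z - x)) * k (z - x)) has_integral integral ?Q (\<lambda>w. f (x + w) * k w))
       (cbox (- e *\<^sub>R One + x) (e *\<^sub>R One + x))"
      by (rule has_integral_cbox_shift[OF 1])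
    have "((\<lambda>z. f (x + (z - x)) * k (z - x)) has_integral integral ?Q (\<lambda>w. f (x + w) * k w)) (cbox a b)"
    proof (rule has_integral_on_superset[OF 2])
      show "cbox (- e *\<^sub>R One + x) (e *\<^sub>R One + x) \<subseteq> cbox a b"
        using that by (simp add: algebra_simps)
      fix z assume z: "z \<notin> cbox (- e *\<^sub>R One + x) (e *\<^sub>R One + x)"
      have "z - x \<notin> ?Q"
      proof
        assume "z - x \<in> ?Q"
        then have "z \<in> cbox (- e *\<^sub>R One + x) (e *\<^sub>R One + x)" by (auto simp: mem_box algebra_simps)
        with z show False by simp
      qed
      then show "f (x + (z - x)) * k (z - x) = 0" by (simp add: kz)
    qed
    moreover have "k (z - x) = k (x - z)" for z
      using ksym[of "x - z"] by simp
    ultimately have "integral (cbox a b) (\<lambda>z. f z * k (x - z)) = integral ?Q (\<lambda>w. f (x + w) * k w)"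
      by (auto intro: integral_unique)
    then show ?thesis using c by (simp add: F_def)
  qed
  have le: "integral ?Q (\<lambda>w. g w * k w) \<le> u * c"
    if "continuous_on ?Q (\<lambda>w. g w * k w)" "\<And>w. w \<in> ?Q \<Longrightarrow> g w \<le> u" for g u
  proof -
    have "integral ?Q (\<lambda>w. g w * k w) \<le> integral ?Q (\<lambda>w. u * k w)"
      by (intro integral_le integrable_continuous that(1) continuous_intros kc mult_right_mono that(2) k0)
    then show ?thesis by (simp add: c_def)
  qed
  show thesis
  proof (rule that[of F])
    show "smooth_on_open UNIV F"
      unfolding F_def by (intro smooth_on_open_mult smooth_convolution f k smooth_on_open_const open_UNIV)
    show "F x \<le> u" if "?C x \<subseteq> cbox a b" "\<And>z. z \<in> ?C x \<Longrightarrow> f z \<le> u" for x u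
    proof -
      have "F x * c \<le> u * c" unfolding Feq[OF that(1)]
        by (rule le[OF fc[OF that(1)]]) (use that sub in auto)
      then show ?thesis using c by simp
    qed
    show "u \<le> F x" if "?C x \<subseteq> cbox a b" "\<And>z. z \<in> ?C x \<Longrightarrow> u \<le> f z" for x u
    proof -
      have "integral ?Q (\<lambda>w. - f (x + w) * k w) \<le> - u * c"
        by (rule le) (use that sub continuous_on_minus[OF fc[OF that(1)]] in auto)
      then have "u * c \<le> F x * c" unfolding Feq[OF that(1)] by simp
      then show ?thesis using c by simp
    qed
    show "F x - F y \<le> u" if "?C x \<subseteq> cbox a b" "?C y \<subseteq> cbox a b"
       "\<And>w. w \<in> ?Q \<Longrightarrow> f (x + w) - f (y + w) \<le> u" for x y u
    proof -
      have "(F x - F y) * c = integral ?Q (\<lambda>w. f (x + w) * k w) - integral ?Q (\<lambda>w. f (y + w) * k w)"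
        using Feq that by (simp add: left_diff_distrib)
      also have "\<dots> = integral ?Q (\<lambda>w. (f (x + w) - f (y + w)) * k w)"
        using integral_diff[OF integrable_continuous[OF fc[OF that(1)]] integrable_continuous[OF fc[OF that(2)]]]
        by (simp add: left_diff_distrib)
      also have "\<dots> \<le> u * c"
        by (rule le) (use continuous_on_diff[OF fc[OF that(1)] fc[OF that(2)]] that(3) in \<open>auto simp: left_diff_distrib\<close>)
      finally show ?thesis using c by simp
    qed
  qed
qed

section \<open>Integration by parts and the fundamental lemma of the calculus of variations\<close>

lemma Ck_on_local:
  assumes "\<And>x. x \<in> S \<Longrightarrow> \<exists>U. open U \<and> x \<in> U \<and> Ck_on k U f"
  shows "Ck_on k S f"
  using assms
proof (induction k arbitrary: f)
  case 0
  have "isCont f x" if "x \<in> S" for x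
    using 0[OF that] by (auto simp: continuous_on_eq_continuous_at)
  then show ?case by (simp add: continuous_at_imp_continuous_on)
next
  case (Suc k)
  show ?case
    unfolding Ck_on.simps
  proof (intro conjI ballI allI)
    show "f differentiable at x" if "x \<in> S" for x
      using Suc.prems[OF that] by auto
    show "Ck_on k S (\<lambda>x. frechet_derivative f (at x) v)" for v
      by (rule Suc.IH) (use Suc.prems in fastforce)
  qed
qed

lemma smooth_on_open_local:
  assumes "open S" "\<And>x. x \<in> S \<Longrightarrow> \<exists>U. x \<in> U \<and> smooth_on_open U f"
  shows "smooth_on_open S f"
  unfolding smooth_on_open_def using assms
  by (auto intro!: Ck_on_local) (meson smooth_on_open_def)

text \<open>The integral of a translate of \<open>F\<close> does not depend on the translation vector; differentiating this
  constant under the integral sign gives the integral of the directional derivative.\<close>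

lemma integral_derivative_compact_support:
  fixes F :: "'b::euclidean_space \<Rightarrow> real"
  assumes der: "\<And>x. (F has_derivative F' x) (at x)"
    and cont: "continuous_on UNIV (\<lambda>x. F' x v)"
    and supp: "\<And>x. F x \<noteq> 0 \<Longrightarrow> x \<in> cbox a b"
  shows "integrable lborel (\<lambda>x. F' x v)" "(\<integral>x. F' x v \<partial>lborel) = 0"
proof -
  define r where "r = norm v"
  let ?a = "a - r *\<^sub>R One" and ?b = "b + r *\<^sub>R One"
  \<comment> \<open>The enlarged box contains the supports of all translates by \<open>s *\<^sub>R v\<close> with \<open>\<bar>s\<bar> < 1\<close>.\<close>
  let ?B = "cbox ?a ?b"
  have ab: "cbox a b \<subseteq> ?B"
    by (auto simp: mem_box inner_diff_left inner_add_left r_def intro: order_trans add_increasing2)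
      (smt (verit) norm_ge_zero)+
  have Fcont: "continuous_on UNIV F"
    using der by (meson continuous_at_imp_continuous_on has_derivative_continuous)
  define I where "I = integral (cbox a b) F"
  have I: "(F has_integral I) (cbox a b)"
    unfolding I_def by (intro integrable_integral integrable_continuous continuous_on_subset[OF Fcont]) auto
  have const: "integral ?B (\<lambda>y. F (y + s *\<^sub>R v)) = I" if s: "s \<in> {-1<..<1}" for s :: real
  proof -
    have 1: "((\<lambda>y. F (y - (- s *\<^sub>R v))) has_integral I) (cbox (a + - s *\<^sub>R v) (b + - s *\<^sub>R v))"
      by (rule has_integral_cbox_shift[OF I])
    have sv: "\<bar>s * (v \<bullet> i)\<bar> \<le> r" if "i \<in> Basis" for i
    proof -
      have "\<bar>s\<bar> * \<bar>v \<bullet> i\<bar> \<le> 1 * norm v"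
        using s that by (intro mult_mono Basis_le_norm) auto
      then show ?thesis by (simp add: r_def abs_mult)
    qed
    have "((\<lambda>y. F (y - (- s *\<^sub>R v))) has_integral I) ?B"
    proof (rule has_integral_on_superset[OF 1])
      show "cbox (a + - s *\<^sub>R v) (b + - s *\<^sub>R v) \<subseteq> ?B"
        using sv by (force simp: mem_box inner_diff_left inner_add_left abs_le_iff)
      fix y assume y: "y \<notin> cbox (a + - s *\<^sub>R v) (b + - s *\<^sub>R v)"
      have "y - (- s *\<^sub>R v) \<notin> cbox a b"
        using y by (auto simp: mem_box inner_diff_left inner_add_left algebra_simps)
      then show "F (y - (- s *\<^sub>R v)) = 0" using supp by blast
    qed
    then show ?thesis by (simp add: integral_unique)
  qed
  have d1: "((\<lambda>s. integral ?B (\<lambda>y. F (y + s *\<^sub>R v))) has_vector_derivative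
      integral ?B (\<lambda>y. F' (y + 0 *\<^sub>R v) v)) (at 0 within {-1<..<1})"
  proof (rule leibniz_rule_vector_derivative)
    fix s :: real and y
    have "((\<lambda>s. F (y + s *\<^sub>R v)) has_derivative (\<lambda>h. F' (y + s *\<^sub>R v) (h *\<^sub>R v))) (at s)"
      by (rule has_derivative_compose[OF _ der]) (auto intro!: derivative_eq_intros)
    moreover have "F' (y + s *\<^sub>R v) (h *\<^sub>R v) = h *\<^sub>R F' (y + s *\<^sub>R v) v" for h
      using has_derivative_linear[OF der] linear_cmul by blast
    ultimately have "((\<lambda>s. F (y + s *\<^sub>R v)) has_vector_derivative F' (y + s *\<^sub>R v) v) (at s)"
      by (simp add: has_vector_derivative_def)
    then show "((\<lambda>s. F (y + s *\<^sub>R v)) has_vector_derivative F' (y + s *\<^sub>R v) v) (at s within {-1<..<1})"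
      by (rule has_vector_derivative_at_within)
  next
    show "(\<lambda>y. F (y + s *\<^sub>R v)) integrable_on ?B" for s
      by (intro integrable_continuous continuous_on_compose2[OF Fcont] continuous_intros) auto
    show "continuous_on ({-1<..<1} \<times> ?B) (\<lambda>(s, y). F' (y + s *\<^sub>R v) v)"
      unfolding split_beta by (intro continuous_on_compose2[OF cont] continuous_intros) auto
  qed auto
  have d2: "((\<lambda>s. integral ?B (\<lambda>y. F (y + s *\<^sub>R v))) has_vector_derivative 0) (at 0 within {-1<..<1})"
    by (rule has_vector_derivative_transform[of 0 _ _ "\<lambda>s. I"]) (use const in auto)
  have at: "at 0 within {-1<..<1} = at (0::real)" by (rule at_within_open) auto
  have "integral ?B (\<lambda>y. F' (y + 0 *\<^sub>R v) v) = 0"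
    by (rule vector_derivative_unique_at[OF d1[unfolded at] d2[unfolded at]])
  then have 0: "integral ?B (\<lambda>y. F' y v) = 0" by simp
  have z: "F' x v = 0" if "x \<notin> cbox a b" for x
  proof -
    have "((\<lambda>x. 0) has_derivative F' x) (at x)"
      by (rule has_derivative_transform_within_open[OF der, of "- cbox a b"])
        (use that supp in \<open>auto simp: open_Compl closed_cbox\<close>)
    then have "F' x = (\<lambda>v. 0)"
      using has_derivative_unique[OF _ has_derivative_const] by blast
    then show ?thesis by simp
  qed
  have "integrable lborel (\<lambda>x. indicator (cbox a b) x *\<^sub>R F' x v)"
    by (intro borel_integrable_compact compact_cbox continuous_on_subset[OF cont]) auto
  moreover have "(\<lambda>x. indicator (cbox a b) x *\<^sub>R F' x v) = (\<lambda>x. F' x v)"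
    using z by (auto simp: fun_eq_iff split: split_indicator)
  ultimately show int: "integrable lborel (\<lambda>x. F' x v)" by simp
  have "((\<lambda>x. F' x v) has_integral 0) ?B"
    unfolding 0[symmetric]
    by (intro integrable_integral integrable_continuous continuous_on_subset[OF cont]) auto
  then have "((\<lambda>x. F' x v) has_integral 0) UNIV"
    by (rule has_integral_on_superset) (use ab z in auto)
  then show "(\<integral>x. F' x v \<partial>lborel) = 0"
    using integral_lborel[OF int] by (simp add: integral_unique)
qed

text \<open>The boxes form a generator of the Borel sets that is stable under intersections, so the integral
  vanishes over every Borel set.\<close>

lemma AE_zero_if_box_integrals_zero:
  fixes f :: "'b::euclidean_space \<Rightarrow> real"
  assumes f: "integrable lborel f"
    and box: "\<And>c d. (LINT x:box c d|lborel. f x) = 0"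
    and UN: "(LINT x|lborel. f x) = 0"
  shows "AE x in lborel. f x = 0"
proof -
  let ?E = "range (\<lambda>(a, b). box a b::'b set)"
  have fs: "set_integrable lborel A f" if "A \<in> sets borel" for A
    using integrable_mult_indicator[of A lborel f] f that by (simp add: set_integrable_def)
  have "(LINT x:A|lborel. f x) = 0" if "A \<in> sets borel" for A
  proof -
    have "Int_stable ?E" by (auto simp: Int_stable_def box_Int_box)
    moreover have "?E \<subseteq> Pow UNIV" by simp
    moreover have "A \<in> sigma_sets UNIV ?E" using that by (simp add: borel_eq_box)
    ultimately show ?thesis
    proof (induction rule: sigma_sets_induct_disjoint)
      case (basic A)
      then show ?case using box by auto
    next
      case empty
      then show ?case by (simp add: set_lebesgue_integral_def)
    next
      case (compl A)
      then have A: "A \<in> sets borel" by (simp add: borel_eq_box)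
      have "(LINT x:UNIV - A|lborel. f x) = (LINT x|lborel. f x - indicator A x *\<^sub>R f x)"
        unfolding set_lebesgue_integral_def by (intro Bochner_Integration.integral_cong) (auto split: split_indicator)
      also have "\<dots> = (LINT x|lborel. f x) - (LINT x:A|lborel. f x)"
        using fs[OF A] f by (simp add: set_lebesgue_integral_def set_integrable_def)
      finally show ?case using UN compl by simp
    next
      case (union A)
      then have A: "range A \<subseteq> sets borel" by (simp add: borel_eq_box)
      have "(LINT x:(\<Union>i. A i)|lborel. f x) = (\<Sum>i. (LINT x:(A i)|lborel. f x))"
        by (rule lebesgue_integral_countable_add)
          (use A union fs in \<open>auto simp: disjoint_family_on_def\<close>)
      then show ?case using union by simp
    qed
  qed
  then show ?thesis
    by (intro density_unique_real[OF f]) (auto simp: set_lebesgue_integral_def)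
qed

text \<open>Let a closed box lie in \<open>O'\<close>. Multiplying \<open>h\<close> by a bump function that is positive on the open box
  gives an integrable function \<open>f\<close>. Products of bump functions are admissible for \<open>h\<close>, hence \<open>f\<close> is
  orthogonal to the bump functions of all other boxes and, in the limit of infinite steepness, to their
  indicator functions. So \<open>f\<close> vanishes almost everywhere, and countably many boxes exhaust \<open>O'\<close>.\<close>

lemma fundamental_lemma_calculus_of_variations:
  fixes h :: "'b::euclidean_space \<Rightarrow> real"
  assumes O: "open O'"
    and h: "\<And>\<psi>. smooth_on_open UNIV \<psi> \<Longrightarrow> compact (closure {y. \<psi> y \<noteq> 0}) \<Longrightarrow> closure {y. \<psi> y \<noteq> 0} \<subseteq> O' \<Longrightarrow>
       integrable lborel (\<lambda>y. h y * \<psi> y) \<and> (\<integral>y. h y * \<psi> y \<partial>lborel) = 0"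
  shows "AE y in lborel. y \<in> O' \<longrightarrow> h y = 0"
proof -
  have box: "AE y in lborel. y \<in> box a b \<longrightarrow> h y = 0" if ab: "cbox a b \<subseteq> O'" for a b
  proof -
    let ?p = "box_bump 1 a b"
    define f where "f = (\<lambda>y. h y * ?p y)"
    have test: "integrable lborel (\<lambda>y. f y * \<psi> y) \<and> (\<integral>y. f y * \<psi> y \<partial>lborel) = 0"
      if "smooth_on_open UNIV \<psi>" for \<psi>
    proof -
      have *: "x \<in> cbox a b" if "?p x * \<psi> x \<noteq> 0" for x
        using box_bump_zero[of 1 x a b] that box_subset_cbox by (metis mult_zero_left subsetD zero_less_one)
      have "integrable lborel (\<lambda>y. h y * (?p y * \<psi> y)) \<and> (\<integral>y. h y * (?p y * \<psi> y) \<partial>lborel) = 0"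
        using closure_support_subset[of "\<lambda>x. ?p x * \<psi> x", OF *] ab
        by (intro h smooth_on_open_mult smooth_box_bump that) auto
      then show ?thesis by (simp add: f_def mult.assoc)
    qed
    have f: "integrable lborel f" "(LINT x|lborel. f x) = 0"
      using test[of "\<lambda>_. 1"] by (auto simp: smooth_on_open_const)
    have "(LINT x:box c d|lborel. f x) = 0" for c d
    proof -
      have "(\<lambda>n. \<integral>y. f y * box_bump (real n) c d y \<partial>lborel) \<longlonglongrightarrow> (\<integral>y. f y * indicator (box c d) y \<partial>lborel)"
      proof (rule integral_dominated_convergence[where w = "\<lambda>y. norm (f y)"])
        show "(\<lambda>y. f y * box_bump (real n) c d y) \<in> borel_measurable lborel" for n
          using test[OF smooth_box_bump] by blast
        show "AE x in lborel. (\<lambda>n. f x * box_bump (real n) c d x) \<longlonglongrightarrow> f x * indicator (box c d) x"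
          by (intro AE_I2 tendsto_mult tendsto_const box_bump_tendsto_indicator)
        show "AE x in lborel. norm (f x * box_bump (real n) c d x) \<le> norm (f x)" for n
          by (intro AE_I2) (simp add: abs_mult box_bump_nonneg box_bump_le_1 mult_left_le)
      qed (use f in auto)
      then have "(\<integral>y. f y * indicator (box c d) y \<partial>lborel) = 0"
        using test[OF smooth_box_bump] by (simp add: LIMSEQ_const_iff)
      then show ?thesis by (simp add: set_lebesgue_integral_def mult.commute)
    qed
    then have "AE y in lborel. f y = 0"
      by (intro AE_zero_if_box_integrals_zero f)
    then show ?thesis
      by eventually_elim (use box_bump_pos[of 1 _ a b] in \<open>force simp: f_def\<close>)
  qed
  define \<F> where "\<F> = {box a b | a b. cbox a b \<subseteq> O'}"
  have "\<And>S. S \<in> \<F> \<Longrightarrow> open S" by (auto simp: \<F>_def)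
  then obtain \<F>' where F': "\<F>' \<subseteq> \<F>" "countable \<F>'" "\<Union>\<F>' = \<Union>\<F>" by (rule Lindelof) blast+
  have U: "\<Union>\<F> = O'"
  proof
    show "O' \<subseteq> \<Union>\<F>"
    proof
      fix x assume "x \<in> O'"
      then obtain a b where "cbox a b \<subseteq> O'" "x \<in> box a b"
        using open_contains_cbox[OF O] by metis
      then show "x \<in> \<Union>\<F>" by (auto simp: \<F>_def)
    qed
  qed (auto simp: \<F>_def dest: subsetD[OF box_subset_cbox])
  have ae: "AE y in lborel. \<forall>S\<in>\<F>'. y \<in> S \<longrightarrow> h y = 0"
    using F' box by (intro AE_ball_countable[THEN iffD2]) (auto simp: \<F>_def)
  show ?thesis
    using ae
  proof eventually_elim
    case (elim y)
    show ?case
    proof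
      assume "y \<in> O'"
      then obtain S where "S \<in> \<F>'" "y \<in> S" unfolding U[symmetric] F'(3)[symmetric] by (rule UnionE)
      with elim show "h y = 0" by blast
    qed
  qed
qed

section \<open>Charts and the Riemannian metric\<close>

definition gnorm :: "('a, 'n::{finite,wellorder}) weighted_mfd \<Rightarrow> ('a, 'n) chart \<Rightarrow> 'a \<Rightarrow> real^'n::_ \<Rightarrow> real" where
  "gnorm M c x v = sqrt (v \<bullet> (metric M c x *v v))"

text \<open>This set refers to the chart \<open>c\<close> alone, whereas \<open>mfd_boundary M\<close> refers to all charts. Functions are
  localised below in open sets disjoint from \<open>mfd_boundary M\<close>, where coordinates lie in this set for
  every chart.\<close>

definition chart_int :: "('a, 'n::{finite,wellorder}) chart \<Rightarrow> (real^'n::_) set" where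
  "chart_int c = chart_img c \<inter> {y. 0 < y $ bdry_index}"

abbreviation overlap :: "('a, 'n) chart \<Rightarrow> ('a, 'n) chart \<Rightarrow> (real^'n) set" where
  "overlap c c' \<equiv> snd c ` (chart_dom c \<inter> chart_dom c')"

lemma convex_half_space: "convex half_space"
  unfolding half_space_def convex_def by (auto intro: add_nonneg_nonneg)

lemma quadratic_form_bound:
  fixes D :: "real^'n^'n"
  shows "\<bar>v \<bullet> (D *v v)\<bar> \<le> (\<Sum>i\<in>UNIV. \<Sum>j\<in>UNIV. \<bar>D $ i $ j\<bar>) * (norm v)\<^sup>2"
proof -
  have "v \<bullet> (D *v v) = (\<Sum>i\<in>UNIV. \<Sum>j\<in>UNIV. v $ i * (D $ i $ j * v $ j))"
    by (simp add: inner_vec_def matrix_vector_mult_def sum_distrib_left)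
  also have "\<bar>\<dots>\<bar> \<le> (\<Sum>i\<in>UNIV. \<Sum>j\<in>UNIV. \<bar>v $ i * (D $ i $ j * v $ j)\<bar>)"
    by (rule order_trans[OF sum_abs]) (intro sum_mono sum_abs)
  also have "\<dots> \<le> (\<Sum>i\<in>UNIV. \<Sum>j\<in>UNIV. \<bar>D $ i $ j\<bar> * (norm v)\<^sup>2)"
  proof (intro sum_mono)
    fix i j
    have "\<bar>v $ i\<bar> * \<bar>v $ j\<bar> \<le> norm v * norm v"
      by (intro mult_mono component_le_norm_cart) auto
    from mult_left_mono[OF this, of "\<bar>D $ i $ j\<bar>"]
    show "\<bar>v $ i * (D $ i $ j * v $ j)\<bar> \<le> \<bar>D $ i $ j\<bar> * (norm v)\<^sup>2"
      by (simp add: abs_mult power2_eq_square ac_simps)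
  qed
  finally show ?thesis by (simp add: sum_distrib_right)
qed

locale weighted_manifold =
  fixes M :: "('a::{second_countable_topology,t2_space}, 'n::{finite,wellorder}) weighted_mfd"
  assumes M: "compact_weighted_riemannian_manifold_with_boundary M"
begin

lemma compact_M: "compact (UNIV :: 'a set)"
  and atlas: "is_smooth_atlas (atlas M)"
  and metric: "is_riemannian_metric (atlas M) (metric M)"
  and volume: "is_riemannian_volume (atlas M) (metric M) (vol M)"
  and weight: "smooth_function M (weight M)"
  and total: "(\<integral>\<^sup>+x. ennreal (exp (- weight M x)) \<partial>vol M) = 1"
  using M by (auto simp: compact_weighted_riemannian_manifold_with_boundary_def)

lemma is_chart: "c \<in> atlas M \<Longrightarrow> is_chart c"
  using atlas by (auto simp: is_smooth_atlas_def)

lemma open_chart_dom: "c \<in> atlas M \<Longrightarrow> open (chart_dom c)"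
  using is_chart by (auto simp: is_chart_def)

lemma chart_homeo: "c \<in> atlas M \<Longrightarrow> homeomorphism (chart_dom c) (chart_img c) (snd c) (chart_inv c)"
  using is_chart by (auto simp: is_chart_def)

lemma chart_inv_left [simp]: "c \<in> atlas M \<Longrightarrow> x \<in> chart_dom c \<Longrightarrow> chart_inv c (snd c x) = x"
  using chart_homeo by (auto simp: homeomorphism_def)

lemma chart_inv_right [simp]: "c \<in> atlas M \<Longrightarrow> y \<in> chart_img c \<Longrightarrow> snd c (chart_inv c y) = y"
  using chart_homeo by (auto simp: homeomorphism_def)

lemma chart_inv_in: "c \<in> atlas M \<Longrightarrow> y \<in> chart_img c \<Longrightarrow> chart_inv c y \<in> chart_dom c"
  using chart_homeo[of c] inv_into_into[of y "snd c" "fst c"] by (simp add: chart_inv_def)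

lemma continuous_chart: "c \<in> atlas M \<Longrightarrow> continuous_on (chart_dom c) (snd c)"
  and continuous_chart_inv: "c \<in> atlas M \<Longrightarrow> continuous_on (chart_img c) (chart_inv c)"
  using chart_homeo by (auto simp: homeomorphism_def)

lemma chart_img_half_space: "c \<in> atlas M \<Longrightarrow> chart_img c \<subseteq> half_space"
  using is_chart[of c] openin_imp_subset unfolding is_chart_def by metis

lemma chart_nonneg: "c \<in> atlas M \<Longrightarrow> x \<in> chart_dom c \<Longrightarrow> 0 \<le> snd c x $ bdry_index"
  using chart_img_half_space[of c] unfolding half_space_def by blast

lemma chart_exists: "\<exists>c\<in>atlas M. x \<in> chart_dom c"
  using atlas by (auto simp: is_smooth_atlas_def)

lemma chart_at: "chart_at M x \<in> atlas M" "x \<in> chart_dom (chart_at M x)"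
  using someI_ex[of "\<lambda>c. c \<in> atlas M \<and> x \<in> chart_dom c"] chart_exists[of x]
  unfolding chart_at_def by blast+

lemma openin_chart_image:
  assumes c: "c \<in> atlas M" and V: "open V"
  shows "openin (top_of_set half_space) (snd c ` (chart_dom c \<inter> V))"
proof -
  have "snd c ` (chart_dom c \<inter> V) = chart_img c \<inter> chart_inv c -` V"
    using c by force
  moreover have "openin (top_of_set (chart_img c)) (chart_img c \<inter> chart_inv c -` V)"
    using continuous_chart_inv[OF c] V by (rule continuous_openin_preimage_gen)
  ultimately show ?thesis
    using is_chart[OF c] by (auto simp: is_chart_def intro: openin_trans)
qed

lemma chart_image_nbhd:
  assumes c: "c \<in> atlas M" and V: "open V" and x: "x \<in> chart_dom c" "x \<in> V"
  obtains r where "r > 0" "ball (snd c x) r \<inter> half_space \<subseteq> snd c ` (chart_dom c \<inter> V)"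
proof -
  obtain U where U: "open U" "snd c ` (chart_dom c \<inter> V) = half_space \<inter> U"
    using openin_chart_image[OF c V] by (auto simp: openin_open)
  then have "snd c x \<in> U" using x by blast
  then obtain r where "r > 0" "ball (snd c x) r \<subseteq> U" using U(1) openE by blast
  then show thesis using U(2) that[of r] by auto
qed

lemma open_chart_image_int:
  assumes "c \<in> atlas M" "open V"
  shows "open (snd c ` (chart_dom c \<inter> V) \<inter> {y. 0 < y $ bdry_index})"
proof -
  obtain U where U: "open U" "snd c ` (chart_dom c \<inter> V) = half_space \<inter> U"
    using openin_chart_image[OF assms] by (auto simp: openin_open)
  have "snd c ` (chart_dom c \<inter> V) \<inter> {y. 0 < y $ bdry_index} = U \<inter> {y. 0 < y $ bdry_index}"
    unfolding U(2) by (auto simp: half_space_def)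
  then show ?thesis
    using U(1) by (auto intro!: open_Collect_less continuous_intros)
qed

lemma open_chart_int: "c \<in> atlas M \<Longrightarrow> open (chart_int c)"
  using open_chart_image_int[of c UNIV] by (simp add: chart_int_def)

lemma open_chart_preimage:
  assumes "c \<in> atlas M" "open W"
  shows "open (chart_dom c \<inter> snd c -` W)"
  using continuous_open_preimage[OF continuous_chart open_chart_dom] assms by blast

lemma not_boundary: "c \<in> atlas M \<Longrightarrow> x \<in> chart_dom c \<Longrightarrow> x \<notin> mfd_boundary M \<Longrightarrow> snd c x \<in> chart_int c"
  using chart_nonneg[of c x] by (force simp: mfd_boundary_def chart_int_def)

lemma transition_extension:
  assumes "c \<in> atlas M" "c' \<in> atlas M" "x \<in> chart_dom c" "x \<in> chart_dom c'"
  obtains W F where "snd c x \<in> W" "smooth_on_open W F" "\<And>z. z \<in> W \<inter> overlap c c' \<Longrightarrow> F z = transition c c' z"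
  using atlas assms unfolding is_smooth_atlas_def smooth_on_set_def
  by (metis (no_types, lifting) IntI image_eqI)

lemma dtransition_has_derivative:
  assumes "c \<in> atlas M" "c' \<in> atlas M" "x \<in> chart_dom c" "x \<in> chart_dom c'"
  shows "(transition c c' has_derivative dtransition c c' x) (at (snd c x) within overlap c c')"
proof -
  obtain W F where F: "snd c x \<in> W" "smooth_on_open W F" "\<And>z. z \<in> W \<inter> overlap c c' \<Longrightarrow> F z = transition c c' z"
    using transition_extension[OF assms] by blast
  have W: "open W" using F(2) by (rule smooth_on_open_open)
  have "(F has_derivative frechet_derivative F (at (snd c x))) (at (snd c x) within W \<inter> overlap c c')"
    using smooth_on_open_has_derivative[OF F(2,1)] by (rule has_derivative_at_withinI)
  then have "(transition c c' has_derivative frechet_derivative F (at (snd c x))) (at (snd c x) within W \<inter> overlap c c')"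
    by (rule has_derivative_transform[rotated 2]) (use F assms in auto)
  moreover have "at (snd c x) within W \<inter> overlap c c' = at (snd c x) within overlap c c'"
    by (rule at_within_nhd[OF F(1) W]) auto
  ultimately have "transition c c' differentiable (at (snd c x) within overlap c c')"
    by (auto simp: differentiable_def)
  then show ?thesis
    by (simp add: dtransition_def frechet_derivative_works)
qed

lemma dtransition_linear:
  assumes "c \<in> atlas M" "c' \<in> atlas M" "x \<in> chart_dom c" "x \<in> chart_dom c'"
  shows "linear (dtransition c c' x)"
  using has_derivative_linear dtransition_has_derivative[OF assms] by blast

lemma transition_chart:
  assumes "c \<in> atlas M" "x \<in> chart_dom c"
  shows "transition c c' (snd c x) = snd c' x"
  using assms by (simp add: transition_def)

lemma metric_pos: "c \<in> atlas M \<Longrightarrow> x \<in> chart_dom c \<Longrightarrow> v \<noteq> 0 \<Longrightarrow> 0 < v \<bullet> (metric M c x *v v)"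
  using metric unfolding is_riemannian_metric_def by blast

lemma metric_transition:
  assumes "c \<in> atlas M" "c' \<in> atlas M" "x \<in> chart_dom c" "x \<in> chart_dom c'"
  shows "v \<bullet> (metric M c x *v w) = dtransition c c' x v \<bullet> (metric M c' x *v dtransition c c' x w)"
  using metric assms unfolding is_riemannian_metric_def by blast

lemma gnorm_nonneg: "c \<in> atlas M \<Longrightarrow> x \<in> chart_dom c \<Longrightarrow> 0 \<le> gnorm M c x v"
  unfolding gnorm_def using metric_pos[of c x v] by (cases "v = 0") (auto simp: less_imp_le)

lemma gnorm_pos: "c \<in> atlas M \<Longrightarrow> x \<in> chart_dom c \<Longrightarrow> v \<noteq> 0 \<Longrightarrow> 0 < gnorm M c x v"
  unfolding gnorm_def using metric_pos[of c x v] by simp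

lemma gnorm_power2: "c \<in> atlas M \<Longrightarrow> x \<in> chart_dom c \<Longrightarrow> (gnorm M c x v)\<^sup>2 = v \<bullet> (metric M c x *v v)"
  unfolding gnorm_def using metric_pos[of c x v] by (cases "v = 0") auto

lemma gnorm_scaleR: "gnorm M c x (r *\<^sub>R v) = \<bar>r\<bar> * gnorm M c x v"
proof -
  have "(r *\<^sub>R v) \<bullet> (metric M c x *v (r *\<^sub>R v)) = r\<^sup>2 * (v \<bullet> (metric M c x *v v))"
    by (simp add: matrix_vector_mult_scaleR power2_eq_square)
  then show ?thesis by (simp add: gnorm_def real_sqrt_mult)
qed

lemma gnorm_transition:
  assumes "c \<in> atlas M" "c' \<in> atlas M" "x \<in> chart_dom c" "x \<in> chart_dom c'"
  shows "gnorm M c' x (dtransition c c' x v) = gnorm M c x v"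
  unfolding gnorm_def using metric_transition[OF assms] by simp

text \<open>The differential of a change of charts preserves the positive definite metric and is thus
  injective; the dimensions agree.\<close>

lemma dtransition_surj:
  assumes "c \<in> atlas M" "c' \<in> atlas M" "x \<in> chart_dom c" "x \<in> chart_dom c'"
  shows "surj (dtransition c c' x)"
proof (rule linear_injective_imp_surjective[OF dtransition_linear[OF assms]])
  show "inj (dtransition c c' x)"
    unfolding linear_injective_0[OF dtransition_linear[OF assms]]
  proof (intro allI impI)
    fix v assume "dtransition c c' x v = 0"
    then have "gnorm M c x v = 0" using gnorm_transition[OF assms, of v] by (simp add: gnorm_def)
    then show "v = 0" using gnorm_pos[OF assms(1,3), of v] by force
  qed
qed simp

lemma tangent_norm_gnorm: "tangent_norm M x V = gnorm M (chart_at M x) x (V (chart_at M x))"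
  by (simp add: tangent_norm_def gnorm_def Let_def)

lemma continuous_metric:
  assumes "c \<in> atlas M"
  shows "continuous_on (chart_img c) (\<lambda>y. metric M c (chart_inv c y))"
  unfolding continuous_on_eq_continuous_within
proof
  fix y assume y: "y \<in> chart_img c"
  have "smooth_on_set (chart_img c) (\<lambda>y. metric M c (chart_inv c y))"
    using metric assms unfolding is_riemannian_metric_def by simp
  then obtain W F where F: "y \<in> W" "smooth_on_open W F" "\<forall>z\<in>W \<inter> chart_img c. F z = metric M c (chart_inv c z)"
    using y unfolding smooth_on_set_def by metis
  have "isCont F y"
    using smooth_on_open_continuous[OF F(2)] smooth_on_open_open[OF F(2)] F(1)
    by (simp add: continuous_on_eq_continuous_at)
  then have cF: "continuous (at y within chart_img c) F" by (rule continuous_at_imp_continuous_at_within)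
  obtain d where d: "d > 0" "ball y d \<subseteq> W"
    using smooth_on_open_open[OF F(2)] F(1) by (rule openE)
  show "continuous (at y within chart_img c) (\<lambda>y. metric M c (chart_inv c y))"
  proof (rule continuous_transform_within[OF cF d(1) y])
    show "F y' = metric M c (chart_inv c y')" if "y' \<in> chart_img c" "dist y' y < d" for y'
    proof -
      have "y' \<in> ball y d" using that(2) by (simp add: dist_commute)
      then have "y' \<in> W \<inter> chart_img c" using d(2) that(1) by blast
      then show ?thesis using F(3) by (rule bspec[rotated])
    qed
  qed
qed

lemma gnorm_lower_bound:
  assumes "c \<in> atlas M" "x \<in> chart_dom c"
  obtains m where "m > 0" "\<And>v. m * (norm v)\<^sup>2 \<le> v \<bullet> (metric M c x *v v)"
proof -
  let ?q = "\<lambda>v. v \<bullet> (metric M c x *v v)"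
  have "continuous_on (sphere 0 1) ?q" by (intro continuous_intros)
  moreover have "sphere (0::real^'n::{finite,wellorder}) 1 \<noteq> {}" by simp
  ultimately obtain u where u: "u \<in> sphere 0 1" "\<And>v. v \<in> sphere 0 1 \<Longrightarrow> ?q u \<le> ?q v"
    using continuous_attains_inf[OF compact_sphere, of 0 1 ?q] by blast
  have "u \<noteq> 0" using u(1) by auto
  show thesis
  proof (rule that[of "?q u"])
    show "0 < ?q u" using metric_pos[OF assms \<open>u \<noteq> 0\<close>] .
    show "?q u * (norm v)\<^sup>2 \<le> ?q v" for v
    proof (cases "v = 0")
      case False
      have "?q ((1 / norm v) *\<^sub>R v) = (1 / norm v)\<^sup>2 * ?q v"
        by (simp add: matrix_vector_mult_scaleR power2_eq_square)
      moreover have "?q u \<le> ?q ((1 / norm v) *\<^sub>R v)"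
        using False by (intro u(2)) simp
      ultimately have "?q u \<le> (1 / norm v)\<^sup>2 * ?q v" by linarith
      then have "?q u * (norm v)\<^sup>2 \<le> ((1 / norm v)\<^sup>2 * ?q v) * (norm v)\<^sup>2"
        by (rule mult_right_mono) simp
      also have "\<dots> = ?q v" using False by (simp add: power_divide)
      finally show ?thesis .
    qed simp
  qed
qed

text \<open>The form \<open>v \<bullet> (metric M c x *v v)\<close> dominates a multiple of \<open>(norm v)\<^sup>2\<close>, while the forms at
  nearby points differ from it by a small multiple of \<open>(norm v)\<^sup>2\<close>, since the coefficients are
  continuous. Hence the frozen norm at \<open>x\<close> may replace the variable one.\<close>

lemma metric_nearly_constant:
  assumes c: "c \<in> atlas M" "x \<in> chart_dom c" and V: "open V" "x \<in> V" and d: "\<delta> > 0"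
  obtains R where "R > 0" "ball (snd c x) R \<inter> half_space \<subseteq> snd c ` (chart_dom c \<inter> V)"
    "\<And>y v. y \<in> ball (snd c x) R \<inter> half_space \<Longrightarrow> gnorm M c (chart_inv c y) v \<le> (1 + \<delta>) * gnorm M c x v"
    "\<And>y v. y \<in> ball (snd c x) R \<inter> half_space \<Longrightarrow> gnorm M c x v \<le> (1 + \<delta>) * gnorm M c (chart_inv c y) v"
proof -
  obtain r where r: "r > 0" "ball (snd c x) r \<inter> half_space \<subseteq> snd c ` (chart_dom c \<inter> V)"
    using chart_image_nbhd[OF c(1) V(1) c(2) V(2)] .
  obtain m where m: "m > 0" "\<And>v. m * (norm v)\<^sup>2 \<le> v \<bullet> (metric M c x *v v)"
    using gnorm_lower_bound[OF c] by blast
  define \<kappa> where "\<kappa> = \<delta> / (1 + \<delta>)"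
  have k: "0 < \<kappa>" "\<kappa> < 1" "\<kappa> \<le> \<delta>" "(1 - \<kappa>) * (1 + \<delta>) = 1" using d by (auto simp: \<kappa>_def field_simps)
  let ?g = "\<lambda>y. metric M c (chart_inv c y)" and ?G = "metric M c x"
  define s where "s = (\<lambda>y. \<Sum>i\<in>UNIV. \<Sum>j\<in>UNIV. \<bar>(?g y - ?G) $ i $ j\<bar>)"
  have "continuous_on (chart_img c) s"
    unfolding s_def by (intro continuous_intros continuous_metric c)
  moreover have "s (snd c x) = 0" using c by (simp add: s_def)
  moreover have "snd c x \<in> chart_img c" using c by auto
  ultimately obtain r' where r': "r' > 0" "\<And>y. y \<in> chart_img c \<Longrightarrow> dist y (snd c x) < r' \<Longrightarrow> \<bar>s y\<bar> < m * \<kappa>"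
    using m k unfolding continuous_on_iff dist_real_def by (metis diff_zero mult_pos_pos)
  define R where "R = min r r'"
  have main: "\<bar>v \<bullet> (?g y *v v) - v \<bullet> (?G *v v)\<bar> \<le> \<kappa> * (v \<bullet> (?G *v v))" "chart_inv c y \<in> chart_dom c"
    if y: "y \<in> ball (snd c x) R \<inter> half_space" for y v
  proof -
    have "y \<in> chart_img c" using y r by (auto simp: R_def)
    moreover have "dist y (snd c x) < r'" using y by (simp add: R_def dist_commute)
    ultimately have s: "\<bar>s y\<bar> < m * \<kappa>" by (rule r')
    have "\<bar>v \<bullet> (?g y *v v) - v \<bullet> (?G *v v)\<bar> = \<bar>v \<bullet> ((?g y - ?G) *v v)\<bar>"
      by (simp add: matrix_vector_mult_diff_rdistrib inner_diff_right)
    also have "\<dots> \<le> s y * (norm v)\<^sup>2" unfolding s_def by (rule quadratic_form_bound)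
    also have "\<dots> \<le> (m * \<kappa>) * (norm v)\<^sup>2" using s by (intro mult_right_mono) auto
    also have "\<dots> \<le> \<kappa> * (v \<bullet> (?G *v v))" using mult_left_mono[OF m(2)[of v], of \<kappa>] k by (simp add: ac_simps)
    finally show "\<bar>v \<bullet> (?g y *v v) - v \<bullet> (?G *v v)\<bar> \<le> \<kappa> * (v \<bullet> (?G *v v))" .
    show "chart_inv c y \<in> chart_dom c" using \<open>y \<in> chart_img c\<close> c chart_inv_in by blast
  qed
  have q: "0 \<le> v \<bullet> (?G *v v)" for v using m(2)[of v] m(1) by (meson order_trans mult_nonneg_nonneg less_imp_le zero_le_power2)
  show thesis
  proof (rule that[of R])
    show "R > 0" using r r' by (simp add: R_def)
    show "ball (snd c x) R \<inter> half_space \<subseteq> snd c ` (chart_dom c \<inter> V)"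
      using r(2) by (auto simp: R_def)
    fix y v assume y: "y \<in> ball (snd c x) R \<inter> half_space"
    have 1: "v \<bullet> (?g y *v v) \<le> (1 + \<delta>) * (v \<bullet> (?G *v v))"
    proof -
      have "v \<bullet> (?g y *v v) \<le> (1 + \<kappa>) * (v \<bullet> (?G *v v))" using main(1)[OF y, of v] by (simp add: algebra_simps)
      also have "\<dots> \<le> (1 + \<delta>) * (v \<bullet> (?G *v v))" using k q by (intro mult_right_mono) auto
      finally show ?thesis .
    qed
    have 2: "v \<bullet> (?G *v v) \<le> (1 + \<delta>) * (v \<bullet> (?g y *v v))"
    proof -
      have "(1 - \<kappa>) * (v \<bullet> (?G *v v)) \<le> v \<bullet> (?g y *v v)" using main(1)[OF y, of v] by (simp add: algebra_simps)
      from mult_left_mono[OF this, of "1 + \<delta>"] have "((1 - \<kappa>) * (1 + \<delta>)) * (v \<bullet> (?G *v v)) \<le> (1 + \<delta>) * (v \<bullet> (?g y *v v))"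
        using d by (simp add: ac_simps)
      then show ?thesis using k by simp
    qed
    have qy: "0 \<le> v \<bullet> (?g y *v v)" using gnorm_power2[OF c(1) main(2)[OF y], of v] by (metis zero_le_power2)
    have sq: "sqrt (1 + \<delta>) \<le> 1 + \<delta>" using d by (simp add: sqrt_le_D real_le_lsqrt power2_eq_square)
    have "sqrt (v \<bullet> (?g y *v v)) \<le> sqrt (1 + \<delta>) * sqrt (v \<bullet> (?G *v v))"
      using 1 by (simp flip: real_sqrt_mult)
    also have "\<dots> \<le> (1 + \<delta>) * sqrt (v \<bullet> (?G *v v))" using sq q by (intro mult_right_mono) auto
    finally show "gnorm M c (chart_inv c y) v \<le> (1 + \<delta>) * gnorm M c x v" by (simp add: gnorm_def)
    have "sqrt (v \<bullet> (?G *v v)) \<le> sqrt (1 + \<delta>) * sqrt (v \<bullet> (?g y *v v))"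
      using 2 by (simp flip: real_sqrt_mult)
    also have "\<dots> \<le> (1 + \<delta>) * sqrt (v \<bullet> (?g y *v v))" using sq qy by (intro mult_right_mono) auto
    finally show "gnorm M c x v \<le> (1 + \<delta>) * gnorm M c (chart_inv c y) v" by (simp add: gnorm_def)
  qed
qed

end

section \<open>Curves and the Riemannian distance\<close>

lemma C1_differentiable_on_local:
  assumes "\<And>t. t \<in> T \<Longrightarrow> \<exists>U. open U \<and> t \<in> U \<and> f C1_differentiable_on U"
  shows "f C1_differentiable_on T"
  unfolding C1_differentiable_on_eq
proof (intro conjI ballI)
  show "f differentiable at t" if "t \<in> T" for t
    using assms[OF that] unfolding C1_differentiable_on_eq by blast
  have "isCont (\<lambda>x. vector_derivative f (at x)) t" if t: "t \<in> T" for t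
  proof -
    obtain U where U: "open U" "t \<in> U" "continuous_on U (\<lambda>x. vector_derivative f (at x))"
      using assms[OF t] unfolding C1_differentiable_on_eq by blast
    then show ?thesis by (simp add: continuous_on_eq_continuous_at)
  qed
  then show "continuous_on T (\<lambda>x. vector_derivative f (at x))"
    by (simp add: continuous_at_imp_continuous_on)
qed

lemma C1_differentiable_on_cong_open:
  assumes "open T" "f C1_differentiable_on T" "\<And>t. t \<in> T \<Longrightarrow> f t = g t"
  shows "g C1_differentiable_on T"
proof -
  obtain D where D: "\<And>t. t \<in> T \<Longrightarrow> (f has_vector_derivative D t) (at t)" "continuous_on T D"
    using assms(2) unfolding C1_differentiable_on_def by blast
  have "(g has_vector_derivative D t) (at t)" if "t \<in> T" for t
    by (rule has_vector_derivative_transform_within_open[OF D(1)[OF that] assms(1) that assms(3)])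
  then show ?thesis using D(2) unfolding C1_differentiable_on_def by blast
qed

lemma unit_interval_diff: "{0, 1} \<subseteq> S \<Longrightarrow> {0..1::real} - S = {0<..<1} - S"
  by (auto simp: less_le)

context weighted_manifold
begin

abbreviation speed :: "(real \<Rightarrow> 'a) \<Rightarrow> real \<Rightarrow> real" where
  "speed \<gamma> t \<equiv> tangent_norm M (\<gamma> t) (velocity \<gamma> t)"

text \<open>The set of exceptional parameters is made explicit, because it has to be transported along
  reparametrisations and enlarged when curves are joined.\<close>

definition curve_off :: "real set \<Rightarrow> (real \<Rightarrow> 'a) \<Rightarrow> bool" where
  "curve_off S \<gamma> \<longleftrightarrow> continuous_on {0..1} \<gamma> \<and> finite S \<and> {0, 1} \<subseteq> S \<and>
     (\<forall>c\<in>atlas M. (snd c \<circ> \<gamma>) C1_differentiable_on {t \<in> {0..1} - S. \<gamma> t \<in> chart_dom c})"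

lemma piecewise_C1_curve_iff: "piecewise_C1_curve M \<gamma> \<longleftrightarrow> (\<exists>S. curve_off S \<gamma>)"
  by (auto simp: piecewise_C1_curve_def curve_off_def)

lemma open_regular_parameters:
  assumes "curve_off S \<gamma>"
  shows "open ({0..1} - S)"
proof -
  have "{0..1} - S = {0<..<1} - S" using assms by (intro unit_interval_diff) (simp add: curve_off_def)
  then show ?thesis using assms by (auto simp: curve_off_def intro: open_Diff finite_imp_closed)
qed

lemma open_curve_preimage:
  assumes "curve_off S \<gamma>" "open V"
  shows "open {t \<in> {0..1} - S. \<gamma> t \<in> V}"
proof -
  have "continuous_on ({0..1} - S) \<gamma>"
    using assms by (auto simp: curve_off_def intro: continuous_on_subset)
  from continuous_open_preimage[OF this open_regular_parameters[OF assms(1)] assms(2)]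
  show ?thesis by (simp add: vimage_def Int_def)
qed

lemma velocity_chart:
  assumes "curve_off S \<gamma>" "c \<in> atlas M" "t \<in> {0..1} - S" "\<gamma> t \<in> chart_dom c"
  shows "((snd c \<circ> \<gamma>) has_vector_derivative velocity \<gamma> t c) (at t)"
proof -
  have "(snd c \<circ> \<gamma>) C1_differentiable_on {t \<in> {0..1} - S. \<gamma> t \<in> chart_dom c}"
    using assms(1,2) by (simp add: curve_off_def)
  then have "(snd c \<circ> \<gamma>) differentiable (at t)"
    using assms(3,4) unfolding C1_differentiable_on_eq by blast
  then show ?thesis unfolding velocity_def by (simp add: vector_derivative_works)
qed

text \<open>The curve may touch the boundary, where the transition map is only differentiable within the half
  space. Since the curve stays in the half space, the chain rule along the set of regular parameters
  still applies.\<close>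

lemma velocity_transition:
  assumes \<gamma>: "curve_off S \<gamma>" and c: "c \<in> atlas M" "c' \<in> atlas M" and t: "t \<in> {0..1} - S"
    and dom: "\<gamma> t \<in> chart_dom c" "\<gamma> t \<in> chart_dom c'"
  shows "velocity \<gamma> t c' = dtransition c c' (\<gamma> t) (velocity \<gamma> t c)"
proof -
  let ?U = "{t \<in> {0..1} - S. \<gamma> t \<in> chart_dom c \<inter> chart_dom c'}"
  have U: "open ?U" by (intro open_curve_preimage[OF \<gamma>] open_Int open_chart_dom c)
  have tU: "t \<in> ?U" using t dom by simp
  have "((snd c \<circ> \<gamma>) has_derivative (\<lambda>h. h *\<^sub>R velocity \<gamma> t c)) (at t within ?U)"
    using velocity_chart[OF \<gamma> c(1) t dom(1)] by (auto simp: has_vector_derivative_def intro: has_derivative_at_withinI)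
  moreover have "(transition c c' has_derivative dtransition c c' (\<gamma> t)) (at ((snd c \<circ> \<gamma>) t) within (snd c \<circ> \<gamma>) ` ?U)"
    using dtransition_has_derivative[OF c dom] by (simp, rule has_derivative_subset) auto
  ultimately have "((\<lambda>s. transition c c' ((snd c \<circ> \<gamma>) s)) has_derivative (\<lambda>h. dtransition c c' (\<gamma> t) (h *\<^sub>R velocity \<gamma> t c))) (at t within ?U)"
    by (rule has_derivative_in_compose)
  moreover have "at t within ?U = at t" by (rule at_within_open[OF tU U])
  ultimately have "((\<lambda>s. transition c c' ((snd c \<circ> \<gamma>) s)) has_derivative (\<lambda>h. dtransition c c' (\<gamma> t) (h *\<^sub>R velocity \<gamma> t c))) (at t)"
    by simp
  then have "((snd c' \<circ> \<gamma>) has_derivative (\<lambda>h. dtransition c c' (\<gamma> t) (h *\<^sub>R velocity \<gamma> t c))) (at t)"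
    by (rule has_derivative_transform_within_open[OF _ U tU]) (simp add: transition_chart c)
  then have "((snd c' \<circ> \<gamma>) has_vector_derivative dtransition c c' (\<gamma> t) (velocity \<gamma> t c)) (at t)"
    by (simp add: has_vector_derivative_def linear_cmul[OF dtransition_linear[OF c dom]])
  then show ?thesis
    using vector_derivative_unique_at[OF velocity_chart[OF \<gamma> c(2) t dom(2)]] by blast
qed

lemma speed_chart:
  assumes "curve_off S \<gamma>" "c \<in> atlas M" "t \<in> {0..1} - S" "\<gamma> t \<in> chart_dom c"
  shows "speed \<gamma> t = gnorm M c (\<gamma> t) (velocity \<gamma> t c)"
proof -
  let ?c = "chart_at M (\<gamma> t)"
  have *: "?c \<in> atlas M" "\<gamma> t \<in> chart_dom ?c" by (rule chart_at)+
  show ?thesis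
    unfolding tangent_norm_gnorm velocity_transition[OF assms(1,2) *(1) assms(3,4) *(2)]
    by (rule gnorm_transition[OF assms(2) *(1) assms(4) *(2)])
qed

lemma speed_nonneg: "0 \<le> speed \<gamma> t"
  unfolding tangent_norm_gnorm by (rule gnorm_nonneg[OF chart_at])

lemma continuous_speed:
  assumes \<gamma>: "curve_off S \<gamma>"
  shows "continuous_on ({0..1} - S) (speed \<gamma>)"
proof -
  have "isCont (speed \<gamma>) t" if t: "t \<in> {0..1} - S" for t
  proof -
    let ?c = "chart_at M (\<gamma> t)"
    let ?U = "{t \<in> {0..1} - S. \<gamma> t \<in> chart_dom ?c}"
    have c: "?c \<in> atlas M" "\<gamma> t \<in> chart_dom ?c" by (rule chart_at)+
    have U: "open ?U" "t \<in> ?U" using t c by (simp_all add: open_curve_preimage[OF \<gamma> open_chart_dom[OF c(1)], simplified])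
    have cv: "continuous_on ?U (\<lambda>s. velocity \<gamma> s ?c)"
      using \<gamma> c(1) unfolding curve_off_def C1_differentiable_on_eq velocity_def by blast
    have cg: "continuous_on ?U \<gamma>" using \<gamma> by (auto simp: curve_off_def intro: continuous_on_subset)
    have "continuous_on ?U (\<lambda>s. metric M ?c (chart_inv ?c (snd ?c (\<gamma> s))))"
      by (rule continuous_on_compose2[OF continuous_metric[OF c(1)] continuous_on_compose2[OF continuous_chart[OF c(1)] cg]]) auto
    then have cm: "continuous_on ?U (\<lambda>s. metric M ?c (\<gamma> s))"
      by (rule continuous_on_eq) (use c in auto)
    have "continuous_on ?U (\<lambda>s. gnorm M ?c (\<gamma> s) (velocity \<gamma> s ?c))"
      unfolding gnorm_def inner_vec_def matrix_vector_mult_def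
      using cv cm by (auto intro!: continuous_intros)
    then have "continuous_on ?U (speed \<gamma>)"
      by (rule continuous_on_eq) (use speed_chart[OF \<gamma> c(1)] in auto)
    then show ?thesis using U by (simp add: continuous_on_eq_continuous_at)
  qed
  then show ?thesis by (simp add: continuous_at_imp_continuous_on)
qed

text \<open>The integrand of the length, restricted to the parameters where it is continuous; unlike the
  speed itself it is known to be Borel measurable.\<close>

definition speed_off :: "real set \<Rightarrow> (real \<Rightarrow> 'a) \<Rightarrow> real \<Rightarrow> ennreal" where
  "speed_off S \<gamma> t = ennreal (indicator ({0..1} - S) t *\<^sub>R speed \<gamma> t)"

lemma measurable_speed_off: "curve_off S \<gamma> \<Longrightarrow> speed_off S \<gamma> \<in> borel_measurable borel"
  unfolding speed_off_def[abs_def]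
  using borel_measurable_continuous_on_indicator[OF borel_open[OF open_regular_parameters] continuous_speed]
  by auto

lemma AE_not_exceptional: "finite S \<Longrightarrow> AE t in lborel. (t::real) \<notin> S"
  by (intro AE_not_in finite_imp_null_set_lborel)

lemma curve_length_speed_off:
  assumes "curve_off S \<gamma>"
  shows "curve_length M \<gamma> = (\<integral>\<^sup>+t. speed_off S \<gamma> t \<partial>lborel)"
  unfolding curve_length_def
proof (rule nn_integral_cong_AE)
  have "finite S" using assms by (simp add: curve_off_def)
  show "AE t in lborel. ennreal (speed \<gamma> t) * indicator {0..1} t = speed_off S \<gamma> t"
    using AE_not_exceptional[OF \<open>finite S\<close>]
    by eventually_elim (auto simp: speed_off_def split: split_indicator)
qed

text \<open>Both the reversal and the joining of curves consist of affine reparametrisations on open sets of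
  parameters; the chain rule scales the speed.\<close>

lemma affine_reparam:
  assumes \<gamma>: "curve_off S \<gamma>" and V: "open V" and r: "r \<noteq> 0"
    and eq: "\<And>t. t \<in> V \<Longrightarrow> \<eta> t = \<gamma> (r * t + s) \<and> r * t + s \<in> {0..1} - S"
    and c: "c \<in> atlas M"
  shows "(snd c \<circ> \<eta>) C1_differentiable_on {t \<in> V. \<eta> t \<in> chart_dom c}"
    and "t \<in> V \<Longrightarrow> speed \<eta> t = \<bar>r\<bar> * speed \<gamma> (r * t + s)"
proof -
  let ?f = "\<lambda>t. r * t + s"
  have f': "(?f has_vector_derivative r) (at t)" for t
    by (auto intro!: derivative_eq_intros simp: has_real_derivative_iff_has_vector_derivative[symmetric])
  let ?T = "\<lambda>c. {t \<in> V. \<eta> t \<in> chart_dom c}"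
  have T_eq: "?T c = V \<inter> ?f -` {t \<in> {0..1} - S. \<gamma> t \<in> chart_dom c}" for c
    using eq by auto
  have T: "open (?T c)" if "c \<in> atlas M" for c
    unfolding T_eq by (intro open_Int V open_vimage open_curve_preimage[OF \<gamma>] open_chart_dom that continuous_intros)
  show "(snd c \<circ> \<eta>) C1_differentiable_on ?T c"
  proof (rule C1_differentiable_on_cong_open[OF T[OF c]])
    show "((snd c \<circ> \<gamma>) \<circ> ?f) C1_differentiable_on ?T c"
    proof (rule C1_differentiable_compose)
      show "?f C1_differentiable_on ?T c"
        unfolding C1_differentiable_on_def using f' by (intro exI[of _ "\<lambda>_. r"]) auto
      have "?f ` ?T c \<subseteq> {t \<in> {0..1} - S. \<gamma> t \<in> chart_dom c}" unfolding T_eq by auto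
      then show "(snd c \<circ> \<gamma>) C1_differentiable_on ?f ` ?T c"
        using \<gamma> c C1_differentiable_on_subset unfolding curve_off_def by blast
      show "finite (?T c \<inter> ?f -` {x})" for x
        by (rule finite_subset[of _ "{(x - s) / r}"]) (use r in \<open>auto simp: field_simps\<close>)
    qed
  qed (use eq in auto)
  assume t: "t \<in> V"
  let ?c = "chart_at M (\<eta> t)"
  have ch: "?c \<in> atlas M" "\<eta> t \<in> chart_dom ?c" by (rule chart_at)+
  have e: "\<eta> t = \<gamma> (?f t)" "?f t \<in> {0..1} - S" using eq t by auto
  have "((snd ?c \<circ> \<gamma>) has_vector_derivative velocity \<gamma> (?f t) ?c) (at (?f t))"
    using velocity_chart[OF \<gamma> ch(1) e(2)] ch(2) e(1) by simp
  from vector_diff_chain_at[OF f'[of t] this]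
  have "((snd ?c \<circ> \<gamma>) \<circ> ?f has_vector_derivative r *\<^sub>R velocity \<gamma> (?f t) ?c) (at t)" .
  then have "(snd ?c \<circ> \<eta> has_vector_derivative r *\<^sub>R velocity \<gamma> (?f t) ?c) (at t)"
    by (rule has_vector_derivative_transform_within_open[OF _ V t]) (use eq in auto)
  then have "velocity \<eta> t ?c = r *\<^sub>R velocity \<gamma> (?f t) ?c"
    unfolding velocity_def[of \<eta>] by (rule vector_derivative_at)
  then show "speed \<eta> t = \<bar>r\<bar> * speed \<gamma> (?f t)"
    by (simp add: tangent_norm_gnorm gnorm_scaleR e(1))
qed

lemma curve_reverse:
  assumes \<gamma>: "curve_off S \<gamma>"
  obtains S' where "curve_off S' (\<lambda>t. \<gamma> (1 - t))" "curve_length M (\<lambda>t. \<gamma> (1 - t)) = curve_length M \<gamma>"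
proof -
  let ?\<eta> = "\<lambda>t. \<gamma> (1 - t)"
  define S' where "S' = (\<lambda>t. 1 - t) ` S"
  have S': "1 - t \<in> S \<longleftrightarrow> t \<in> S'" for t by (force simp: S'_def)
  have S: "finite S" "{0,1} \<subseteq> S" "continuous_on {0..1} \<gamma>" using \<gamma> by (auto simp: curve_off_def)
  have fin: "finite S'" "{0,1} \<subseteq> S'" using S S'[of 0] S'[of 1] by (auto simp: S'_def)
  let ?V = "{0..1} - S'"
  have V: "open ?V"
  proof -
    have "?V = {0<..<1} - S'" by (rule unit_interval_diff[OF fin(2)])
    then show ?thesis using fin(1) by (simp add: open_Diff finite_imp_closed)
  qed
  have eq: "?\<eta> t = \<gamma> (-1 * t + 1) \<and> -1 * t + 1 \<in> {0..1} - S" if "t \<in> ?V" for t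
    using that S'[of t] by auto
  have "curve_off S' ?\<eta>"
    unfolding curve_off_def
  proof (intro conjI ballI)
    show "continuous_on {0..1} ?\<eta>"
      by (intro continuous_on_compose2[OF S(3)] continuous_intros) auto
    show "(snd c \<circ> ?\<eta>) C1_differentiable_on {t \<in> ?V. ?\<eta> t \<in> chart_dom c}" if "c \<in> atlas M" for c
      using affine_reparam(1)[OF \<gamma> V _ eq that] by simp
  qed (use fin in auto)
  moreover have "curve_length M ?\<eta> = curve_length M \<gamma>"
  proof -
    have "speed_off S' ?\<eta> t = speed_off S \<gamma> (1 + -1 * t)" for t
      using affine_reparam(2)[OF \<gamma> V _ eq chart_at(1), of t] S'[of t]
      by (auto simp: speed_off_def algebra_simps split: split_indicator)
    then have "(\<integral>\<^sup>+t. speed_off S' ?\<eta> t \<partial>lborel) = (\<integral>\<^sup>+t. speed_off S \<gamma> t \<partial>lborel)"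
      using nn_integral_real_affine[OF measurable_speed_off[OF \<gamma>], of "-1" 1] by simp
    then show ?thesis
      unfolding curve_length_speed_off[OF \<gamma>] curve_length_speed_off[OF \<open>curve_off S' ?\<eta>\<close>] .
  qed
  ultimately show thesis by (rule that)
qed

lemma curve_join:
  assumes \<gamma>1: "curve_off S1 \<gamma>1" and \<gamma>2: "curve_off S2 \<gamma>2" and mid: "\<gamma>1 1 = \<gamma>2 0"
  obtains S \<gamma> where "curve_off S \<gamma>" "\<gamma> 0 = \<gamma>1 0" "\<gamma> 1 = \<gamma>2 1"
    "curve_length M \<gamma> = curve_length M \<gamma>1 + curve_length M \<gamma>2"
proof -
  define \<gamma> where "\<gamma> = (\<lambda>t::real. if t \<le> 1/2 then \<gamma>1 (2 * t) else \<gamma>2 (2 * t - 1))"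
  define S where "S = {0, 1/2, 1} \<union> (\<lambda>t. t / 2) ` S1 \<union> (\<lambda>t. (t + 1) / 2) ` S2"
  have S1: "finite S1" "{0,1} \<subseteq> S1" "continuous_on {0..1} \<gamma>1" using \<gamma>1 by (auto simp: curve_off_def)
  have S2: "finite S2" "{0,1} \<subseteq> S2" "continuous_on {0..1} \<gamma>2" using \<gamma>2 by (auto simp: curve_off_def)
  have inS: "t \<in> S" if "2 * t \<in> S1 \<or> 2 * t - 1 \<in> S2" for t
    using that
  proof
    assume "2 * t \<in> S1"
    then have "t \<in> (\<lambda>t. t / 2) ` S1" by (rule rev_image_eqI) simp
    then show ?thesis by (simp add: S_def)
  next
    assume "2 * t - 1 \<in> S2"
    then have "t \<in> (\<lambda>t. (t + 1) / 2) ` S2" by (rule rev_image_eqI) simp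
    then show ?thesis by (simp add: S_def)
  qed
  have S: "finite S" "{0,1} \<subseteq> S" "1/2 \<in> S" using S1 S2 by (auto simp: S_def)
  let ?V1 = "{0<..<1/2} - S" and ?V2 = "{1/2<..<1} - S"
  have V: "open ?V1" "open ?V2" "{0..1} - S = ?V1 \<union> ?V2"
  proof -
    show "open ?V1" "open ?V2" using S by (auto intro: open_Diff finite_imp_closed)
    have "t \<in> ?V1 \<union> ?V2" if "t \<in> {0..1} - S" for t
    proof -
      have "t \<noteq> 0" "t \<noteq> 1" "t \<noteq> 1/2" using that S by blast+
      then show ?thesis using that by auto
    qed
    moreover have "?V1 \<union> ?V2 \<subseteq> {0..1} - S" by auto
    ultimately show "{0..1} - S = ?V1 \<union> ?V2" by blast
  qed
  have eq1: "\<gamma> t = \<gamma>1 (2 * t + 0) \<and> 2 * t + 0 \<in> {0..1} - S1" if "t \<in> ?V1" for t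
    using that inS[of t] by (auto simp: \<gamma>_def)
  have eq2: "\<gamma> t = \<gamma>2 (2 * t + -1) \<and> 2 * t + -1 \<in> {0..1} - S2" if "t \<in> ?V2" for t
    using that inS[of t] by (auto simp: \<gamma>_def)
  have "curve_off S \<gamma>"
    unfolding curve_off_def
  proof (intro conjI ballI)
    have "continuous_on ({0..1/2} \<union> {1/2..1}) \<gamma>"
      unfolding \<gamma>_def
    proof (rule continuous_on_cases)
      show "continuous_on {0..1/2} (\<lambda>t. \<gamma>1 (2 * t))" "continuous_on {1/2..1} (\<lambda>t. \<gamma>2 (2 * t - 1))"
        by (intro continuous_on_compose2[OF S1(3)] continuous_on_compose2[OF S2(3)] continuous_intros; auto)+
    qed (use mid in \<open>auto simp: mult.commute[of 2]\<close>)
    moreover have "{0..1/2} \<union> {1/2..1} = {0..1::real}" by auto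
    ultimately show "continuous_on {0..1} \<gamma>" by simp
    fix c assume c: "c \<in> atlas M"
    let ?T1 = "{t \<in> ?V1. \<gamma> t \<in> chart_dom c}" and ?T2 = "{t \<in> ?V2. \<gamma> t \<in> chart_dom c}"
    have 1: "(snd c \<circ> \<gamma>) C1_differentiable_on ?T1"
      using affine_reparam(1)[OF \<gamma>1 V(1) _ eq1 c] by simp
    have 2: "(snd c \<circ> \<gamma>) C1_differentiable_on ?T2"
      using affine_reparam(1)[OF \<gamma>2 V(2) _ eq2 c] by simp
    have o1: "open ?T1"
    proof -
      have e: "?T1 = ?V1 \<inter> (\<lambda>t. 2 * t) -` {t \<in> {0..1} - S1. \<gamma>1 t \<in> chart_dom c}" using eq1 by auto
      show ?thesis unfolding e
        by (intro open_Int V open_vimage open_curve_preimage[OF \<gamma>1] open_chart_dom c continuous_intros)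
    qed
    have o2: "open ?T2"
    proof -
      have e: "?T2 = ?V2 \<inter> (\<lambda>t. 2 * t + -1) -` {t \<in> {0..1} - S2. \<gamma>2 t \<in> chart_dom c}" using eq2 by auto
      show ?thesis unfolding e
        by (intro open_Int V open_vimage open_curve_preimage[OF \<gamma>2] open_chart_dom c continuous_intros)
    qed
    have "{t \<in> {0..1} - S. \<gamma> t \<in> chart_dom c} = ?T1 \<union> ?T2" using V(3) by blast
    then show "(snd c \<circ> \<gamma>) C1_differentiable_on {t \<in> {0..1} - S. \<gamma> t \<in> chart_dom c}"
      using 1 2 o1 o2 by (intro C1_differentiable_on_local) auto
  qed (use S in auto)
  moreover have "curve_length M \<gamma> = curve_length M \<gamma>1 + curve_length M \<gamma>2"
  proof -
    have m: "speed_off S1 \<gamma>1 \<in> borel_measurable borel" "speed_off S2 \<gamma>2 \<in> borel_measurable borel"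
      by (intro measurable_speed_off \<gamma>1 \<gamma>2)+
    have "curve_length M \<gamma> = (\<integral>\<^sup>+t. 2 * speed_off S1 \<gamma>1 (0 + 2 * t) + 2 * speed_off S2 \<gamma>2 (-1 + 2 * t) \<partial>lborel)"
      unfolding curve_length_def
    proof (rule nn_integral_cong_AE)
      show "AE t in lborel. ennreal (speed \<gamma> t) * indicator {0..1} t
          = 2 * speed_off S1 \<gamma>1 (0 + 2 * t) + 2 * speed_off S2 \<gamma>2 (-1 + 2 * t)"
        using AE_not_exceptional[OF S(1)]
      proof eventually_elim
        case (elim t)
        consider "t \<in> ?V1" | "t \<in> ?V2" | "t < 0 \<or> t > 1" using V(3) elim by force
        then show ?case
        proof cases
          case 1
          have "speed \<gamma> t = 2 * speed \<gamma>1 (2 * t)"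
            using affine_reparam(2)[OF \<gamma>1 V(1) _ eq1 chart_at(1) 1] by simp
          moreover have "2 * t - 1 \<notin> {0..1}" using 1 by auto
          ultimately show ?thesis using 1 eq1[OF 1] speed_nonneg[of \<gamma>1 "2 * t"]
            by (simp add: speed_off_def ennreal_mult)
        next
          case 2
          have "speed \<gamma> t = 2 * speed \<gamma>2 (2 * t - 1)"
            using affine_reparam(2)[OF \<gamma>2 V(2) _ eq2 chart_at(1) 2] by simp
          moreover have "2 * t \<notin> {0..1}" using 2 by auto
          ultimately show ?thesis using 2 eq2[OF 2] speed_nonneg[of \<gamma>2 "2 * t - 1"]
            by (simp add: speed_off_def ennreal_mult)
        next
          case 3
          have "indicator ({0..1} - S1) (2 * t) = (0::real)"
            using 3 by (auto split: split_indicator)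
          moreover have "indicator ({0..1} - S2) (2 * t - 1) = (0::real)"
            using 3 by (auto split: split_indicator)
          ultimately show ?thesis using 3 by (auto simp: speed_off_def split: split_indicator)
        qed
      qed
    qed
    also have "\<dots> = 2 * (\<integral>\<^sup>+t. speed_off S1 \<gamma>1 (0 + 2 * t) \<partial>lborel) + 2 * (\<integral>\<^sup>+t. speed_off S2 \<gamma>2 (-1 + 2 * t) \<partial>lborel)"
    proof -
      define h1 h2 where "h1 = (\<lambda>t. speed_off S1 \<gamma>1 (0 + 2 * t))" and "h2 = (\<lambda>t. speed_off S2 \<gamma>2 (-1 + 2 * t))"
      have [measurable]: "h1 \<in> borel_measurable borel" "h2 \<in> borel_measurable borel"
        unfolding h1_def h2_def using m by measurable
      have "(\<integral>\<^sup>+t. 2 * h1 t + 2 * h2 t \<partial>lborel) = 2 * (\<integral>\<^sup>+t. h1 t \<partial>lborel) + 2 * (\<integral>\<^sup>+t. h2 t \<partial>lborel)"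
        by (simp add: nn_integral_add nn_integral_cmult)
      then show ?thesis unfolding h1_def h2_def .
    qed
    also have "\<dots> = curve_length M \<gamma>1 + curve_length M \<gamma>2"
      unfolding curve_length_speed_off[OF \<gamma>1] curve_length_speed_off[OF \<gamma>2]
      using nn_integral_real_affine[OF m(1), of 2 0] nn_integral_real_affine[OF m(2), of 2 "-1"] by simp
    finally show ?thesis .
  qed
  moreover have "\<gamma> 0 = \<gamma>1 0" "\<gamma> 1 = \<gamma>2 1" by (auto simp: \<gamma>_def)
  ultimately show thesis using that by blast
qed

lemma rdist_less_iff:
  "rdist M x y < e \<longleftrightarrow> (\<exists>S \<gamma>. curve_off S \<gamma> \<and> \<gamma> 0 = x \<and> \<gamma> 1 = y \<and> curve_length M \<gamma> < e)"
  by (auto simp: rdist_def INF_less_iff piecewise_C1_curve_iff)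

lemma rdist_le: "curve_off S \<gamma> \<Longrightarrow> \<gamma> 0 = x \<Longrightarrow> \<gamma> 1 = y \<Longrightarrow> rdist M x y \<le> curve_length M \<gamma>"
  unfolding rdist_def by (rule INF_lower) (auto simp: piecewise_C1_curve_iff)

lemma rdist_sym: "rdist M x y = rdist M y x"
proof -
  have "rdist M x y \<le> rdist M y x" for x y
  proof (rule dense_ge)
    fix e assume "rdist M y x < e"
    then obtain S \<gamma> where g: "curve_off S \<gamma>" "\<gamma> 0 = y" "\<gamma> 1 = x" "curve_length M \<gamma> < e"
      by (auto simp: rdist_less_iff)
    obtain S' where "curve_off S' (\<lambda>t. \<gamma> (1 - t))" "curve_length M (\<lambda>t. \<gamma> (1 - t)) = curve_length M \<gamma>"
      by (rule curve_reverse[OF g(1)])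
    then show "rdist M x y \<le> e"
      using rdist_le[of S' "\<lambda>t. \<gamma> (1 - t)" x y] g by (auto intro: order_trans less_imp_le)
  qed
  then show ?thesis by (intro antisym)
qed

text \<open>Strict upper bounds of the distances are witnessed by curves, which can be joined.\<close>

lemma rdist_triangle_less:
  assumes "rdist M x y < a" "rdist M y z < b"
  shows "rdist M x z \<le> a + b"
proof -
  obtain S1 \<gamma>1 where 1: "curve_off S1 \<gamma>1" "\<gamma>1 0 = x" "\<gamma>1 1 = y" "curve_length M \<gamma>1 < a"
    using assms(1) by (auto simp: rdist_less_iff)
  obtain S2 \<gamma>2 where 2: "curve_off S2 \<gamma>2" "\<gamma>2 0 = y" "\<gamma>2 1 = z" "curve_length M \<gamma>2 < b"
    using assms(2) by (auto simp: rdist_less_iff)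
  have "\<gamma>1 1 = \<gamma>2 0" using 1 2 by simp
  from curve_join[OF 1(1) 2(1) this] obtain S \<gamma> where "curve_off S \<gamma>" "\<gamma> 0 = \<gamma>1 0" "\<gamma> 1 = \<gamma>2 1"
    "curve_length M \<gamma> = curve_length M \<gamma>1 + curve_length M \<gamma>2" by blast
  then show ?thesis using rdist_le[of S \<gamma> x z] 1 2 by (auto intro: order_trans add_mono less_imp_le)
qed

text \<open>The straight segment in the chart joins the two points; its speed at a parameter is the norm of
  \<open>z - y\<close> at the corresponding point.\<close>

lemma rdist_chart_segment:
  assumes c: "c \<in> atlas M" and K: "convex K" "K \<subseteq> chart_img c" "y \<in> K" "z \<in> K"
    and B: "\<And>w. w \<in> K \<Longrightarrow> gnorm M c (chart_inv c w) (z - y) \<le> B"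
  shows "rdist M (chart_inv c y) (chart_inv c z) \<le> ennreal B"
proof -
  define \<sigma> where "\<sigma> = (\<lambda>t::real. y + t *\<^sub>R (z - y))"
  define \<gamma> where "\<gamma> = (\<lambda>t. chart_inv c (\<sigma> t))"
  have \<sigma>K: "\<sigma> t \<in> K" if "t \<in> {0..1}" for t
  proof -
    have "\<sigma> t = (1 - t) *\<^sub>R y + t *\<^sub>R z" by (simp add: \<sigma>_def algebra_simps)
    then show ?thesis using K that by (simp add: convex_alt)
  qed
  have \<sigma>': "(\<sigma> has_vector_derivative (z - y)) (at t)" for t
    unfolding \<sigma>_def by (auto intro!: derivative_eq_intros)
  have c\<sigma>: "continuous_on A \<sigma>" for A unfolding \<sigma>_def by (intro continuous_intros)
  have c\<gamma>: "continuous_on {0..1} \<gamma>"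
    unfolding \<gamma>_def using \<sigma>K K by (intro continuous_on_compose2[OF continuous_chart_inv[OF c]] c\<sigma>) auto
  have dom: "\<gamma> t \<in> chart_dom c" "snd c (\<gamma> t) = \<sigma> t" if "t \<in> {0..1}" for t
    using \<sigma>K[OF that] K c chart_inv_in by (auto simp: \<gamma>_def)
  have off: "curve_off {0,1} \<gamma>"
    unfolding curve_off_def
  proof (intro conjI ballI)
    fix c' assume c': "c' \<in> atlas M"
    let ?T = "{t \<in> {0..1} - {0,1}. \<gamma> t \<in> chart_dom c'}"
    have T: "open ?T"
    proof -
      have "?T = {0<..<1} \<inter> \<gamma> -` chart_dom c'" by force
      moreover have "open ({0<..<1} \<inter> \<gamma> -` chart_dom c')"
        by (rule continuous_open_preimage) (auto intro: continuous_on_subset[OF c\<gamma>] open_chart_dom c')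
      ultimately show ?thesis by simp
    qed
    show "(snd c' \<circ> \<gamma>) C1_differentiable_on ?T"
    proof (rule C1_differentiable_on_local)
      fix t assume t: "t \<in> ?T"
      then have t01: "t \<in> {0..1}" by simp
      have "\<gamma> t \<in> chart_dom c'" using t by simp
      from transition_extension[OF c c' dom(1)[OF t01] this]
      obtain W F where F: "snd c (\<gamma> t) \<in> W" "smooth_on_open W F" "\<And>z. z \<in> W \<inter> overlap c c' \<Longrightarrow> F z = transition c c' z"
        by blast
      let ?U = "?T \<inter> \<sigma> -` W"
      have U: "open ?U"
        by (intro open_Int T open_vimage smooth_on_open_open[OF F(2)] c\<sigma>)
      have "(F \<circ> \<sigma>) C1_differentiable_on ?U"
        unfolding C1_differentiable_on_def
      proof (intro exI conjI ballI)
        show "((F \<circ> \<sigma>) has_vector_derivative frechet_derivative F (at (\<sigma> s)) (z - y)) (at s)" if "s \<in> ?U" for s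
        proof -
          have "\<sigma> s \<in> W" using that by simp
          from diff_chain_at[OF \<sigma>'[unfolded has_vector_derivative_def] smooth_on_open_has_derivative[OF F(2) this]]
          have "(F \<circ> \<sigma> has_derivative frechet_derivative F (at (\<sigma> s)) \<circ> (\<lambda>h. h *\<^sub>R (z - y))) (at s)" .
          then show ?thesis
            using linear_cmul[OF has_derivative_linear[OF smooth_on_open_has_derivative[OF F(2) \<open>\<sigma> s \<in> W\<close>]]]
            by (simp add: has_vector_derivative_def o_def)
        qed
        show "continuous_on ?U (\<lambda>s. frechet_derivative F (at (\<sigma> s)) (z - y))"
          by (rule continuous_on_compose2[OF smooth_on_open_continuous_derivative[OF F(2)] c\<sigma>]) auto
      qed
      then have "(snd c' \<circ> \<gamma>) C1_differentiable_on ?U"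
      proof (rule C1_differentiable_on_cong_open[OF U])
        fix s assume s: "s \<in> ?U"
        then have s01: "s \<in> {0..1}" by simp
        \<comment> \<open>On its domain the transition map agrees with a smooth map of the full space.\<close>
        have "\<sigma> s \<in> overlap c c'" using s dom[OF s01] by (force simp: image_iff)
        then have "F (\<sigma> s) = transition c c' (\<sigma> s)" using s by (intro F(3)) auto
        also have "\<dots> = snd c' (\<gamma> s)" by (simp add: transition_def \<gamma>_def)
        finally show "(F \<circ> \<sigma>) s = (snd c' \<circ> \<gamma>) s" by simp
      qed
      then show "\<exists>U. open U \<and> t \<in> U \<and> (snd c' \<circ> \<gamma>) C1_differentiable_on U"
        using U t F(1) dom(2)[OF t01] by (intro exI[of _ ?U]) auto
    qed
  qed (use c\<gamma> in auto)
  have sp: "speed \<gamma> t \<le> B" if t: "t \<in> {0..1} - {0,1}" for t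
  proof -
    have t01: "t \<in> {0..1}" and t': "t \<in> {0<..<1}" using t by auto
    have "((snd c \<circ> \<gamma>) has_vector_derivative (z - y)) (at t)"
      by (rule has_vector_derivative_transform_within_open[OF \<sigma>', where S = "{0<..<1}"]) (use t' dom in auto)
    then have "velocity \<gamma> t c = z - y" unfolding velocity_def by (rule vector_derivative_at)
    then have "speed \<gamma> t = gnorm M c (\<gamma> t) (z - y)"
      using speed_chart[OF off c t dom(1)[OF t01]] by simp
    then show ?thesis using B[OF \<sigma>K[OF t01]] by (simp add: \<gamma>_def)
  qed
  have "rdist M (chart_inv c y) (chart_inv c z) \<le> curve_length M \<gamma>"
    by (rule rdist_le[OF off]) (auto simp: \<gamma>_def \<sigma>_def)
  also have "\<dots> \<le> (\<integral>\<^sup>+t. ennreal B * indicator {0..1::real} t \<partial>lborel)"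
    unfolding curve_length_def
  proof (rule nn_integral_mono_AE)
    show "AE t in lborel. ennreal (speed \<gamma> t) * indicator {0..1} t \<le> ennreal B * indicator {0..1} t"
      using AE_not_exceptional[of "{0,1}"]
      by (rule eventually_mono) (use sp in \<open>auto simp: ennreal_leI split: split_indicator\<close>)
  qed
  also have "\<dots> = ennreal B" by (simp add: nn_integral_cmult_indicator)
  finally show ?thesis .
qed

lemma rdist_refl: "rdist M x x = 0"
proof -
  obtain c where c: "c \<in> atlas M" "x \<in> chart_dom c" using chart_exists by blast
  have "rdist M (chart_inv c (snd c x)) (chart_inv c (snd c x)) \<le> ennreal 0"
    by (rule rdist_chart_segment[OF c(1), where K = "{snd c x}"]) (use c in \<open>auto simp: gnorm_def\<close>)
  then show ?thesis using c by simp
qed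

end

section \<open>Smooth functions on the manifold\<close>

context weighted_manifold
begin

definition du :: "('a \<Rightarrow> real) \<Rightarrow> ('a, 'n::{finite,wellorder}) chart \<Rightarrow> 'a \<Rightarrow> real^'n::_ \<Rightarrow> real" where
  "du u c x = frechet_derivative (\<lambda>y. u (chart_inv c y)) (at (snd c x))"

lemma smooth_functionE:
  assumes "smooth_function M u" "c \<in> atlas M" "x \<in> chart_dom c"
  obtains W F where "snd c x \<in> W" "smooth_on_open W F" "\<And>z. z \<in> W \<Longrightarrow> z \<in> chart_img c \<Longrightarrow> F z = u (chart_inv c z)"
proof -
  have "smooth_on_set (chart_img c) (\<lambda>y. u (chart_inv c y))"
    using assms by (simp add: smooth_function_def)
  moreover have "snd c x \<in> chart_img c" using assms by simp
  ultimately obtain W F where "snd c x \<in> W" "smooth_on_open W F" "\<forall>z\<in>W \<inter> chart_img c. F z = u (chart_inv c z)"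
    unfolding smooth_on_set_def by meson
  then show thesis using that by blast
qed

lemma smooth_functionI:
  assumes "\<And>c x. c \<in> atlas M \<Longrightarrow> x \<in> chart_dom c \<Longrightarrow>
    \<exists>W F. snd c x \<in> W \<and> smooth_on_open W F \<and> (\<forall>z\<in>W \<inter> chart_img c. F z = u (chart_inv c z))"
  shows "smooth_function M u"
  unfolding smooth_function_def smooth_on_set_def using assms by force

lemma smooth_function_const: "smooth_function M (\<lambda>x. a)"
  by (rule smooth_functionI) (auto intro!: exI[of _ UNIV] exI[of _ "\<lambda>_. a"] smooth_on_open_const)

lemma smooth_function_binop:
  assumes u: "smooth_function M u" and w: "smooth_function M w"
    and op: "\<And>(W :: (real^'n::{finite,wellorder}) set) F G. smooth_on_open W F \<Longrightarrow> smooth_on_open W G \<Longrightarrow> smooth_on_open W (\<lambda>x. op (F x) (G x :: real) :: real)"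
  shows "smooth_function M (\<lambda>x. op (u x) (w x))"
proof (rule smooth_functionI)
  fix c x assume c: "c \<in> atlas M" "x \<in> chart_dom c"
  obtain W F where F: "snd c x \<in> W" "smooth_on_open W F" "\<And>z. z \<in> W \<Longrightarrow> z \<in> chart_img c \<Longrightarrow> F z = u (chart_inv c z)"
    by (rule smooth_functionE[OF u c]) blast
  obtain W' G where G: "snd c x \<in> W'" "smooth_on_open W' G" "\<And>z. z \<in> W' \<Longrightarrow> z \<in> chart_img c \<Longrightarrow> G z = w (chart_inv c z)"
    by (rule smooth_functionE[OF w c]) blast
  have "smooth_on_open (W \<inter> W') (\<lambda>x. op (F x) (G x))"
    using smooth_on_open_open[OF F(2)] smooth_on_open_open[OF G(2)]
    by (intro op smooth_on_open_subset[OF F(2)] smooth_on_open_subset[OF G(2)]) auto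
  then show "\<exists>W F. snd c x \<in> W \<and> smooth_on_open W F \<and> (\<forall>z\<in>W \<inter> chart_img c. F z = op (u (chart_inv c z)) (w (chart_inv c z)))"
    using F G by (intro exI[of _ "W \<inter> W'"] exI[of _ "\<lambda>x. op (F x) (G x)"]) auto
qed

lemma smooth_function_add: "smooth_function M u \<Longrightarrow> smooth_function M w \<Longrightarrow> smooth_function M (\<lambda>x. u x + w x)"
  by (rule smooth_function_binop) (auto intro: smooth_on_open_add)

lemma smooth_function_mult: "smooth_function M u \<Longrightarrow> smooth_function M w \<Longrightarrow> smooth_function M (\<lambda>x. u x * w x)"
  by (rule smooth_function_binop) (auto intro: smooth_on_open_mult)

lemma smooth_function_sum: "(\<And>i. i \<in> I \<Longrightarrow> smooth_function M (f i)) \<Longrightarrow> smooth_function M (\<lambda>x. \<Sum>i\<in>I. f i x)"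
  by (induction I rule: infinite_finite_induct) (auto intro: smooth_function_add smooth_function_const)

lemma smooth_function_compose:
  assumes u: "smooth_function M u" and g: "smooth_on_open T g" "\<And>x. u x \<in> T"
  shows "smooth_function M (\<lambda>x. g (u x))"
proof (rule smooth_functionI)
  fix c x assume c: "c \<in> atlas M" "x \<in> chart_dom c"
  obtain W F where F: "snd c x \<in> W" "smooth_on_open W F" "\<And>z. z \<in> W \<Longrightarrow> z \<in> chart_img c \<Longrightarrow> F z = u (chart_inv c z)"
    by (rule smooth_functionE[OF u c]) blast
  let ?W = "W \<inter> F -` T"
  have W: "open ?W"
    by (rule continuous_open_preimage[OF smooth_on_open_continuous[OF F(2)] smooth_on_open_open[OF F(2)] smooth_on_open_open[OF g(1)]])
  have "smooth_on_open ?W (\<lambda>z. g (F z))"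
    by (rule smooth_on_open_compose[OF g(1) smooth_on_open_subset[OF F(2) W]]) auto
  moreover have "F (snd c x) = u x" using F(3)[OF F(1)] c by simp
  ultimately show "\<exists>W F. snd c x \<in> W \<and> smooth_on_open W F \<and> (\<forall>z\<in>W \<inter> chart_img c. F z = g (u (chart_inv c z)))"
    using F g(2)[of x] by (intro exI[of _ ?W] exI[of _ "\<lambda>z. g (F z)"]) auto
qed

lemma continuous_smooth_function:
  assumes "smooth_function M u"
  shows "continuous_on UNIV u"
proof -
  have "isCont u x" for x
  proof -
    obtain c where c: "c \<in> atlas M" "x \<in> chart_dom c" using chart_exists by blast
    obtain W F where F: "snd c x \<in> W" "smooth_on_open W F" "\<And>z. z \<in> W \<Longrightarrow> z \<in> chart_img c \<Longrightarrow> F z = u (chart_inv c z)"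
      by (rule smooth_functionE[OF assms c]) blast
    let ?U = "chart_dom c \<inter> snd c -` W"
    have U: "open ?U" by (rule open_chart_preimage[OF c(1) smooth_on_open_open[OF F(2)]])
    have "continuous_on ?U (\<lambda>x. F (snd c x))"
      by (rule continuous_on_compose2[OF smooth_on_open_continuous[OF F(2)] continuous_on_subset[OF continuous_chart[OF c(1)]]]) auto
    then have "continuous_on ?U u"
      by (rule continuous_on_eq) (use F(3) c in auto)
    moreover have "x \<in> ?U" using c F by simp
    ultimately show ?thesis using U by (simp add: continuous_on_eq_continuous_at)
  qed
  then show ?thesis by (simp add: continuous_at_imp_continuous_on)
qed

lemma chart_int_D:
  assumes "c \<in> atlas M" "y \<in> chart_int c"
  shows "chart_inv c y \<in> chart_dom c" "snd c (chart_inv c y) = y"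
  using assms chart_inv_in by (auto simp: chart_int_def)

lemma smooth_on_chart_int:
  assumes u: "smooth_function M u" and c: "c \<in> atlas M"
  shows "smooth_on_open (chart_int c) (\<lambda>y. u (chart_inv c y))"
proof (rule smooth_on_open_local[OF open_chart_int[OF c]])
  fix y assume y: "y \<in> chart_int c"
  note yD = chart_int_D[OF c y]
  obtain W F where F: "snd c (chart_inv c y) \<in> W" "smooth_on_open W F" "\<And>z. z \<in> W \<Longrightarrow> z \<in> chart_img c \<Longrightarrow> F z = u (chart_inv c z)"
    by (rule smooth_functionE[OF u c yD(1)]) blast
  have "smooth_on_open (W \<inter> chart_int c) F"
    using open_chart_int[OF c] smooth_on_open_open[OF F(2)] by (intro smooth_on_open_subset[OF F(2)]) auto
  then have "smooth_on_open (W \<inter> chart_int c) (\<lambda>y. u (chart_inv c y))"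
    by (rule smooth_on_open_cong) (use F in \<open>auto simp: chart_int_def\<close>)
  then show "\<exists>U. y \<in> U \<and> smooth_on_open U (\<lambda>y. u (chart_inv c y))"
    using F(1) y yD by (intro exI[of _ "W \<inter> chart_int c"]) auto
qed

lemma du_has_derivative:
  assumes "smooth_function M u" "c \<in> atlas M" "snd c x \<in> chart_int c"
  shows "((\<lambda>y. u (chart_inv c y)) has_derivative du u c x) (at (snd c x))"
  unfolding du_def by (rule smooth_on_open_has_derivative[OF smooth_on_chart_int[OF assms(1,2)] assms(3)])

lemma du_eqI:
  assumes "((\<lambda>y. u (chart_inv c y)) has_derivative D) (at (snd c x))"
  shows "du u c x = D"
  unfolding du_def using frechet_derivative_at[OF assms] by simp

lemma du_linear:
  assumes "smooth_function M u" "c \<in> atlas M" "snd c x \<in> chart_int c"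
  shows "linear (du u c x)"
  using du_has_derivative[OF assms] by (rule has_derivative_linear)

lemma du_cong_open:
  assumes c: "c \<in> atlas M" "x \<in> chart_dom c" "snd c x \<in> chart_int c" and V: "open V" "x \<in> V"
    and D: "(G has_derivative D) (at (snd c x))"
    and eq: "\<And>z. z \<in> V \<Longrightarrow> z \<in> chart_dom c \<Longrightarrow> u z = G (snd c z)"
  shows "du u c x = D"
proof (rule du_eqI)
  let ?U = "snd c ` (chart_dom c \<inter> V) \<inter> {y. 0 < y $ bdry_index}"
  show "((\<lambda>y. u (chart_inv c y)) has_derivative D) (at (snd c x))"
    by (rule has_derivative_transform_within_open[OF D open_chart_image_int[OF c(1) V(1)]])
      (use c V eq in \<open>auto simp: chart_int_def\<close>)
qed

lemma du_locally_const:
  assumes c: "c \<in> atlas M" "x \<in> chart_dom c" "snd c x \<in> chart_int c" and V: "open V" "x \<in> V"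
    and eq: "\<And>z. z \<in> V \<Longrightarrow> u z = a"
  shows "du u c x v = 0"
  by (subst du_cong_open[OF c V, of "\<lambda>_. a" "\<lambda>_. 0"]) (use eq in auto)

lemma du_const:
  assumes c: "c \<in> atlas M" "x \<in> chart_dom c" "snd c x \<in> chart_int c"
  shows "du (\<lambda>_. a) c x v = 0"
  by (rule du_locally_const[OF c, of UNIV]) auto

lemma du_add:
  assumes "smooth_function M u" "smooth_function M w" "c \<in> atlas M" "snd c x \<in> chart_int c"
  shows "du (\<lambda>x. u x + w x) c x v = du u c x v + du w c x v"
  by (subst du_eqI[OF has_derivative_add[OF du_has_derivative[OF assms(1,3,4)] du_has_derivative[OF assms(2,3,4)]]]) simp

lemma du_mult:
  assumes "smooth_function M u" "smooth_function M w" "c \<in> atlas M" "x \<in> chart_dom c" "snd c x \<in> chart_int c"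
  shows "du (\<lambda>x. u x * w x) c x v = u x * du w c x v + du u c x v * w x"
  by (subst du_eqI[OF has_derivative_mult[OF du_has_derivative[OF assms(1,3,5)] du_has_derivative[OF assms(2,3,5)]]])
    (use assms in simp)

lemma du_sum:
  assumes "\<And>i. i \<in> I \<Longrightarrow> smooth_function M (f i)" "c \<in> atlas M" "snd c x \<in> chart_int c"
  shows "du (\<lambda>x. \<Sum>i\<in>I. f i x) c x v = (\<Sum>i\<in>I. du (f i) c x v)"
  by (subst du_eqI[OF has_derivative_sum[of I "\<lambda>i y. f i (chart_inv c y)" "\<lambda>i. du (f i) c x"]])
    (use assms du_has_derivative in auto)

lemma du_compose:
  assumes u: "smooth_function M u" and c: "c \<in> atlas M" "x \<in> chart_dom c" "snd c x \<in> chart_int c"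
    and g: "(g has_real_derivative g') (at (u x))"
  shows "du (\<lambda>x. g (u x)) c x v = g' * du u c x v"
proof -
  have "(g has_derivative (\<lambda>h. h * g')) (at (u (chart_inv c (snd c x))))"
    using g c by (simp add: has_field_derivative_def mult_commute_abs)
  from has_derivative_compose[OF du_has_derivative[OF u c(1,3)] this]
  show ?thesis by (subst du_eqI) (auto simp: mult.commute)
qed

lemma du_transition:
  assumes u: "smooth_function M u" and c: "c \<in> atlas M" "x \<in> chart_dom c" "snd c x \<in> chart_int c"
    and c': "c' \<in> atlas M" "x \<in> chart_dom c'" "snd c' x \<in> chart_int c'"
  shows "du u c' x (dtransition c c' x v) = du u c x v"
proof -
  let ?U = "overlap c c' \<inter> {y. 0 < y $ bdry_index}"
  have U: "open ?U" by (rule open_chart_image_int[OF c(1) open_chart_dom[OF c'(1)]])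
  have xU: "snd c x \<in> ?U" using c c' by (auto simp: chart_int_def)
  have "(transition c c' has_derivative dtransition c c' x) (at (snd c x) within ?U)"
    using dtransition_has_derivative[OF c(1) c'(1) c(2) c'(2)] by (rule has_derivative_subset) auto
  then have t: "(transition c c' has_derivative dtransition c c' x) (at (snd c x))"
    using at_within_open[OF xU U] by simp
  have "((\<lambda>y. u (chart_inv c' y)) has_derivative du u c' x) (at (transition c c' (snd c x)))"
    using du_has_derivative[OF u c'(1,3)] by (simp add: transition_chart c)
  from has_derivative_compose[OF t this]
  have "((\<lambda>y. u (chart_inv c' (transition c c' y))) has_derivative (\<lambda>v. du u c' x (dtransition c c' x v))) (at (snd c x))" .
  then have "((\<lambda>y. u (chart_inv c y)) has_derivative (\<lambda>v. du u c' x (dtransition c c' x v))) (at (snd c x))"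
    by (rule has_derivative_transform_within_open[OF _ U xU])
      (use c c' in \<open>auto simp: transition_def\<close>)
  then show ?thesis by (simp add: du_eqI)
qed

text \<open>This says that the norm of the differential of \<open>u\<close> at \<open>x\<close>, dual to the Riemannian norm, is at most
  \<open>C\<close>. Bounding the differential directly avoids the gradient until the very end.\<close>

definition slope_le :: "('a \<Rightarrow> real) \<Rightarrow> real \<Rightarrow> 'a \<Rightarrow> bool" where
  "slope_le u C x \<longleftrightarrow> (\<forall>c\<in>atlas M. x \<in> chart_dom c \<longrightarrow> (\<forall>v. \<bar>du u c x v\<bar> \<le> C * gnorm M c x v))"

text \<open>One chart suffices, because the differential of a change of charts is a bijective isometry.\<close>

lemma slope_leI:
  assumes u: "smooth_function M u" and x: "x \<notin> mfd_boundary M" and c: "c \<in> atlas M" "x \<in> chart_dom c"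
    and le: "\<And>v. \<bar>du u c x v\<bar> \<le> C * gnorm M c x v"
  shows "slope_le u C x"
  unfolding slope_le_def
proof (intro ballI impI allI)
  fix c' w assume c': "c' \<in> atlas M" "x \<in> chart_dom c'"
  obtain v where v: "w = dtransition c c' x v"
    using dtransition_surj[OF c(1) c'(1) c(2) c'(2)] by (metis surjD)
  show "\<bar>du u c' x w\<bar> \<le> C * gnorm M c' x w"
    unfolding v
    using du_transition[OF u c not_boundary[OF c x] c' not_boundary[OF c' x]] gnorm_transition[OF c(1) c'(1) c(2) c'(2)] le
    by simp
qed

text \<open>Around a point outside the domain of \<open>c\<close> the function vanishes: the part of the manifold that
  corresponds to \<open>K\<close> is compact and therefore closed.\<close>

lemma smooth_function_lift:
  assumes c: "c \<in> atlas M" and v: "smooth_on_open UNIV v"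
    and K: "compact K" "K \<subseteq> chart_img c" "\<And>y. y \<notin> K \<Longrightarrow> v y = 0"
  shows "smooth_function M (\<lambda>x. if x \<in> chart_dom c then v (snd c x) else 0)" (is "smooth_function M ?u")
proof (rule smooth_functionI)
  fix c' x assume c': "c' \<in> atlas M" "x \<in> chart_dom c'"
  show "\<exists>W F. snd c' x \<in> W \<and> smooth_on_open W F \<and> (\<forall>z\<in>W \<inter> chart_img c'. F z = ?u (chart_inv c' z))"
  proof (cases "x \<in> chart_dom c")
    case True
    obtain W F where F: "snd c' x \<in> W" "smooth_on_open W F" "\<And>z. z \<in> W \<inter> overlap c' c \<Longrightarrow> F z = transition c' c z"
      using transition_extension[OF c'(1) c c'(2) True] by blast
    obtain r where r: "r > 0" "ball (snd c' x) r \<inter> half_space \<subseteq> overlap c' c"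
      using chart_image_nbhd[OF c'(1) open_chart_dom[OF c] c'(2) True] .
    let ?W = "W \<inter> ball (snd c' x) r"
    have W: "open ?W" using smooth_on_open_open[OF F(2)] by auto
    show ?thesis
    proof (intro exI[of _ ?W] exI[of _ "\<lambda>z. v (F z)"] conjI ballI)
      show "smooth_on_open ?W (\<lambda>z. v (F z))"
        by (rule smooth_on_open_compose[OF v smooth_on_open_subset[OF F(2) W]]) auto
      fix z assume z: "z \<in> ?W \<inter> chart_img c'"
      then have "z \<in> overlap c' c" using r(2) chart_img_half_space[OF c'(1)] by blast
      then have "F z = transition c' c z" using z F(3) by blast
      moreover obtain x' where "z = snd c' x'" "x' \<in> chart_dom c'" "x' \<in> chart_dom c"
        using \<open>z \<in> overlap c' c\<close> by blast
      then have "chart_inv c' z \<in> chart_dom c" using c' by simp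
      ultimately show "v (F z) = ?u (chart_inv c' z)" by (simp add: transition_def)
    qed (use F r in auto)
  next
    case False
    have "compact (chart_inv c ` K)"
      by (rule compact_continuous_image[OF continuous_on_subset[OF continuous_chart_inv[OF c] K(2)] K(1)])
    then have V: "open (- (chart_inv c ` K))" by (simp add: compact_imp_closed open_Compl)
    have "x \<in> - (chart_inv c ` K)" using False K(2) chart_inv_in[OF c] by auto
    from chart_image_nbhd[OF c'(1) V c'(2) this]
    obtain r where r: "r > 0" "ball (snd c' x) r \<inter> half_space \<subseteq> snd c' ` (chart_dom c' \<inter> - (chart_inv c ` K))" .
    show ?thesis
    proof (intro exI[of _ "ball (snd c' x) r"] exI[of _ "\<lambda>z. 0"] conjI ballI)
      fix z assume z: "z \<in> ball (snd c' x) r \<inter> chart_img c'"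
      then have "z \<in> snd c' ` (chart_dom c' \<inter> - (chart_inv c ` K))" using r(2) chart_img_half_space[OF c'(1)] by blast
      then have *: "chart_inv c' z \<notin> chart_inv c ` K" using c' by auto
      have "v (snd c (chart_inv c' z)) = 0" if d: "chart_inv c' z \<in> chart_dom c"
      proof (rule K(3))
        show "snd c (chart_inv c' z) \<notin> K"
          using * chart_inv_left[OF c d] by (metis imageI)
      qed
      then show "0 = ?u (chart_inv c' z)" by simp
    qed (use r in \<open>auto intro: smooth_on_open_const\<close>)
  qed
qed

end

section \<open>Weak gradients\<close>

text \<open>The matrices on the segment from the identity to \<open>A\<close> are positive definite and hence invertible, so
  the determinant does not change its sign along the segment.\<close>

lemma pos_def_det_pos:
  fixes A :: "real^'n^'n"
  assumes pos: "\<And>v. v \<noteq> 0 \<Longrightarrow> 0 < v \<bullet> (A *v v)"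
  shows "0 < det A"
proof -
  define f where "f = (\<lambda>t::real. (1 - t) *\<^sub>R mat 1 + t *\<^sub>R A)"
  have nz: "det (f t) \<noteq> 0" if "t \<in> {0..1}" for t
  proof -
    have "v = 0" if v: "f t *v v = 0" for v
    proof (rule ccontr)
      assume "v \<noteq> 0"
      have "v \<bullet> (f t *v v) = (1 - t) * (v \<bullet> v) + t * (v \<bullet> (A *v v))"
        by (simp add: f_def matrix_vector_mult_add_rdistrib scaleR_matrix_vector_assoc[symmetric] inner_add_right)
      also have "\<dots> > 0"
      proof (cases "t = 0")
        case False
        then show ?thesis using \<open>t \<in> {0..1}\<close> pos[OF \<open>v \<noteq> 0\<close>] \<open>v \<noteq> 0\<close>
          by (intro add_nonneg_pos mult_pos_pos mult_nonneg_nonneg) auto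
      qed (use \<open>v \<noteq> 0\<close> in auto)
      finally show False using v by simp
    qed
    then have "\<exists>B. B ** f t = mat 1" unfolding matrix_left_invertible_ker by blast
    then show ?thesis by (simp add: invertible_left_inverse flip: invertible_det_nz)
  qed
  have cont: "continuous_on {0..1} (\<lambda>t. det (f t))"
    unfolding det_def f_def by (intro continuous_intros)
  show ?thesis
  proof (rule ccontr)
    assume "\<not> 0 < det A"
    then have "det (f 1) \<le> 0" "0 \<le> det (f 0)" by (simp_all add: f_def)
    then obtain t where "0 \<le> t" "t \<le> 1" "det (f t) = 0"
      using IVT2'[of "\<lambda>t. det (f t)" 1 0 0] cont by auto
    then show False using nz[of t] by simp
  qed
qed

context weighted_manifold
begin

lemma metric_det_pos: "c \<in> atlas M \<Longrightarrow> x \<in> chart_dom c \<Longrightarrow> 0 < det (metric M c x)"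
  by (rule pos_def_det_pos) (rule metric_pos)

lemma sets_vol: "sets (vol M) = sets borel"
  using volume by (simp add: is_riemannian_volume_def)

lemma sets_wmeasure: "sets (wmeasure M) = sets borel"
  by (simp add: wmeasure_def sets_vol)

lemma space_wmeasure: "space (wmeasure M) = UNIV"
  using sets_eq_imp_space_eq[OF sets_wmeasure] by simp

lemma emeasure_vol_chart:
  assumes "c \<in> atlas M" "B \<in> sets borel" "B \<subseteq> chart_dom c"
  shows "emeasure (vol M) B = (\<integral>\<^sup>+y\<in>snd c ` B. ennreal (sqrt (det (metric M c (chart_inv c y)))) \<partial>lborel)"
  using volume assms unfolding is_riemannian_volume_def by blast

lemma measurable_exp_weight: "(\<lambda>x. ennreal (exp (- weight M x))) \<in> borel_measurable (vol M)"
  unfolding measurable_cong_sets[OF sets_vol refl]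
  using borel_measurable_continuous_onI[OF continuous_smooth_function[OF weight]] by measurable

lemma emeasure_wmeasure_UNIV: "emeasure (wmeasure M) UNIV = 1"
proof -
  have "UNIV \<in> sets (vol M)" by (simp add: sets_vol)
  then show ?thesis using total by (simp add: wmeasure_def emeasure_density measurable_exp_weight)
qed

lemma AE_wmeasure: "(AE x in wmeasure M. P x) \<longleftrightarrow> (AE x in vol M. P x)"
  unfolding wmeasure_def by (simp add: AE_density measurable_exp_weight)

lemma borel_chart_img: "c \<in> atlas M \<Longrightarrow> chart_img c \<in> sets borel"
proof -
  assume "c \<in> atlas M"
  then obtain U where "open U" "chart_img c = half_space \<inter> U"
    using is_chart[of c] unfolding is_chart_def openin_open by blast
  moreover have "closed (half_space :: (real^'n::{finite,wellorder}) set)" unfolding half_space_def by (intro closed_Collect_le continuous_intros)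
  ultimately show ?thesis by simp
qed

lemma borel_chart_image:
  assumes c: "c \<in> atlas M" and N: "N \<in> sets borel" "N \<subseteq> chart_dom c"
  shows "snd c ` N \<in> sets borel"
proof -
  have "chart_inv c \<in> borel_measurable (restrict_space borel (chart_img c))"
    by (rule borel_measurable_continuous_on_restrict[OF continuous_chart_inv[OF c]])
  from measurable_sets[OF this N(1)]
  have "chart_inv c -` N \<inter> chart_img c \<in> sets borel"
    using borel_chart_img[OF c] by (simp add: space_restrict_space sets_restrict_space_iff)
  moreover have "snd c ` N = chart_inv c -` N \<inter> chart_img c"
    using c N(2) by (force simp: subset_iff)
  ultimately show ?thesis by simp
qed

text \<open>The density of the volume measure in the chart is positive.\<close>

lemma null_set_chart_iff:
  assumes c: "c \<in> atlas M" and N: "N \<in> sets borel" "N \<subseteq> chart_dom c"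
  shows "N \<in> null_sets (vol M) \<longleftrightarrow> (AE y in lborel. y \<notin> snd c ` N)"
proof -
  let ?h = "\<lambda>y. sqrt (det (metric M c (chart_inv c y)))"
  have "continuous_on (chart_img c) ?h"
    unfolding det_def by (intro continuous_intros continuous_metric c)
  from borel_measurable_continuous_on_indicator[OF borel_chart_img[OF c] this]
  have m1: "(\<lambda>y. indicator (chart_img c) y *\<^sub>R ?h y) \<in> borel_measurable borel" .
  have [measurable]: "snd c ` N \<in> sets borel" by (rule borel_chart_image[OF assms])
  have eq: "ennreal (?h y) * indicator (snd c ` N) y = ennreal (indicator (chart_img c) y *\<^sub>R ?h y) * indicator (snd c ` N) y" for y
    using N(2) by (auto split: split_indicator)
  have m: "(\<lambda>y. ennreal (?h y) * indicator (snd c ` N) y) \<in> borel_measurable lborel"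
    unfolding eq using m1 by measurable
  have z: "ennreal (?h y) * indicator (snd c ` N) y = 0 \<longleftrightarrow> y \<notin> snd c ` N" for y
  proof (cases "y \<in> snd c ` N")
    case True
    then have "chart_inv c y \<in> chart_dom c" using N(2) c by auto
    then show ?thesis using True metric_det_pos[OF c] by (simp add: ennreal_eq_0_iff not_le)
  qed simp
  show ?thesis
    using N sets_vol emeasure_vol_chart[OF assms] nn_integral_0_iff_AE[OF m] z
    by (simp add: null_sets_def)
qed

lemma AE_vol_imp_AE_chart:
  assumes c: "c \<in> atlas M" and ae: "AE x in vol M. P x" and P: "{x. \<not> P x} \<in> sets borel"
  shows "AE y in lborel. y \<in> chart_img c \<longrightarrow> P (chart_inv c y)"
proof -
  let ?N = "{x. \<not> P x}"
  have "?N \<in> null_sets (vol M)"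
    using ae P AE_iff_null_sets[of ?N "vol M"] by (simp add: sets_vol)
  moreover have "chart_dom c \<in> sets (vol M)" using open_chart_dom[OF c] by (simp add: sets_vol)
  ultimately have "?N \<inter> chart_dom c \<in> null_sets (vol M)" by (rule null_set_Int2)
  then have "AE y in lborel. y \<notin> snd c ` (?N \<inter> chart_dom c)"
    using null_set_chart_iff[OF c, of "?N \<inter> chart_dom c"] P open_chart_dom[OF c] by simp
  then show ?thesis
  proof eventually_elim
    case (elim y)
    show ?case
    proof (intro impI, rule ccontr)
      assume "y \<in> chart_img c" "\<not> P (chart_inv c y)"
      then have "chart_inv c y \<in> ?N \<inter> chart_dom c" "y = snd c (chart_inv c y)" using c chart_inv_in by auto
      with elim show False by blast
    qed
  qed
qed

lemma AE_chart_imp_AE_vol: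
  assumes c: "c \<in> atlas M" and ae: "AE y in lborel. y \<in> chart_img c \<longrightarrow> P (chart_inv c y)"
    and P: "{x \<in> chart_dom c. \<not> P x} \<in> sets borel"
  shows "AE x in vol M. x \<in> chart_dom c \<longrightarrow> P x"
proof -
  let ?N = "{x \<in> chart_dom c. \<not> P x}"
  have "AE y in lborel. y \<notin> snd c ` ?N"
    using ae by eventually_elim (use c in auto)
  then have "?N \<in> null_sets (vol M)" using null_set_chart_iff[OF c P] by auto
  then show ?thesis by (rule AE_I[rotated -1, of ?N] | auto intro!: AE_I'[of ?N])
qed

lemma finite_atlas: obtains \<A> where "finite \<A>" "\<A> \<subseteq> atlas M" "(\<Union>c\<in>\<A>. chart_dom c) = UNIV"
proof -
  have "compact (UNIV :: 'a set)" by (rule compact_M)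
  moreover have "\<And>c. c \<in> atlas M \<Longrightarrow> open (chart_dom c)" by (rule open_chart_dom)
  moreover have "UNIV \<subseteq> (\<Union>c\<in>atlas M. chart_dom c)" using chart_exists by blast
  ultimately obtain \<A> where "\<A> \<subseteq> atlas M" "finite \<A>" "UNIV \<subseteq> (\<Union>c\<in>\<A>. chart_dom c)"
    by (rule compactE_image)
  then show thesis using that by blast
qed

lemma AE_boundary_hyperplane: "AE y in lborel. (y :: real^'n::{finite,wellorder}) $ bdry_index \<noteq> 0"
proof -
  have "{y :: real^'n::{finite,wellorder}. y $ bdry_index = 0} \<in> null_sets lebesgue"
    using negligible_standard_hyperplane_cart[of bdry_index] by (simp add: negligible_iff_null_sets)
  moreover have "{y :: real^'n::{finite,wellorder}. y $ bdry_index = 0} \<in> sets borel"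
    by (intro borel_closed closed_Collect_eq continuous_intros)
  ultimately have "{y :: real^'n::{finite,wellorder}. y $ bdry_index = 0} \<in> null_sets lborel"
    by (simp add: null_sets_def)
  then show ?thesis by (rule AE_I'[of _ lborel]) auto
qed

text \<open>The differentials are equal almost everywhere in each chart by the fundamental lemma, and the metric
  is invertible. Finitely many charts cover the manifold, and the transformation law transports the
  equality of the components from these to all charts.\<close>

lemma weak_gradient_unique:
  assumes X: "is_weak_gradient M u X" and Y: "is_weak_gradient M w Y"
    and m: "u \<in> borel_measurable borel" "w \<in> borel_measurable borel"
    and ae: "AE x in wmeasure M. u x = w x"
  shows "AE x in wmeasure M. \<forall>c\<in>atlas M. x \<in> chart_dom c \<longrightarrow> X c x = Y c x"
proof -
  have one: "AE x in vol M. x \<in> chart_dom c \<longrightarrow> X c x = Y c x" if c: "c \<in> atlas M" for c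
  proof (rule AE_chart_imp_AE_vol[OF c])
    have "{x. u x \<noteq> w x} \<in> sets borel" using m by measurable
    then have uw: "AE y in lborel. y \<in> chart_img c \<longrightarrow> u (chart_inv c y) = w (chart_inv c y)"
      using ae unfolding AE_wmeasure by (intro AE_vol_imp_AE_chart[OF c]) auto
    define h where "h = (\<lambda>j y. (metric M c (chart_inv c y) *v X c (chart_inv c y)) $ j - (metric M c (chart_inv c y) *v Y c (chart_inv c y)) $ j)"
    have "AE y in lborel. y \<in> chart_int c \<longrightarrow> h j y = 0" for j
    proof (rule fundamental_lemma_calculus_of_variations[OF open_chart_int[OF c]])
      fix \<psi> :: "real^'n::{finite,wellorder} \<Rightarrow> real"
      assume psi: "smooth_on_open UNIV \<psi>" "compact (closure {y. \<psi> y \<noteq> 0})" "closure {y. \<psi> y \<noteq> 0} \<subseteq> chart_int c"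
      then have t: "\<psi> \<in> test_functions c" by (simp add: test_functions_def chart_int_def)
      let ?d = "\<lambda>y. frechet_derivative \<psi> (at y) (axis j 1)"
      let ?a = "\<lambda>y. (metric M c (chart_inv c y) *v X c (chart_inv c y)) $ j"
      let ?b = "\<lambda>y. (metric M c (chart_inv c y) *v Y c (chart_inv c y)) $ j"
      have 1: "integrable lborel (\<lambda>y. u (chart_inv c y) * ?d y)" "integrable lborel (\<lambda>y. ?a y * \<psi> y)"
        "(\<integral>y. u (chart_inv c y) * ?d y \<partial>lborel) = - (\<integral>y. ?a y * \<psi> y \<partial>lborel)"
        using X c t unfolding is_weak_gradient_def Let_def by blast+
      have 2: "integrable lborel (\<lambda>y. w (chart_inv c y) * ?d y)" "integrable lborel (\<lambda>y. ?b y * \<psi> y)"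
        "(\<integral>y. w (chart_inv c y) * ?d y \<partial>lborel) = - (\<integral>y. ?b y * \<psi> y \<partial>lborel)"
        using Y c t unfolding is_weak_gradient_def Let_def by blast+
      have "(\<integral>y. u (chart_inv c y) * ?d y \<partial>lborel) = (\<integral>y. w (chart_inv c y) * ?d y \<partial>lborel)"
      proof (rule integral_cong_AE)
        show "AE y in lborel. u (chart_inv c y) * ?d y = w (chart_inv c y) * ?d y"
          using uw
        proof eventually_elim
          case (elim y)
          have "?d y = 0" if "y \<notin> chart_img c"
          proof -
            have "((\<lambda>y. 0) has_derivative frechet_derivative \<psi> (at y)) (at y)"
              by (rule has_derivative_transform_within_open[OF smooth_on_open_has_derivative[OF psi(1)], of _ "- closure {y. \<psi> y \<noteq> 0}"])
                (use psi(3) that closure_subset[of "{y. \<psi> y \<noteq> 0}"] in \<open>auto simp: chart_int_def\<close>)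
            then show ?thesis
              using has_derivative_unique[OF _ has_derivative_const] by fastforce
          qed
          then show ?case using elim by (cases "y \<in> chart_img c") auto
        qed
      qed (use 1 2 in auto)
      then have "(\<integral>y. ?a y * \<psi> y \<partial>lborel) - (\<integral>y. ?b y * \<psi> y \<partial>lborel) = 0" using 1 2 by simp
      moreover have "(\<lambda>y. h j y * \<psi> y) = (\<lambda>y. ?a y * \<psi> y - ?b y * \<psi> y)"
        by (simp add: h_def left_diff_distrib)
      ultimately show "integrable lborel (\<lambda>y. h j y * \<psi> y) \<and> (\<integral>y. h j y * \<psi> y \<partial>lborel) = 0"
        using Bochner_Integration.integral_diff[OF 1(2) 2(2)] Bochner_Integration.integrable_diff[OF 1(2) 2(2)] by simp
    qed
    then have "AE y in lborel. \<forall>j\<in>UNIV. y \<in> chart_int c \<longrightarrow> h j y = 0"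
      by (intro AE_finite_allI) auto
    then show "AE y in lborel. y \<in> chart_img c \<longrightarrow> X c (chart_inv c y) = Y c (chart_inv c y)"
      using AE_boundary_hyperplane
    proof eventually_elim
      case (elim y)
      show ?case
      proof
        assume y: "y \<in> chart_img c"
        then have "0 < y $ bdry_index" using chart_img_half_space[OF c] elim(2) by (force simp: half_space_def)
        then have "y \<in> chart_int c" using y by (simp add: chart_int_def)
        let ?x = "chart_inv c y"
        let ?d = "X c ?x - Y c ?x"
        have "metric M c ?x *v ?d = 0"
          using elim(1) \<open>y \<in> chart_int c\<close> by (auto simp: h_def vec_eq_iff matrix_vector_mult_diff_distrib)
        then have "?d = 0" using metric_pos[OF c chart_inv_in[OF c y], of ?d] by force
        then show "X c ?x = Y c ?x" by simp
      qed
    qed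
    have m: "X c \<in> borel_measurable (restrict_space borel (chart_dom c))" "Y c \<in> borel_measurable (restrict_space borel (chart_dom c))"
      using X Y c by (auto simp: is_weak_gradient_def measurable_vector_field_def)
    have "{x \<in> space (restrict_space borel (chart_dom c)). X c x \<noteq> Y c x} \<in> sets (restrict_space borel (chart_dom c))"
      using m by measurable
    then show "{x \<in> chart_dom c. X c x \<noteq> Y c x} \<in> sets borel"
      using open_chart_dom[OF c] by (simp add: space_restrict_space sets_restrict_space_iff)
  qed
  obtain \<A> where A: "finite \<A>" "\<A> \<subseteq> atlas M" "(\<Union>c\<in>\<A>. chart_dom c) = UNIV" by (rule finite_atlas)
  have "AE x in vol M. \<forall>c\<in>\<A>. x \<in> chart_dom c \<longrightarrow> X c x = Y c x"
    using A one by (intro AE_finite_allI) auto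
  then have "AE x in vol M. \<forall>c\<in>atlas M. x \<in> chart_dom c \<longrightarrow> X c x = Y c x"
  proof eventually_elim
    case (elim x)
    obtain c where c: "c \<in> \<A>" "x \<in> chart_dom c" using A(3) by blast
    then have ca: "c \<in> atlas M" using A(2) by blast
    have "X c' x = Y c' x" if c': "c' \<in> atlas M" "x \<in> chart_dom c'" for c'
    proof -
      have x: "x \<in> chart_dom c \<inter> chart_dom c'" using c(2) c'(2) by (rule IntI)
      have *: "Z c' x = dtransition c c' x (Z c x)" if "is_weak_gradient M f Z" for f Z
        using that ca c'(1) x unfolding is_weak_gradient_def measurable_vector_field_def by meson
      note *[OF X] *[OF Y]
      then show ?thesis using elim c by simp
    qed
    then show ?case by blast
  qed
  then show ?thesis unfolding AE_wmeasure .
qed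

text \<open>The gradient is obtained from the differential by Cramer's rule, which makes its measurability
  evident. Where the coordinates lie on the boundary of the half space, the two-sided derivative has no
  meaning and is replaced by zero; this is the right value for functions that vanish near the
  boundary.\<close>

definition partials :: "('a \<Rightarrow> real) \<Rightarrow> ('a, 'n::{finite,wellorder}) chart \<Rightarrow> 'a \<Rightarrow> real^'n::_" where
  "partials u c x = (\<chi> i. if 0 < snd c x $ bdry_index then du u c x (axis i 1) else 0)"

definition cgrad :: "('a \<Rightarrow> real) \<Rightarrow> ('a, 'n::{finite,wellorder}) chart \<Rightarrow> 'a \<Rightarrow> real^'n::_" where
  "cgrad u c x = (\<chi> k. det (\<chi> i j. if j = k then partials u c x $ i else metric M c x $ i $ j) / det (metric M c x))"

lemma metric_cgrad:
  assumes "c \<in> atlas M" "x \<in> chart_dom c"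
  shows "metric M c x *v cgrad u c x = partials u c x"
  using cramer[of "metric M c x" "cgrad u c x" "partials u c x"] metric_det_pos[OF assms]
  by (simp add: cgrad_def)

lemma inner_partials:
  assumes "smooth_function M u" "c \<in> atlas M" "snd c x \<in> chart_int c"
  shows "v \<bullet> partials u c x = du u c x v"
proof -
  have "v = (\<Sum>i\<in>UNIV. v $ i *\<^sub>R axis i 1)" using basis_expansion[of v] by (simp add: scalar_mult_eq_scaleR)
  then have "du u c x v = du u c x (\<Sum>i\<in>UNIV. v $ i *\<^sub>R axis i 1)" by simp
  also have "\<dots> = (\<Sum>i\<in>UNIV. v $ i * du u c x (axis i 1))"
    using du_linear[OF assms] by (simp add: linear_sum linear_cmul)
  finally show ?thesis
    using assms(3) by (simp add: inner_vec_def partials_def chart_int_def)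
qed

lemma vec_eq_if_metric_eq:
  assumes c: "c \<in> atlas M" "x \<in> chart_dom c" and eq: "\<And>v. v \<bullet> (metric M c x *v X) = v \<bullet> (metric M c x *v Y)"
  shows "X = Y"
proof -
  have "(X - Y) \<bullet> (metric M c x *v (X - Y)) = 0"
    using eq[of "X - Y"] by (simp add: matrix_vector_mult_diff_distrib inner_diff_right)
  then show ?thesis using metric_pos[OF c, of "X - Y"] by force
qed

lemma cgrad_zero:
  assumes c: "c \<in> atlas M" "x \<in> chart_dom c" and V: "open V" "x \<in> V" "\<And>z. z \<in> V \<Longrightarrow> u z = 0"
  shows "cgrad u c x = 0"
proof -
  have "partials u c x = 0"
    using du_locally_const[OF c _ V(1,2), where u = u and a = 0] V(3) c by (auto simp: partials_def vec_eq_iff chart_int_def)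
  then show ?thesis using metric_cgrad[OF c, of u] by (intro vec_eq_if_metric_eq[OF c]) simp
qed

lemma test_functions_interiorD:
  assumes "u \<in> test_functions_interior M"
  shows "smooth_function M u" and "x \<in> mfd_boundary M \<Longrightarrow> x \<in> - closure {x. u x \<noteq> 0}"
    and "z \<in> - closure {x. u x \<noteq> 0} \<Longrightarrow> u z = 0"
  using assms closure_subset[of "{x. u x \<noteq> 0}"] by (auto simp: test_functions_interior_def)

lemma cgrad_boundary:
  assumes u: "u \<in> test_functions_interior M" and "c \<in> atlas M" "x \<in> chart_dom c" "x \<in> mfd_boundary M"
  shows "cgrad u c x = 0"
  by (rule cgrad_zero[OF assms(2,3) _ test_functions_interiorD(2)[OF u assms(4)] test_functions_interiorD(3)[OF u]])
    (auto simp: open_Compl)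

lemma measurable_cgrad:
  assumes u: "smooth_function M u" and c: "c \<in> atlas M"
  shows "cgrad u c \<in> borel_measurable (restrict_space borel (chart_dom c))"
proof -
  let ?R = "restrict_space borel (chart_dom c)"
  have "continuous_on (chart_dom c) (\<lambda>x. metric M c (chart_inv c (snd c x)))"
    by (rule continuous_on_compose2[OF continuous_metric[OF c] continuous_chart[OF c]]) auto
  then have "continuous_on (chart_dom c) (metric M c)"
    by (rule continuous_on_eq) (use c in auto)
  then have g: "(\<lambda>x. metric M c x $ i $ j) \<in> borel_measurable ?R" for i j
    by (intro borel_measurable_continuous_on_restrict continuous_intros)
  let ?D = "chart_dom c \<inter> snd c -` chart_int c"
  have D: "open ?D" by (rule open_chart_preimage[OF c open_chart_int[OF c]])
  have b: "(\<lambda>x. partials u c x $ i) \<in> borel_measurable ?R" for i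
  proof -
    have "continuous_on ?D (\<lambda>x. du u c x (axis i 1))"
      unfolding du_def
      by (rule continuous_on_compose2[OF smooth_on_open_continuous_derivative[OF smooth_on_chart_int[OF u c]]
            continuous_on_subset[OF continuous_chart[OF c]]]) auto
    from borel_measurable_continuous_on_indicator[OF borel_open[OF D] this]
    have "(\<lambda>x. indicator ?D x *\<^sub>R du u c x (axis i 1)) \<in> borel_measurable ?R"
      by (rule measurable_restrict_space1)
    then show ?thesis
      by (rule measurable_cong[THEN iffD1, rotated])
        (auto simp: partials_def space_restrict_space chart_int_def split: split_indicator)
  qed
  have det_m: "(\<lambda>x. det (A x)) \<in> borel_measurable ?R"
    if "\<And>i j. (\<lambda>x. A x $ i $ j) \<in> borel_measurable ?R" for A :: "'a \<Rightarrow> real^'n::{finite,wellorder}^'n::{finite,wellorder}"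
    unfolding det_def by (intro borel_measurable_sum borel_measurable_times borel_measurable_const borel_measurable_prod that)
  have "(\<lambda>x. cgrad u c x $ k) \<in> borel_measurable ?R" for k
    unfolding cgrad_def vec_lambda_beta
  proof (intro borel_measurable_divide det_m)
    show "(\<lambda>x. (\<chi> i j. if j = k then partials u c x $ i else metric M c x $ i $ j) $ i $ j) \<in> borel_measurable ?R" for i j
      using b g by (cases "j = k") auto
  qed (rule g)
  then show ?thesis
    by (subst borel_measurable_euclidean_space) (auto simp: Basis_vec_def inner_axis)
qed

text \<open>At boundary points both sides are zero. Elsewhere both vectors have the same inner products with all
  tangent vectors, namely the values of the differential.\<close>

lemma cgrad_transition:
  assumes u: "u \<in> test_functions_interior M" and c: "c \<in> atlas M" "x \<in> chart_dom c" and c': "c' \<in> atlas M" "x \<in> chart_dom c'"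
  shows "cgrad u c' x = dtransition c c' x (cgrad u c x)"
proof (cases "x \<in> mfd_boundary M")
  case True
  then show ?thesis
    using cgrad_boundary[OF u c] cgrad_boundary[OF u c'] linear_0[OF dtransition_linear[OF c(1) c'(1) c(2) c'(2)]] by simp
next
  case False
  let ?T = "dtransition c c' x"
  have i: "snd c x \<in> chart_int c" "snd c' x \<in> chart_int c'" using not_boundary c c' False by auto
  note s = test_functions_interiorD(1)[OF u]
  show ?thesis
  proof (rule vec_eq_if_metric_eq[OF c'])
    fix w
    obtain v where v: "w = ?T v"
      using dtransition_surj[OF c(1) c'(1) c(2) c'(2)] by (metis surjD)
    have "w \<bullet> (metric M c' x *v cgrad u c' x) = du u c' x (?T v)"
      using inner_partials[OF s c'(1) i(2)] v by (simp add: metric_cgrad[OF c'])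
    also have "\<dots> = v \<bullet> (metric M c x *v cgrad u c x)"
      using inner_partials[OF s c(1) i(1)] du_transition[OF s c i(1) c' i(2)] by (simp add: metric_cgrad[OF c])
    also have "\<dots> = w \<bullet> (metric M c' x *v ?T (cgrad u c x))"
      unfolding v by (rule metric_transition[OF c(1) c'(1) c(2) c'(2)])
    finally show "w \<bullet> (metric M c' x *v cgrad u c' x) = w \<bullet> (metric M c' x *v ?T (cgrad u c x))" .
  qed
qed

text \<open>In a chart, the product of \<open>u\<close> with a test function extends by zero to a differentiable function of
  compact support on the full space; the integral of its partial derivative vanishes.\<close>

lemma weak_gradient_cgrad:
  assumes u: "u \<in> test_functions_interior M"
  shows "is_weak_gradient M u (cgrad u)"
  unfolding is_weak_gradient_def measurable_vector_field_def Let_def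
proof (intro conjI ballI allI)
  note s = test_functions_interiorD(1)[OF u]
  show "cgrad u c \<in> borel_measurable (restrict_space borel (chart_dom c))" if "c \<in> atlas M" for c
    by (rule measurable_cgrad[OF s that])
  show "cgrad u c' x = dtransition c c' x (cgrad u c x)"
    if "c \<in> atlas M" "c' \<in> atlas M" "x \<in> chart_dom c \<inter> chart_dom c'" for c c' x
    using that by (intro cgrad_transition[OF u]) auto
next
  fix c \<psi> j
  assume c: "c \<in> atlas M" and t: "\<psi> \<in> test_functions c"
  note s = test_functions_interiorD(1)[OF u]
  let ?d = "\<lambda>y. frechet_derivative \<psi> (at y) (axis j 1)"
  let ?w = "\<lambda>y. u (chart_inv c y)"
  let ?g = "\<lambda>y. (metric M c (chart_inv c y) *v cgrad u c (chart_inv c y)) $ j"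
  define K where "K = closure {y. \<psi> y \<noteq> 0}"
  have psi: "smooth_on_open UNIV \<psi>" and K: "compact K" "K \<subseteq> chart_int c" "closed K"
    using t by (auto simp: test_functions_def chart_int_def K_def)
  have psiK: "\<psi> y = 0" if "y \<notin> K" for y
    using that closure_subset[of "{y. \<psi> y \<noteq> 0}"] unfolding K_def by blast
  have oK: "open (- K)" using K(3) by (rule open_Compl)
  have dK: "?d y = 0" if "y \<notin> K" for y
  proof -
    have "((\<lambda>y. 0) has_derivative frechet_derivative \<psi> (at y)) (at y)"
      by (rule has_derivative_transform_within_open[OF smooth_on_open_has_derivative[OF psi UNIV_I] oK]) (use that psiK in auto)
    then show ?thesis
      using has_derivative_unique[OF _ has_derivative_const] by fastforce
  qed
  note sw = smooth_on_chart_int[OF s c]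
  define F' where "F' = (\<lambda>y v. if y \<in> chart_int c then ?w y * frechet_derivative \<psi> (at y) v + du u c (chart_inv c y) v * \<psi> y else 0)"
  have du_eq: "du u c (chart_inv c y) = frechet_derivative ?w (at y)" if "y \<in> chart_int c" for y
    using chart_int_D[OF c that] by (simp add: du_def)
  have der: "((\<lambda>y. ?w y * \<psi> y) has_derivative F' y) (at y)" for y
  proof (cases "y \<in> chart_int c")
    case True
    then show ?thesis
      using has_derivative_mult[OF smooth_on_open_has_derivative[OF sw True] smooth_on_open_has_derivative[OF psi UNIV_I]]
      by (simp add: F'_def du_eq)
  next
    case False
    then have y: "y \<in> - K" using K by auto
    have "((\<lambda>y. 0) has_derivative F' y) (at y)" using False by (simp add: F'_def)
    then show ?thesis
      by (rule has_derivative_transform_within_open[OF _ oK y]) (simp add: psiK)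
  qed
  have F'eq: "F' y (axis j 1) = ?w y * ?d y + ?g y * \<psi> y" for y
  proof (cases "y \<in> chart_int c")
    case True
    have "?g y = du u c (chart_inv c y) (axis j 1)"
      using chart_int_D[OF c True] metric_cgrad[OF c] True by (simp add: partials_def chart_int_def)
    then show ?thesis using True by (simp add: F'_def)
  next
    case False
    then have "y \<notin> K" using K by auto
    then show ?thesis using False psiK dK by (simp add: F'_def)
  qed
  have ind: "(\<lambda>y. indicator K y *\<^sub>R f y) = f" if "\<And>y. y \<notin> K \<Longrightarrow> f y = 0" for f :: "real^'n::{finite,wellorder} \<Rightarrow> real"
    using that by (auto simp: fun_eq_iff split: split_indicator)
  have cd: "continuous_on UNIV ?d" by (rule smooth_on_open_continuous_derivative[OF psi])
  have cw: "continuous_on K ?w" by (rule continuous_on_subset[OF smooth_on_open_continuous[OF sw] K(2)])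
  have cpsi: "continuous_on UNIV \<psi>" by (rule smooth_on_open_continuous[OF psi])
  have c1: "continuous_on K (\<lambda>y. ?w y * ?d y)"
    by (intro continuous_on_mult cw continuous_on_subset[OF cd]) auto
  have cg: "continuous_on K ?g"
  proof -
    have "continuous_on K (\<lambda>y. frechet_derivative ?w (at y) (axis j 1))"
      by (rule continuous_on_subset[OF smooth_on_open_continuous_derivative[OF sw] K(2)])
    then show ?thesis
    proof (rule continuous_on_eq)
      fix y assume "y \<in> K"
      then have y: "y \<in> chart_int c" using K by auto
      show "frechet_derivative ?w (at y) (axis j 1) = ?g y"
        using chart_int_D[OF c y] metric_cgrad[OF c] y du_eq[OF y] by (simp add: partials_def chart_int_def)
    qed
  qed
  have c2: "continuous_on K (\<lambda>y. ?g y * \<psi> y)"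
    by (intro continuous_on_mult cg continuous_on_subset[OF cpsi]) auto
  show 1: "integrable lborel (\<lambda>y. ?w y * ?d y)"
    using borel_integrable_compact[OF K(1) c1] ind[of "\<lambda>y. ?w y * ?d y"] dK by simp
  show 2: "integrable lborel (\<lambda>y. ?g y * \<psi> y)"
    using borel_integrable_compact[OF K(1) c2] ind[of "\<lambda>y. ?g y * \<psi> y"] psiK by simp
  obtain a b where ab: "K \<subseteq> cbox a b" using bounded_subset_cbox_symmetric compact_imp_bounded[OF K(1)] by metis
  have "continuous_on UNIV (\<lambda>y. F' y (axis j 1))"
  proof -
    have "isCont (\<lambda>y. F' y (axis j 1)) y" for y
    proof (cases "y \<in> chart_int c")
      case True
      have "continuous_on (chart_int c) (\<lambda>y. ?w y * ?d y + frechet_derivative ?w (at y) (axis j 1) * \<psi> y)"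
        by (intro continuous_intros smooth_on_open_continuous[OF sw] continuous_on_subset[OF cd]
            smooth_on_open_continuous_derivative[OF sw] continuous_on_subset[OF cpsi]) auto
      then have "continuous_on (chart_int c) (\<lambda>y. F' y (axis j 1))"
        by (rule continuous_on_eq) (simp add: F'_def du_eq)
      then show ?thesis using True open_chart_int[OF c] by (simp add: continuous_on_eq_continuous_at)
    next
      case False
      then have y: "y \<in> - K" using K by auto
      have "continuous_on (- K) (\<lambda>y. F' y (axis j 1))"
        by (rule continuous_on_eq[of _ "\<lambda>_. 0"]) (auto simp: F'eq psiK dK)
      then show ?thesis using y oK by (simp add: continuous_on_eq_continuous_at)
    qed
    then show ?thesis by (simp add: continuous_at_imp_continuous_on)
  qed
  from integral_derivative_compact_support(2)[OF der this, of a b]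
  have "(\<integral>y. F' y (axis j 1) \<partial>lborel) = 0" using ab psiK by fastforce
  then show "(\<integral>y. ?w y * ?d y \<partial>lborel) = - (\<integral>y. ?g y * \<psi> y \<partial>lborel)"
    unfolding F'eq using Bochner_Integration.integral_add[OF 1 2] by simp
qed

text \<open>For the gradient \<open>X\<close> of \<open>u\<close>, the slope bound applied to \<open>X\<close> itself gives
  \<open>\<bar>X\<bar>\<^sup>2 = du X \<le> C * \<bar>X\<bar>\<close>. The function \<open>w\<close> stands for an arbitrary representative of the class of
  \<open>u\<close>, for which only the existence of a weak gradient is known.\<close>

lemma grad_norm_bound:
  assumes u: "u \<in> test_functions_interior M" and w: "w \<in> borel_measurable borel" "AE x in wmeasure M. w x = u x"
    and X: "\<exists>X. is_weak_gradient M w X"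
    and C: "\<And>x. x \<notin> mfd_boundary M \<Longrightarrow> slope_le u (C x) x" "\<And>x. 0 \<le> C x"
  shows "AE x in wmeasure M. 0 \<le> grad_norm M w x \<and> grad_norm M w x \<le> C x"
proof -
  have g: "is_weak_gradient M w (grad M w)" unfolding grad_def by (rule someI_ex[OF X])
  have um: "u \<in> borel_measurable borel"
    by (rule borel_measurable_continuous_onI[OF continuous_smooth_function[OF test_functions_interiorD(1)[OF u]]])
  have "AE x in wmeasure M. \<forall>c\<in>atlas M. x \<in> chart_dom c \<longrightarrow> grad M w c x = cgrad u c x"
    by (rule weak_gradient_unique[OF g weak_gradient_cgrad[OF u] w(1) um w(2)])
  then show ?thesis
  proof eventually_elim
    case (elim x)
    let ?c = "chart_at M x"
    have c: "?c \<in> atlas M" "x \<in> chart_dom ?c" by (rule chart_at)+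
    have e: "grad_norm M w x = gnorm M ?c x (cgrad u ?c x)"
      unfolding grad_norm_def tangent_norm_gnorm using elim c by simp
    let ?X = "cgrad u ?c x"
    have "gnorm M ?c x ?X \<le> C x"
    proof (cases "x \<in> mfd_boundary M")
      case True
      then have "?X = 0" by (rule cgrad_boundary[OF u c])
      then show ?thesis using C(2) by (simp add: gnorm_def)
    next
      case False
      have "(gnorm M ?c x ?X)\<^sup>2 = du u ?c x ?X"
        using gnorm_power2[OF c] metric_cgrad[OF c]
          inner_partials[OF test_functions_interiorD(1)[OF u] c(1) not_boundary[OF c False]] by simp
      also have "\<dots> \<le> C x * gnorm M ?c x ?X"
        using C(1)[OF False] c unfolding slope_le_def by (meson abs_le_D1)
      finally have "gnorm M ?c x ?X * gnorm M ?c x ?X \<le> C x * gnorm M ?c x ?X" by (simp add: power2_eq_square)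
      then show ?thesis
        using gnorm_nonneg[OF c, of ?X] C(2)[of x] by (cases "gnorm M ?c x ?X = 0") auto
    qed
    then show ?case using e gnorm_nonneg[OF c] by simp
  qed
qed

end

section \<open>Smoothing a Lipschitz function\<close>

lemma cube_in_open:
  fixes y :: "'b::euclidean_space"
  assumes "open W" "y \<in> W"
  obtains s where "s > 0" "cube y s \<subseteq> W"
proof -
  obtain e where e: "e > 0" "ball y e \<subseteq> W" using openE[OF assms] .
  define s where "s = e / (2 * DIM('b))"
  have s: "s > 0" using e by (simp add: s_def)
  have "z \<in> ball y e" if z: "z \<in> cube y s" for z
  proof -
    have "norm (z - y) \<le> (\<Sum>i\<in>Basis. \<bar>(z - y) \<bullet> i\<bar>)" by (rule norm_le_l1)
    also have "\<dots> \<le> (\<Sum>i\<in>(Basis::'b set). s)"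
      using z by (intro sum_mono) (auto simp: mem_box inner_diff_left inner_add_left abs_le_iff algebra_simps)
    also have "\<dots> < e" using e by (simp add: s_def)
    finally show ?thesis by (simp add: dist_norm norm_minus_commute)
  qed
  then show thesis using that[OF s] e by blast
qed

lemma derivative_bound_of_local_lipschitz:
  fixes F :: "'b::real_normed_vector \<Rightarrow> real"
  assumes F: "(F has_derivative D) (at y)" and W: "open W" "y \<in> W"
    and le: "\<And>t. t > 0 \<Longrightarrow> y + t *\<^sub>R v \<in> W \<Longrightarrow> \<bar>F (y + t *\<^sub>R v) - F y\<bar> \<le> t * B"
  shows "\<bar>D v\<bar> \<le> B"
proof -
  have "((\<lambda>t. F (y + t *\<^sub>R v)) has_derivative (\<lambda>t. D (t *\<^sub>R v))) (at 0)"
    by (rule has_derivative_compose[of "\<lambda>t. y + t *\<^sub>R v"]) (use F in \<open>auto intro!: derivative_eq_intros\<close>)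
  then have "((\<lambda>t. F (y + t *\<^sub>R v)) has_real_derivative D v) (at 0)"
    using linear_cmul[OF has_derivative_linear[OF F]]
    by (simp add: has_field_derivative_def mult_commute_abs)
  then have "((\<lambda>t. (F (y + t *\<^sub>R v) - F y) / t) \<longlongrightarrow> D v) (at 0)"
    by (simp add: has_field_derivative_iff)
  then have lim: "((\<lambda>t. \<bar>(F (y + t *\<^sub>R v) - F y) / t\<bar>) \<longlongrightarrow> \<bar>D v\<bar>) (at_right 0)"
    by (intro tendsto_rabs) (rule tendsto_mono[OF at_le[OF subset_UNIV]])
  have "((\<lambda>t. y + t *\<^sub>R v) \<longlongrightarrow> y + 0 *\<^sub>R v) (at_right 0)"
    by (intro tendsto_intros)
  then have "eventually (\<lambda>t. y + t *\<^sub>R v \<in> W) (at_right 0)"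
    using W by (simp add: topological_tendstoD)
  moreover have "eventually (\<lambda>t. t > 0) (at_right (0::real))" by (simp add: eventually_at_filter)
  ultimately have "eventually (\<lambda>t. \<bar>(F (y + t *\<^sub>R v) - F y) / t\<bar> \<le> B) (at_right 0)"
  proof eventually_elim
    case (elim t)
    then show ?case using le[of t] by (simp add: abs_divide field_simps)
  qed
  then show ?thesis by (rule tendsto_upperbound[OF lim]) simp
qed

context weighted_manifold
begin

text \<open>The values of \<open>rdist\<close> are extended reals; comparing them with a real bound \<open>l\<close> leaves pairs of
  points at infinite distance unconstrained.\<close>

definition lipschitz1 :: "('a \<Rightarrow> real) \<Rightarrow> bool" where
  "lipschitz1 f \<longleftrightarrow> (\<forall>x y l. 0 \<le> l \<longrightarrow> rdist M x y \<le> ennreal l \<longrightarrow> \<bar>f x - f y\<bar> \<le> l)"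

lemma lipschitz1_chart:
  assumes f: "lipschitz1 f" and c: "c \<in> atlas M" and K: "convex K" "K \<subseteq> chart_img c" "y \<in> K" "z \<in> K"
    and B: "\<And>w. w \<in> K \<Longrightarrow> gnorm M c (chart_inv c w) (z - y) \<le> B"
  shows "\<bar>f (chart_inv c y) - f (chart_inv c z)\<bar> \<le> B"
proof -
  have "0 \<le> gnorm M c (chart_inv c y) (z - y)" using K by (intro gnorm_nonneg c chart_inv_in[OF c]) auto
  also have "\<dots> \<le> B" by (rule B[OF K(3)])
  finally show ?thesis
    using f rdist_chart_segment[OF c K B] unfolding lipschitz1_def by blast
qed

lemma continuous_gnorm: "continuous_on A (gnorm M c x)"
  unfolding gnorm_def by (intro continuous_intros)

lemma gnorm_zero [simp]: "gnorm M c x 0 = 0"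
  by (simp add: gnorm_def)

lemma gnorm_minus_commute: "gnorm M c x (v - w) = gnorm M c x (w - v)"
  using gnorm_scaleR[of c x "-1" "v - w"] by simp

text \<open>In a chart around the point, the distance is at most twice the norm of the difference of the
  coordinates.\<close>

lemma continuous_lipschitz1:
  assumes f: "lipschitz1 f"
  shows "continuous_on UNIV f"
proof -
  have "isCont f x" for x
  proof -
    let ?c = "chart_at M x"
    have c: "?c \<in> atlas M" "x \<in> chart_dom ?c" by (rule chart_at)+
    let ?y = "snd ?c x"
    obtain R where R: "R > 0" "ball ?y R \<inter> half_space \<subseteq> snd ?c ` (chart_dom ?c \<inter> UNIV)"
      "\<And>y v. y \<in> ball ?y R \<inter> half_space \<Longrightarrow> gnorm M ?c (chart_inv ?c y) v \<le> (1 + 1) * gnorm M ?c x v"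
      by (rule metric_nearly_constant[OF c open_UNIV UNIV_I, of 1]) auto
    let ?K = "ball ?y R \<inter> half_space"
    have K: "convex ?K" "?K \<subseteq> chart_img ?c" using R by (auto intro: convex_Int convex_half_space)
    have yK: "?y \<in> ?K" using R c chart_img_half_space[OF c(1)] by auto
    let ?U = "chart_dom ?c \<inter> snd ?c -` ball ?y R"
    have U: "open ?U" "x \<in> ?U" using open_chart_preimage[OF c(1)] c R by auto
    have le: "\<bar>f z - f x\<bar> \<le> 2 * gnorm M ?c x (snd ?c z - ?y)" if "z \<in> ?U" for z
    proof -
      have zK: "snd ?c z \<in> ?K" using that chart_img_half_space[OF c(1)] by auto
      have "\<bar>f (chart_inv ?c ?y) - f (chart_inv ?c (snd ?c z))\<bar> \<le> 2 * gnorm M ?c x (snd ?c z - ?y)"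
        by (rule lipschitz1_chart[OF f c(1) K yK zK]) (use R(3) in simp)
      then show ?thesis using that c by (simp add: abs_minus_commute)
    qed
    have lim: "((\<lambda>z. 2 * gnorm M ?c x (snd ?c z - ?y)) \<longlongrightarrow> 0) (at x)"
    proof -
      have "continuous_on ?U (\<lambda>z. 2 * gnorm M ?c x (snd ?c z - ?y))"
        by (intro continuous_intros continuous_on_compose2[OF continuous_gnorm[of UNIV]]
            continuous_on_subset[OF continuous_chart[OF c(1)]]) auto
      then have "isCont (\<lambda>z. 2 * gnorm M ?c x (snd ?c z - ?y)) x"
        using U continuous_on_eq_continuous_at by blast
      then show ?thesis by (simp add: isCont_def)
    qed
    have ev: "eventually (\<lambda>z. z \<in> ?U) (at x)"
      using U by (auto simp: eventually_at_topological)
    have "((\<lambda>z. f z - f x) \<longlongrightarrow> 0) (at x)"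
      by (rule Lim_null_comparison[OF eventually_mono[OF ev] lim]) (use le in auto)
    then show ?thesis by (simp add: isCont_def LIM_zero_iff)
  qed
  then show ?thesis by (simp add: continuous_at_imp_continuous_on)
qed

text \<open>Locally, the partial derivatives are bounded and the Riemannian norm dominates a multiple of the
  Euclidean one; near the boundary the function vanishes. The manifold is compact.\<close>

lemma bounded_slope:
  assumes u: "u \<in> test_functions_interior M"
  obtains C where "0 \<le> C" "\<And>z. z \<notin> mfd_boundary M \<Longrightarrow> slope_le u C z"
proof -
  note s = test_functions_interiorD(1)[OF u]
  have "\<exists>V C. open V \<and> x \<in> V \<and> 0 \<le> C \<and> (\<forall>z\<in>V - mfd_boundary M. slope_le u C z)" for x
  proof (cases "x \<in> mfd_boundary M")
    case True
    let ?V = "- closure {x. u x \<noteq> 0}"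
    have V: "open ?V" by (simp add: open_Compl)
    have "slope_le u 0 z" if z: "z \<in> ?V" "z \<notin> mfd_boundary M" for z
    proof (rule slope_leI[OF s z(2) chart_at])
      have "du u (chart_at M z) z v = 0" for v
        by (rule du_locally_const[OF chart_at not_boundary[OF chart_at z(2)] V z(1)])
          (rule test_functions_interiorD(3)[OF u])
      then show "\<bar>du u (chart_at M z) z v\<bar> \<le> 0 * gnorm M (chart_at M z) z v" for v
        by simp
    qed
    then show ?thesis
      using V test_functions_interiorD(2)[OF u True] by (intro exI[of _ ?V] exI[of _ 0]) auto
  next
    case False
    let ?c = "chart_at M x"
    have c: "?c \<in> atlas M" "x \<in> chart_dom ?c" by (rule chart_at)+
    let ?y = "snd ?c x" and ?w = "\<lambda>y. u (chart_inv ?c y)"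
    have yi: "?y \<in> chart_int ?c" by (rule not_boundary[OF c False])
    obtain R where R: "R > 0" "ball ?y R \<inter> half_space \<subseteq> snd ?c ` (chart_dom ?c \<inter> UNIV)"
      "\<And>y v. y \<in> ball ?y R \<inter> half_space \<Longrightarrow> gnorm M ?c x v \<le> (1 + 1) * gnorm M ?c (chart_inv ?c y) v"
      by (rule metric_nearly_constant[OF c open_UNIV UNIV_I, of 1]) auto
    obtain m where m: "m > 0" "\<And>v. m * (norm v)\<^sup>2 \<le> v \<bullet> (metric M ?c x *v v)"
      using gnorm_lower_bound[OF c] by blast
    define S where "S = (\<lambda>y. \<Sum>i\<in>UNIV. \<bar>frechet_derivative ?w (at y) (axis i 1)\<bar>)"
    have "continuous_on (chart_int ?c) S"
      unfolding S_def by (intro continuous_intros smooth_on_open_continuous_derivative[OF smooth_on_chart_int[OF s c(1)]])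
    from continuous_open_preimage[OF this open_chart_int[OF c(1)], of "{..<S ?y + 1}"]
    have W0: "open (chart_int ?c \<inter> S -` {..<S ?y + 1})" by simp
    have W: "open (chart_int ?c \<inter> S -` {..<S ?y + 1} \<inter> ball ?y R)" by (rule open_Int[OF W0 open_ball])
    let ?W = "chart_int ?c \<inter> S -` {..<S ?y + 1} \<inter> ball ?y R"
    let ?V = "chart_dom ?c \<inter> snd ?c -` ?W"
    let ?C = "(S ?y + 1) / sqrt m * 2"
    have S0: "0 \<le> S y" for y unfolding S_def by (intro sum_nonneg) auto
    have V: "open ?V" by (rule open_chart_preimage[OF c(1) W])
    have "slope_le u ?C z" if z: "z \<in> ?V" "z \<notin> mfd_boundary M" for z
    proof (rule slope_leI[OF s z(2) c(1)])
      show "z \<in> chart_dom ?c" using z by simp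
      fix v
      have zi: "snd ?c z \<in> chart_int ?c" using z by simp
      have h: "snd ?c z \<in> ball ?y R \<inter> half_space"
        using z chart_img_half_space[OF c(1)] by auto
      have zc: "chart_inv ?c (snd ?c z) = z" using z c by simp
      have "du u ?c z v = v \<bullet> partials u ?c z"
        using inner_partials[OF s c(1) zi] by simp
      also have "\<dots> = (\<Sum>i\<in>UNIV. v $ i * frechet_derivative ?w (at (snd ?c z)) (axis i 1))"
        using zi by (simp add: inner_vec_def partials_def chart_int_def du_def)
      also have "\<bar>\<dots>\<bar> \<le> (\<Sum>i\<in>UNIV. norm v * \<bar>frechet_derivative ?w (at (snd ?c z)) (axis i 1)\<bar>)"
        by (rule order_trans[OF sum_abs]) (auto intro!: sum_mono mult_right_mono component_le_norm_cart simp: abs_mult)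
      also have "\<dots> = norm v * S (snd ?c z)" by (simp add: S_def sum_distrib_left)
      also have "\<dots> \<le> norm v * (S ?y + 1)" using z by (intro mult_left_mono) auto
      finally have 1: "\<bar>du u ?c z v\<bar> \<le> norm v * (S ?y + 1)" .
      have "sqrt m * norm v \<le> gnorm M ?c x v"
        using real_sqrt_le_mono[OF m(2)[of v]] by (simp add: gnorm_def real_sqrt_mult)
      also have "\<dots> \<le> 2 * gnorm M ?c z v" using R(3)[OF h, of v] zc by simp
      finally have "norm v \<le> 2 * gnorm M ?c z v / sqrt m" using m(1) by (simp add: field_simps)
      then have "norm v * (S ?y + 1) \<le> 2 * gnorm M ?c z v / sqrt m * (S ?y + 1)"
        using S0[of ?y] by (intro mult_right_mono) auto
      with 1 show "\<bar>du u ?c z v\<bar> \<le> ?C * gnorm M ?c z v" by (simp add: field_simps)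
    qed
    moreover have "x \<in> ?V" using c yi R by simp
    moreover have "0 \<le> ?C" using S0[of ?y] m by simp
    ultimately show ?thesis using V by blast
  qed
  then obtain V C where VC: "\<And>x. open (V x)" "\<And>x. x \<in> V x" "\<And>x. 0 \<le> C x"
    "\<And>x z. z \<in> V x \<Longrightarrow> z \<notin> mfd_boundary M \<Longrightarrow> slope_le u (C x) z"
    by (metis DiffI)
  obtain I where I: "finite I" "UNIV \<subseteq> (\<Union>x\<in>I. V x)"
    by (rule compactE_image[OF compact_M, of UNIV V]) (use VC in auto)
  show thesis
  proof (rule that[of "\<Sum>x\<in>I. C x"])
    show "0 \<le> (\<Sum>x\<in>I. C x)" using VC by (intro sum_nonneg)
    fix z assume z: "z \<notin> mfd_boundary M"
    obtain x where x: "x \<in> I" "z \<in> V x" using I by blast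
    have le: "C x \<le> (\<Sum>x\<in>I. C x)" by (rule member_le_sum[OF x(1)]) (use VC I in auto)
    have "slope_le u (C x) z" by (rule VC(4)[OF x(2) z])
    then show "slope_le u (\<Sum>x\<in>I. C x) z"
      unfolding slope_le_def
      using mult_right_mono[OF le gnorm_nonneg] by (meson order_trans)
  qed
qed

text \<open>A smooth substitute of \<open>1 / t\<close> which stays finite down to \<open>t = 0\<close>: the denominator is the sum of
  \<open>t\<close> and a bump that vanishes for \<open>t \<ge> \<sigma>\<close>. Multiplying finitely many nonnegative functions by the
  value at their sum gives weights that add up to at most 1, and to exactly 1 where the sum is at
  least \<open>\<sigma>\<close>.\<close>

lemma smooth_reciprocal_weight:
  assumes "\<sigma> > 0"
  obtains T \<Omega> where "smooth_on_open T \<Omega>" "{0..} \<subseteq> T" "\<And>t. 0 \<le> t \<Longrightarrow> 0 \<le> \<Omega> t"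
    "\<And>t. 0 \<le> t \<Longrightarrow> t * \<Omega> t \<le> (1::real)" "\<And>t. \<sigma> \<le> t \<Longrightarrow> t * \<Omega> t = 1"
proof -
  define d where "d = (\<lambda>t. t + flat_exp 0 (\<sigma> - t))"
  have sd: "smooth_on_open UNIV d"
    unfolding d_def
    by (intro smooth_on_open_add smooth_on_open_id smooth_on_open_compose[OF smooth_flat_exp]
        smooth_on_open_diff smooth_on_open_const) auto
  have pos: "0 < d t" if "0 \<le> t" for t
    using that assms flat_exp_bounds(1)[of "\<sigma> - t"] flat_exp_bounds(3)[of "\<sigma> - t"]
    by (cases "t = 0") (auto simp: d_def)
  let ?T = "{t. 0 < d t}"
  have T: "open ?T"
    using smooth_on_open_continuous[OF sd] by (intro open_Collect_less continuous_intros)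
  show thesis
  proof (rule that[of ?T "\<lambda>t. inverse (d t)"])
    show "smooth_on_open ?T (\<lambda>t. inverse (d t))"
      by (rule smooth_on_open_compose[OF smooth_on_open_inverse smooth_on_open_subset[OF sd T]]) auto
    show "{0..} \<subseteq> ?T" using pos by auto
    show "0 \<le> inverse (d t)" if "0 \<le> t" for t using pos[OF that] by simp
    show "t * inverse (d t) \<le> 1" if "0 \<le> t" for t
      using pos[OF that] flat_exp_bounds(1)[of "\<sigma> - t"] by (simp add: field_simps d_def)
    show "t * inverse (d t) = 1" if "\<sigma> \<le> t" for t
      using that assms by (simp add: d_def flat_exp_def)
  qed
qed

text \<open>On a small cube in a chart around \<open>x\<close>, the function \<open>f\<close> is Lipschitz with respect to the frozen norm
  at \<open>x\<close>, up to a factor close to 1, and this norm is dominated by the norms at the other points of the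
  cube. The factor 3 leaves room for bump functions supported in the cube of radius \<open>r\<close> and for
  averages over small cubes centred in the cube of radius \<open>2 * r\<close>.\<close>

lemma lipschitz_chart_cube:
  assumes f: "lipschitz1 f" and V: "open V" "x \<in> V" and x: "x \<notin> mfd_boundary M" and d: "\<delta> > 0"
  defines "c \<equiv> chart_at M x"
  obtains r where "r > 0" "cube (snd c x) (3 * r) \<subseteq> chart_int c \<inter> snd c ` (chart_dom c \<inter> V)"
    "\<And>y z. y \<in> cube (snd c x) (3 * r) \<Longrightarrow>
       z \<in> cube (snd c x) (3 * r) \<Longrightarrow>
       \<bar>f (chart_inv c y) - f (chart_inv c z)\<bar> \<le> (1 + \<delta>) * gnorm M c x (y - z)"
    "\<And>y v. y \<in> cube (snd c x) (3 * r) \<Longrightarrow>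
       gnorm M c x v \<le> (1 + \<delta>) * gnorm M c (chart_inv c y) v"
proof -
  have c: "c \<in> atlas M" "x \<in> chart_dom c" unfolding c_def by (rule chart_at)+
  let ?y = "snd c x"
  have yi: "?y \<in> chart_int c" by (rule not_boundary[OF c x])
  obtain R where R: "R > 0" "ball ?y R \<inter> half_space \<subseteq> snd c ` (chart_dom c \<inter> V)"
    "\<And>y v. y \<in> ball ?y R \<inter> half_space \<Longrightarrow> gnorm M c (chart_inv c y) v \<le> (1 + \<delta>) * gnorm M c x v"
    "\<And>y v. y \<in> ball ?y R \<inter> half_space \<Longrightarrow> gnorm M c x v \<le> (1 + \<delta>) * gnorm M c (chart_inv c y) v"
    by (rule metric_nearly_constant[OF c V d]) auto
  have "open (chart_int c \<inter> ball ?y R)" "?y \<in> chart_int c \<inter> ball ?y R"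
    using open_chart_int[OF c(1)] yi R by auto
  then obtain s where s: "s > 0" "cube ?y s \<subseteq> chart_int c \<inter> ball ?y R"
    by (rule cube_in_open)
  have sub: "cube ?y s \<subseteq> ball ?y R \<inter> half_space"
    using s chart_img_half_space[OF c(1)] by (auto simp: chart_int_def)
  show thesis
  proof (rule that[of "s / 3"])
    show "cube ?y (3 * (s / 3)) \<subseteq> chart_int c \<inter> snd c ` (chart_dom c \<inter> V)"
      using s sub R(2) by auto
    show "\<bar>f (chart_inv c y) - f (chart_inv c z)\<bar> \<le> (1 + \<delta>) * gnorm M c x (y - z)"
      if "y \<in> cube ?y (3 * (s / 3))"
        "z \<in> cube ?y (3 * (s / 3))" for y z
    proof (rule lipschitz1_chart[OF f c(1)])
      show "convex (cube ?y s)" by (rule convex_box)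
      show "cube ?y s \<subseteq> chart_img c" using s by (auto simp: chart_int_def)
      show "gnorm M c (chart_inv c w) (z - y) \<le> (1 + \<delta>) * gnorm M c x (y - z)"
        if "w \<in> cube ?y s" for w
        using R(3)[OF subsetD[OF sub that], of "z - y"] by (simp add: gnorm_minus_commute[of c x z y])
    qed (use that in auto)
    show "gnorm M c x v \<le> (1 + \<delta>) * gnorm M c (chart_inv c y) v"
      if "y \<in> cube ?y (3 * (s / 3))" for y v
    proof (rule R(4), rule subsetD[OF sub])
      show "y \<in> cube ?y s" using that by simp
    qed
  qed (use s in simp)
qed

end

text \<open>Averages over cubes on which \<open>N\<close> is smaller than \<open>\<eta>\<close> differ from \<open>g\<close> by at most \<open>\<eta>\<close>.\<close>

lemma cube_mollification:
  fixes g :: "'b::euclidean_space \<Rightarrow> real"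
  assumes r: "r > 0" and cont: "continuous_on (cube y0 (3 * r)) g"
    and N: "continuous_on UNIV N" "N 0 = 0" and eta: "\<eta> > 0"
    and lip: "\<And>y z. y \<in> cube y0 (3 * r) \<Longrightarrow>
      z \<in> cube y0 (3 * r) \<Longrightarrow> \<bar>g y - g z\<bar> \<le> N (y - z)"
  shows "\<exists>F. smooth_on_open UNIV F \<and>
    (\<forall>y\<in>cube y0 (2 * r). \<bar>F y - g y\<bar> \<le> \<eta>) \<and>
    (\<forall>y\<in>cube y0 (2 * r).
     \<forall>z\<in>cube y0 (2 * r). F y - F z \<le> N (y - z))"
proof -
  let ?Q3 = "cube y0 (3 * r)"
  let ?Q2 = "cube y0 (2 * r)"
  have "open {w. N w < \<eta>}" by (intro open_Collect_less N(1) continuous_intros)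
  moreover have "0 \<in> {w. N w < \<eta>}" using N eta by simp
  ultimately obtain e' where e': "e' > 0" "cbox (0 - e' *\<^sub>R One) (0 + e' *\<^sub>R One) \<subseteq> {w. N w < \<eta>}"
    by (rule cube_in_open)
  define e where "e = min e' r"
  have e: "e > 0" "e \<le> e'" "e \<le> r" using e' r by (auto simp: e_def)
  let ?C = "\<lambda>y :: 'b. cube y e"
  have C: "?C y \<subseteq> ?Q3" if "y \<in> ?Q2" for y
  proof
    fix z assume z: "z \<in> ?C y"
    show "z \<in> ?Q3" unfolding mem_box
    proof
      fix i :: 'b assume i: "i \<in> Basis"
      have "\<bar>z \<bullet> i - y \<bullet> i\<bar> \<le> e" "\<bar>y \<bullet> i - y0 \<bullet> i\<bar> \<le> 2 * r"
        using z that i by (auto simp: mem_box inner_diff_left inner_add_left abs_le_iff algebra_simps)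
      then show "(y0 - (3 * r) *\<^sub>R One) \<bullet> i \<le> z \<bullet> i \<and> z \<bullet> i \<le> (y0 + (3 * r) *\<^sub>R One) \<bullet> i"
        using e i by (simp add: inner_diff_left inner_add_left abs_le_iff)
    qed
  qed
  have small: "N w < \<eta>" if "w \<in> cbox (- e *\<^sub>R One) (e *\<^sub>R One)" for w
  proof -
    have "w \<in> cbox (0 - e' *\<^sub>R One) (0 + e' *\<^sub>R One)"
      using that e by (fastforce simp: mem_box)
    then show ?thesis using e' by blast
  qed
  have yC: "y \<in> ?C y" for y using e by (auto simp: mem_box inner_diff_left inner_add_left)
  have diff: "z - y \<in> cbox (- e *\<^sub>R One) (e *\<^sub>R One)" if "z \<in> ?C y" for y z
    using that by (auto simp: mem_box inner_diff_left inner_add_left algebra_simps)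
  obtain F where F: "smooth_on_open UNIV F"
    "\<And>x u. ?C x \<subseteq> ?Q3 \<Longrightarrow> (\<And>z. z \<in> ?C x \<Longrightarrow> g z \<le> u) \<Longrightarrow> F x \<le> u"
    "\<And>x u. ?C x \<subseteq> ?Q3 \<Longrightarrow> (\<And>z. z \<in> ?C x \<Longrightarrow> u \<le> g z) \<Longrightarrow> u \<le> F x"
    "\<And>x y u. ?C x \<subseteq> ?Q3 \<Longrightarrow> ?C y \<subseteq> ?Q3 \<Longrightarrow>
          (\<And>w. w \<in> cbox (- e *\<^sub>R One) (e *\<^sub>R One) \<Longrightarrow> g (x + w) - g (y + w) \<le> u) \<Longrightarrow> F x - F y \<le> u"
    by (rule mollify[OF cont e(1)]) blast
  show ?thesis
  proof (intro exI[of _ F] conjI ballI)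
    fix y assume y: "y \<in> ?Q2"
    have near: "\<bar>g z - g y\<bar> \<le> \<eta>" if "z \<in> ?C y" for z
    proof -
      have "\<bar>g z - g y\<bar> \<le> N (z - y)" using lip that C[OF y] yC[of y] by blast
      also have "\<dots> \<le> \<eta>" using small[OF diff[OF that]] by simp
      finally show ?thesis .
    qed
    have "F y \<le> g y + \<eta>" "g y - \<eta> \<le> F y"
      by (rule F(2)[OF C[OF y]], use near in force) (rule F(3)[OF C[OF y]], use near in force)
    then show "\<bar>F y - g y\<bar> \<le> \<eta>" by simp
    fix z assume z: "z \<in> ?Q2"
    show "F y - F z \<le> N (y - z)"
    proof (rule F(4)[OF C[OF y] C[OF z]])
      fix w :: 'b assume w: "w \<in> cbox (- e *\<^sub>R One) (e *\<^sub>R One)"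
      then have "x + w \<in> ?C x" for x by (auto simp: mem_box inner_diff_left inner_add_left)
      then have "\<bar>g (y + w) - g (z + w)\<bar> \<le> N ((y + w) - (z + w))" using lip C y z by blast
      then show "g (y + w) - g (z + w) \<le> N (y - z)" by simp
    qed
  qed (rule F(1))
qed

context weighted_manifold
begin

text \<open>The set \<open>K\<close> is covered by finitely many chart cubes, with bump functions \<open>\<beta> x\<close> whose sum is \<open>s\<close> and
  weights \<open>P x = \<beta> x * \<Omega> \<circ> s\<close>. With \<open>F x\<close> the mollification of \<open>f\<close> in the chart around \<open>x\<close>, put
  \<open>\<psi> = T + (\<Sum>x. P x * (F x - T))\<close>. Its differential consists of two parts. The first one,
  \<open>\<Sum>x. P x * d(F x)\<close>, has slope at most \<open>1 + \<delta> / 2\<close>, since mollification preserves Lipschitz bounds and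
  the weights add up to at most 1. The second one, \<open>\<Sum>x. (F x - T) * d(P x)\<close>, equals
  \<open>\<Sum>x. (F x - f) * d(P x)\<close>: where \<open>f \<noteq> T\<close>, the weights add up to 1 in a neighbourhood. It is made
  small by choosing the mollification parameter after the weights, whose slopes are bounded.\<close>

lemma smooth_lipschitz_approximation:
  assumes f: "lipschitz1 f" and K: "closed K" "K \<subseteq> V" and V: "open V" "V \<inter> mfd_boundary M = {}"
    and fT: "\<And>x. x \<notin> K \<Longrightarrow> f x = T" and d: "\<delta> > 0" and eps: "\<epsilon> > 0"
  obtains \<psi> where "smooth_function M \<psi>" "\<And>x. \<bar>\<psi> x - f x\<bar> \<le> \<epsilon>"
    "\<And>x. x \<notin> mfd_boundary M \<Longrightarrow> slope_le \<psi> (1 + \<delta>) x"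
proof -
  define \<delta>' where "\<delta>' = min 1 \<delta> / 6"
  have d': "\<delta>' > 0" "(1 + \<delta>') * (1 + \<delta>') \<le> 1 + \<delta> / 2"
  proof -
    show "\<delta>' > 0" using d by (simp add: \<delta>'_def)
    have "\<delta>' * \<delta>' \<le> 1 * \<delta>'" using d by (intro mult_right_mono) (auto simp: \<delta>'_def)
    moreover have "\<delta>' \<le> \<delta> / 6" by (simp add: \<delta>'_def)
    ultimately show "(1 + \<delta>') * (1 + \<delta>') \<le> 1 + \<delta> / 2" by (simp add: algebra_simps)
  qed
  define c where "c = (\<lambda>x. chart_at M x)"
  have c: "c x \<in> atlas M" "x \<in> chart_dom (c x)" for x unfolding c_def by (rule chart_at)+
  let ?y = "\<lambda>x. snd (c x) x"
  have "\<exists>r. r > 0 \<and>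
      cube (?y x) (3 * r) \<subseteq> chart_int (c x) \<inter> snd (c x) ` (chart_dom (c x) \<inter> V) \<and>
      (\<forall>y\<in>cube (?y x) (3 * r). \<forall>z\<in>cube (?y x) (3 * r).
       \<bar>f (chart_inv (c x) y) - f (chart_inv (c x) z)\<bar> \<le> (1 + \<delta>') * gnorm M (c x) x (y - z)) \<and>
      (\<forall>y\<in>cube (?y x) (3 * r). \<forall>v.
       gnorm M (c x) x v \<le> (1 + \<delta>') * gnorm M (c x) (chart_inv (c x) y) v)" if "x \<in> K" for x
  proof -
    have x: "x \<in> V" "x \<notin> mfd_boundary M" using that K V by auto
    show ?thesis
      unfolding c_def by (rule lipschitz_chart_cube[OF f V(1) x d'(1)]) blast
  qed
  then obtain r where r: "\<And>x. x \<in> K \<Longrightarrow> r x > 0"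
    "\<And>x. x \<in> K \<Longrightarrow> cube (?y x) (3 * r x) \<subseteq> chart_int (c x) \<inter> snd (c x) ` (chart_dom (c x) \<inter> V)"
    "\<And>x y z. x \<in> K \<Longrightarrow> y \<in> cube (?y x) (3 * r x) \<Longrightarrow>
       z \<in> cube (?y x) (3 * r x) \<Longrightarrow>
       \<bar>f (chart_inv (c x) y) - f (chart_inv (c x) z)\<bar> \<le> (1 + \<delta>') * gnorm M (c x) x (y - z)"
    "\<And>x y v. x \<in> K \<Longrightarrow> y \<in> cube (?y x) (3 * r x) \<Longrightarrow>
       gnorm M (c x) x v \<le> (1 + \<delta>') * gnorm M (c x) (chart_inv (c x) y) v"
    by metis
  define Q where "Q = (\<lambda>a x. cube (?y x) (a * r x))"
  define B where "B = (\<lambda>a x. box (?y x - (a * r x) *\<^sub>R One) (?y x + (a * r x) *\<^sub>R One))"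
  have Qmono: "Q a x \<subseteq> Q a' x" if "x \<in> K" "a \<le> a'" for a a' x
  proof -
    have "a * r x \<le> a' * r x" using that r(1) by (intro mult_right_mono) (auto simp: less_imp_le)
    then show ?thesis by (fastforce simp: Q_def mem_box inner_diff_left inner_add_left)
  qed
  have BQ: "B a x \<subseteq> Q a x" for a x unfolding B_def Q_def by (rule box_subset_cbox)
  have Q1B2: "Q 1 x \<subseteq> B 2 x" if "x \<in> K" for x
    using r(1)[OF that] by (fastforce simp: Q_def B_def mem_box inner_diff_left inner_add_left)
  have Q3i: "Q 3 x \<subseteq> chart_int (c x)" "Q 3 x \<subseteq> snd (c x) ` (chart_dom (c x) \<inter> V)" if "x \<in> K" for x
    using r(2)[OF that] by (auto simp: Q_def)
  have Qimg: "Q 1 x \<subseteq> chart_img (c x)" if "x \<in> K" for x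
    using Q3i[OF that] Qmono[OF that, of 1 3] by auto
  define U where "U = (\<lambda>x. chart_dom (c x) \<inter> snd (c x) -` B 1 x)"
  define b where "b = (\<lambda>x. box_bump 1 (?y x - (1 * r x) *\<^sub>R One) (?y x + (1 * r x) *\<^sub>R One))"
  define \<beta> where "\<beta> = (\<lambda>x z. if z \<in> chart_dom (c x) then b x (snd (c x) z) else 0)"
  have U: "open (U x)" for x unfolding U_def B_def by (intro open_chart_preimage c) auto
  have xU: "x \<in> U x" if "x \<in> K" for x
    using r(1)[OF that] c by (auto simp: U_def B_def mem_box inner_diff_left inner_add_left)
  have "compact K" using compact_Int_closed[OF compact_M K(1)] by simp
  then obtain I where I: "I \<subseteq> K" "finite I" "K \<subseteq> (\<Union>x\<in>I. U x)"
    by (rule compactE_image[of K K U]) (use U xU in auto)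
  have chi_pos: "0 < \<beta> x z \<longleftrightarrow> z \<in> U x" for x z
    by (auto simp: \<beta>_def b_def box_bump_pos_iff U_def B_def)
  have chi_nonneg: "0 \<le> \<beta> x z" for x z by (auto simp: \<beta>_def b_def box_bump_nonneg)
  have bz: "b x y = 0" if "y \<notin> Q 1 x" for x y
    unfolding b_def using that BQ[of 1 x] by (intro box_bump_zero) (auto simp: B_def)
  have bs: "smooth_on_open UNIV (b x)" for x unfolding b_def by (rule smooth_box_bump)
  have lift: "smooth_function M (\<lambda>z. if z \<in> chart_dom (c x) then w (snd (c x) z) else 0)"
    if "x \<in> K" "smooth_on_open UNIV w" "\<And>y. y \<notin> Q 1 x \<Longrightarrow> w y = 0" for x w
    by (rule smooth_function_lift[OF c(1) that(2) _ Qimg[OF that(1)] that(3)]) (simp add: Q_def compact_cbox)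
  have chi_s: "smooth_function M (\<beta> x)" if "x \<in> K" for x
    unfolding \<beta>_def by (rule lift[OF that bs bz])
  \<comment> \<open>The supports of the bump functions stay away from the boundary.\<close>
  define S where "S = (\<lambda>x. chart_inv (c x) ` Q 1 x)"
  have S: "closed (S x)" "S x \<subseteq> V" if x: "x \<in> K" for x
  proof -
    have "compact (S x)" unfolding S_def
      by (rule compact_continuous_image[OF continuous_on_subset[OF continuous_chart_inv[OF c(1)] Qimg[OF x]]])
        (simp add: Q_def compact_cbox)
    then show "closed (S x)" by (rule compact_imp_closed)
    show "S x \<subseteq> V"
    proof
      fix z assume "z \<in> S x"
      then obtain y where y: "y \<in> Q 1 x" "z = chart_inv (c x) y" by (auto simp: S_def)
      then have "y \<in> snd (c x) ` (chart_dom (c x) \<inter> V)" using Qmono[OF x, of 1 3] Q3i(2)[OF x] by auto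
      then show "z \<in> V" using y c by auto
    qed
  qed
  have inS: "z \<in> S x" if "z \<in> chart_dom (c x)" "snd (c x) z \<in> Q 1 x" for x z
    unfolding S_def using that(2) chart_inv_left[OF c(1) that(1)] by (metis imageI)
  have chi_S: "\<beta> x z = 0" if "z \<notin> S x" for x z
    using that inS[of z x] bz by (auto simp: \<beta>_def)
  define s where "s = (\<lambda>z. \<Sum>x\<in>I. \<beta> x z)"
  have s0: "0 \<le> s z" for z unfolding s_def by (intro sum_nonneg chi_nonneg)
  have ss: "smooth_function M s" unfolding s_def using I chi_s by (intro smooth_function_sum) auto
  have spos: "0 < s z" if z: "z \<in> K" for z
  proof -
    obtain x where x: "x \<in> I" "z \<in> U x" using I(3) z by blast
    have "\<beta> x z \<le> s z" unfolding s_def by (rule member_le_sum[OF x(1)]) (use I chi_nonneg in auto)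
    then show ?thesis using chi_pos[of x z] x by simp
  qed
  obtain \<sigma> where sigma: "\<sigma> > 0" "\<And>z. z \<in> K \<Longrightarrow> \<sigma> < s z"
  proof (cases "K = {}")
    case False
    have "continuous_on K s" by (rule continuous_on_subset[OF continuous_smooth_function[OF ss]]) auto
    then obtain z0 where z0: "z0 \<in> K" "\<And>z. z \<in> K \<Longrightarrow> s z0 \<le> s z"
      using continuous_attains_inf[OF \<open>compact K\<close> False] by blast
    show thesis
      by (rule that[of "s z0 / 2"]) (use spos[OF z0(1)] z0(2) in \<open>force+\<close>)
  qed (use that[of 1] in auto)
  obtain TT \<Omega> where Om: "smooth_on_open TT \<Omega>" "{0..} \<subseteq> TT" "\<And>t. 0 \<le> t \<Longrightarrow> 0 \<le> \<Omega> t"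
    "\<And>t. 0 \<le> t \<Longrightarrow> t * \<Omega> t \<le> 1" "\<And>t. \<sigma> \<le> t \<Longrightarrow> t * \<Omega> t = 1"
    by (rule smooth_reciprocal_weight[OF sigma(1)]) blast
  have Oms: "smooth_function M (\<lambda>z. \<Omega> (s z))"
    by (rule smooth_function_compose[OF ss Om(1)]) (use s0 Om(2) in auto)
  define P where "P = (\<lambda>x z. \<beta> x z * \<Omega> (s z))"
  have Ps: "smooth_function M (P x)" if "x \<in> K" for x
    unfolding P_def by (intro smooth_function_mult chi_s Oms that)
  have P0: "0 \<le> P x z" for x z unfolding P_def by (intro mult_nonneg_nonneg chi_nonneg Om(3) s0)
  have sumP: "(\<Sum>x\<in>I. P x z) = s z * \<Omega> (s z)" for z
    by (simp add: P_def s_def sum_distrib_right)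
  have Ptest: "P x \<in> test_functions_interior M" if x: "x \<in> K" for x
  proof -
    have "closure {z. P x z \<noteq> 0} \<subseteq> S x"
      by (rule closure_minimal) (use chi_S S[OF x] in \<open>auto simp: P_def\<close>)
    moreover have "compact (closure {z. P x z \<noteq> 0})"
      using compact_Int_closed[OF compact_M closed_closure] by simp
    ultimately show ?thesis using S[OF x] V Ps[OF x] by (auto simp: test_functions_interior_def)
  qed
  have "\<exists>C. 0 \<le> C \<and> (\<forall>z. z \<notin> mfd_boundary M \<longrightarrow> slope_le (P x) C z)" if "x \<in> K" for x
    using bounded_slope[OF Ptest[OF that]] by metis
  then obtain C where C: "\<And>x. x \<in> K \<Longrightarrow> 0 \<le> C x" "\<And>x z. x \<in> K \<Longrightarrow> z \<notin> mfd_boundary M \<Longrightarrow> slope_le (P x) (C x) z"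
    by metis
  define CC where "CC = (\<Sum>x\<in>I. C x)"
  have CC: "0 \<le> CC" unfolding CC_def using C I by (intro sum_nonneg) auto
  \<comment> \<open>The admissible mollification error, which depends on the slopes of the weights.\<close>
  define \<eta> where "\<eta> = min \<epsilon> (\<delta> / 2 / (CC + 1))"
  have eta: "\<eta> > 0" "\<eta> \<le> \<epsilon>" "\<eta> * CC \<le> \<delta> / 2"
  proof -
    show "\<eta> > 0" "\<eta> \<le> \<epsilon>" using eps d CC by (auto simp: \<eta>_def)
    have "\<eta> \<le> \<delta> / 2 / (CC + 1)" by (simp add: \<eta>_def)
    then have "\<eta> * (CC + 1) \<le> \<delta> / 2" using CC by (subst (asm) pos_le_divide_eq) auto
    then show "\<eta> * CC \<le> \<delta> / 2" using \<open>\<eta> > 0\<close> by (simp add: distrib_left)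
  qed
  have "\<exists>F. smooth_on_open UNIV F \<and> (\<forall>y\<in>Q 2 x. \<bar>F y - f (chart_inv (c x) y)\<bar> \<le> \<eta>) \<and>
    (\<forall>y\<in>Q 2 x. \<forall>z\<in>Q 2 x. F y - F z \<le> (1 + \<delta>') * gnorm M (c x) x (y - z))" if x: "x \<in> K" for x
    unfolding Q_def
  proof (rule cube_mollification[OF r(1)[OF x] _ _ _ eta(1)])
    show "continuous_on (cube (?y x) (3 * r x)) (\<lambda>y. f (chart_inv (c x) y))"
      using Q3i(1)[OF x]
      by (intro continuous_on_compose2[OF continuous_lipschitz1[OF f] continuous_on_subset[OF continuous_chart_inv[OF c(1)]]])
        (auto simp: Q_def chart_int_def)
    show "continuous_on UNIV (\<lambda>v. (1 + \<delta>') * gnorm M (c x) x v)"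
      by (intro continuous_intros continuous_gnorm)
  qed (use r(3)[OF x] in auto)
  then obtain F where F: "\<And>x. x \<in> K \<Longrightarrow> smooth_on_open UNIV (F x)"
    "\<And>x y. x \<in> K \<Longrightarrow> y \<in> Q 2 x \<Longrightarrow> \<bar>F x y - f (chart_inv (c x) y)\<bar> \<le> \<eta>"
    "\<And>x y z. x \<in> K \<Longrightarrow> y \<in> Q 2 x \<Longrightarrow> z \<in> Q 2 x \<Longrightarrow> F x y - F x z \<le> (1 + \<delta>') * gnorm M (c x) x (y - z)"
    by metis
  have DF: "\<bar>frechet_derivative (F x) (at y) v\<bar> \<le> (1 + \<delta>') * gnorm M (c x) x v" if x: "x \<in> K" and y: "y \<in> B 2 x" for x y v
  proof (rule derivative_bound_of_local_lipschitz[OF smooth_on_open_has_derivative[OF F(1)[OF x] UNIV_I]])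
    show "open (B 2 x)" unfolding B_def by (rule open_box)
    fix t :: real assume t: "0 < t" "y + t *\<^sub>R v \<in> B 2 x"
    have "y \<in> Q 2 x" "y + t *\<^sub>R v \<in> Q 2 x" using y t BQ[of 2 x] by auto
    from F(3)[OF x this] F(3)[OF x this(2,1)]
    show "\<bar>F x (y + t *\<^sub>R v) - F x y\<bar> \<le> t * ((1 + \<delta>') * gnorm M (c x) x v)"
      using t gnorm_minus_commute[of "c x" x y "y + t *\<^sub>R v"] gnorm_scaleR[of "c x" x t v] by (simp add: ac_simps)
  qed (rule y)
  define h where "h = (\<lambda>x z. if z \<in> chart_dom (c x) then b x (snd (c x) z) * (F x (snd (c x) z) - T) else 0)"
  have hs: "smooth_function M (h x)" if "x \<in> K" for x
    unfolding h_def
    by (rule lift[OF that]) (use bz in \<open>auto intro!: smooth_on_open_mult smooth_on_open_diff smooth_on_open_const bs F that\<close>)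
  have h_eq: "h x z = \<beta> x z * (F x (snd (c x) z) - T)" for x z by (simp add: h_def \<beta>_def)
  define \<psi> where "\<psi> = (\<lambda>z. T + (\<Sum>x\<in>I. h x z * \<Omega> (s z)))"
  have hOs: "smooth_function M (\<lambda>z. h x z * \<Omega> (s z))" if "x \<in> K" for x
    by (intro smooth_function_mult hs Oms that)
  have psi_s: "smooth_function M \<psi>"
    unfolding \<psi>_def using I(1) by (intro smooth_function_add smooth_function_const smooth_function_sum hOs) auto
  \<comment> \<open>Outside \<open>K\<close> the second factor vanishes, on \<open>K\<close> the first one.\<close>
  have q: "(1 - (\<Sum>x\<in>I. P x z)) * (T - f z) = 0" for z
    using Om(5)[of "s z"] sigma(2)[of z] fT[of z] by (cases "z \<in> K") (auto simp: sumP)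
  have close: "\<bar>\<psi> z - f z\<bar> \<le> \<epsilon>" for z
  proof -
    have "\<psi> z - f z = (\<Sum>x\<in>I. P x z * (F x (snd (c x) z) - f z)) + (1 - (\<Sum>x\<in>I. P x z)) * (T - f z)"
      by (simp add: \<psi>_def h_eq P_def sum_distrib_left sum_distrib_right sum_subtractf algebra_simps sum.distrib)
    then have "\<bar>\<psi> z - f z\<bar> = \<bar>\<Sum>x\<in>I. P x z * (F x (snd (c x) z) - f z)\<bar>" using q by simp
    also have "\<dots> \<le> (\<Sum>x\<in>I. \<bar>P x z * (F x (snd (c x) z) - f z)\<bar>)" by (rule sum_abs)
    also have "\<dots> \<le> (\<Sum>x\<in>I. P x z * \<eta>)"
    proof (rule sum_mono)
      fix x assume x: "x \<in> I"
      show "\<bar>P x z * (F x (snd (c x) z) - f z)\<bar> \<le> P x z * \<eta>"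
      proof (cases "z \<in> U x")
        case True
        have xK: "x \<in> K" using x I by auto
        have z: "z \<in> chart_dom (c x)" "snd (c x) z \<in> Q 2 x"
          using True BQ[of 1 x] Qmono[OF xK, of 1 2] by (auto simp: U_def)
        have "\<bar>F x (snd (c x) z) - f z\<bar> \<le> \<eta>" using F(2)[OF xK z(2)] z(1) c by simp
        then show ?thesis using P0[of x z] by (simp add: abs_mult mult_left_mono)
      next
        case False
        then have "\<beta> x z = 0" using chi_pos[of x z] chi_nonneg[of x z] by simp
        then show ?thesis by (simp add: P_def)
      qed
    qed
    also have "\<dots> = s z * \<Omega> (s z) * \<eta>" by (simp add: sumP flip: sum_distrib_right)
    also have "\<dots> \<le> 1 * \<eta>" using Om(4)[OF s0[of z]] eta by (intro mult_right_mono) auto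
    finally show ?thesis using eta by simp
  qed
  have slope: "slope_le \<psi> (1 + \<delta>) z" if z: "z \<notin> mfd_boundary M" for z
  proof (rule slope_leI[OF psi_s z c(1) c(2)])
    let ?c = "c z"
    have ci: "snd ?c z \<in> chart_int ?c" by (rule not_boundary[OF c z])
    fix v
    let ?g = "gnorm M ?c z v"
    have g0: "0 \<le> ?g" by (rule gnorm_nonneg[OF c])
    \<comment> \<open>The two parts of the differential of a summand: \<open>L\<close> is the differential of \<open>F x\<close>, and \<open>\<phi>\<close> is
      \<open>F x - T\<close>. Away from the support both can be chosen trivially.\<close>
    have ex: "\<exists>L \<phi>. \<bar>L\<bar> \<le> (1 + \<delta> / 2) * ?g \<and> \<bar>\<phi> - (f z - T)\<bar> \<le> \<eta> \<and>
        du (\<lambda>z. h x z * \<Omega> (s z)) ?c z v = P x z * L + \<phi> * du (P x) ?c z v" if x: "x \<in> K" for x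
    proof (cases "z \<in> chart_dom (c x) \<and> snd (c x) z \<in> B 2 x")
      case True
      then have zx: "z \<in> chart_dom (c x)" "snd (c x) z \<in> B 2 x" by auto
      have z23: "snd (c x) z \<in> Q 2 x" "snd (c x) z \<in> Q 3 x" using zx BQ[of 2 x] Qmono[OF x, of 2 3] by auto
      have zi: "snd (c x) z \<in> chart_int (c x)" using Q3i(1)[OF x] z23 by auto
      define w where "w = dtransition ?c (c x) z v"
      have gw: "gnorm M (c x) z w = ?g"
        unfolding w_def by (rule gnorm_transition[OF c(1) c(1) c(2) zx(1)])
      define L where "L = frechet_derivative (F x) (at (snd (c x) z)) w"
      have "\<bar>L\<bar> \<le> (1 + \<delta>') * gnorm M (c x) x w" unfolding L_def by (rule DF[OF x zx(2)])
      also have "gnorm M (c x) x w \<le> (1 + \<delta>') * gnorm M (c x) z w"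
        using r(4)[OF x, of "snd (c x) z" w] z23(2) zx(1) c by (simp add: Q_def)
      finally have "\<bar>L\<bar> \<le> ((1 + \<delta>') * (1 + \<delta>')) * ?g" using d' gw by (simp add: mult_left_mono mult.assoc)
      also have "\<dots> \<le> (1 + \<delta> / 2) * ?g" by (rule mult_right_mono[OF d'(2) g0])
      finally have L: "\<bar>L\<bar> \<le> (1 + \<delta> / 2) * ?g" .
      let ?\<phi> = "F x (snd (c x) z) - T"
      have phi: "\<bar>?\<phi> - (f z - T)\<bar> \<le> \<eta>" using F(2)[OF x z23(1)] zx c by simp
      have "du (\<lambda>z. h x z * \<Omega> (s z)) (c x) z = (\<lambda>v. P x (chart_inv (c x) (snd (c x) z)) * (frechet_derivative (F x) (at (snd (c x) z)) v - 0) + du (P x) (c x) z v * ?\<phi>)"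
        by (rule du_cong_open[OF c(1) zx(1) zi open_UNIV UNIV_I has_derivative_mult[OF du_has_derivative[OF Ps[OF x] c(1) zi]
          has_derivative_diff[OF smooth_on_open_has_derivative[OF F(1)[OF x] UNIV_I] has_derivative_const]]])
          (use c in \<open>simp add: h_eq P_def\<close>)
      then have "du (\<lambda>z. h x z * \<Omega> (s z)) (c x) z w = P x z * L + ?\<phi> * du (P x) (c x) z w"
        using zx c by (simp add: L_def)
      then have "du (\<lambda>z. h x z * \<Omega> (s z)) ?c z v = P x z * L + ?\<phi> * du (P x) ?c z v"
        unfolding w_def
          du_transition[OF hOs[OF x] c(1) c(2) ci c(1) zx(1) zi]
          du_transition[OF Ps[OF x] c(1) c(2) ci c(1) zx(1) zi] .
      then show ?thesis using L phi by blast
    next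
      case False
      have zS: "z \<in> - S x"
      proof
        assume "z \<in> S x"
        then obtain y where y: "y \<in> Q 1 x" "z = chart_inv (c x) y" by (auto simp: S_def)
        then have "z \<in> chart_dom (c x)" "snd (c x) z = y" using Qimg[OF x] chart_inv_in[OF c(1)] c by auto
        then show False using False y Q1B2[OF x] by auto
      qed
      have oS: "open (- S x)" using S(1)[OF x] by (rule open_Compl)
      have "du (\<lambda>z. h x z * \<Omega> (s z)) ?c z v = 0" "du (P x) ?c z v = 0"
        by (rule du_locally_const[OF c ci oS zS, where a = 0], simp add: h_eq P_def chi_S)+
      moreover have "0 \<le> (1 + \<delta> / 2) * ?g" using d g0 by simp
      moreover have "P x z = 0" using zS by (simp add: P_def chi_S)
      ultimately show ?thesis using eta by (intro exI[of _ 0] exI[of _ "f z - T"]) auto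
    qed
    have "\<forall>x. \<exists>p. x \<in> K \<longrightarrow> \<bar>fst p\<bar> \<le> (1 + \<delta> / 2) * ?g \<and> \<bar>snd p - (f z - T)\<bar> \<le> \<eta> \<and>
        du (\<lambda>z. h x z * \<Omega> (s z)) ?c z v = P x z * fst p + snd p * du (P x) ?c z v" (is "\<forall>x. \<exists>p. ?R x p")
    proof
      fix x
      show "\<exists>p. ?R x p"
      proof (cases "x \<in> K")
        case True
        obtain L \<phi> where "\<bar>L\<bar> \<le> (1 + \<delta> / 2) * ?g \<and> \<bar>\<phi> - (f z - T)\<bar> \<le> \<eta> \<and>
          du (\<lambda>z. h x z * \<Omega> (s z)) ?c z v = P x z * L + \<phi> * du (P x) ?c z v"
          using ex[OF True] by (elim exE)
        then show ?thesis by (intro exI[of _ "(L, \<phi>)"]) simp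
      qed simp
    qed
    from choice[OF this] obtain p where p: "\<And>x. ?R x (p x)" by (elim exE) (rule that, elim allE)
    define L \<phi> where "L = (\<lambda>x. fst (p x))" and "\<phi> = (\<lambda>x. snd (p x))"
    have L: "\<bar>L x\<bar> \<le> (1 + \<delta> / 2) * ?g" "\<bar>\<phi> x - (f z - T)\<bar> \<le> \<eta>"
      "du (\<lambda>z. h x z * \<Omega> (s z)) ?c z v = P x z * L x + \<phi> x * du (P x) ?c z v" if "x \<in> K" for x
      using p[of x] that by (simp_all only: L_def \<phi>_def simp_thms)
    have "du \<psi> ?c z v = (\<Sum>x\<in>I. du (\<lambda>z. h x z * \<Omega> (s z)) ?c z v)"
    proof -
      have I': "smooth_function M (\<lambda>z. h x z * \<Omega> (s z))" if "x \<in> I" for x using hOs that I by auto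
      let ?S = "\<lambda>z. \<Sum>x\<in>I. h x z * \<Omega> (s z)"
      have S': "smooth_function M ?S" by (rule smooth_function_sum[OF I'])
      have "du \<psi> ?c z v = du (\<lambda>_. T) ?c z v + du ?S ?c z v"
        unfolding \<psi>_def by (rule du_add[OF smooth_function_const S' c(1) ci])
      also have "du ?S ?c z v = (\<Sum>x\<in>I. du (\<lambda>z. h x z * \<Omega> (s z)) ?c z v)"
        by (rule du_sum[OF I' c(1) ci])
      finally show ?thesis using du_const[OF c ci] by simp
    qed
    also have "\<dots> = (\<Sum>x\<in>I. P x z * L x + \<phi> x * du (P x) ?c z v)"
      by (intro sum.cong refl L) (use I in auto)
    also have "\<dots> = (\<Sum>x\<in>I. P x z * L x) + (\<Sum>x\<in>I. (\<phi> x - (f z - T)) * du (P x) ?c z v) + (f z - T) * (\<Sum>x\<in>I. du (P x) ?c z v)"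
      by (simp add: sum_distrib_left sum.distrib[symmetric] algebra_simps)
    also have "(f z - T) * (\<Sum>x\<in>I. du (P x) ?c z v) = 0"
    proof (cases "z \<in> K")
      case True
      have I': "smooth_function M (P x)" if "x \<in> I" for x using Ps that I by auto
      let ?V = "{z. \<sigma> < s z}"
      have V': "open ?V" using continuous_smooth_function[OF ss] by (intro open_Collect_less continuous_intros)
      have "(\<Sum>x\<in>I. du (P x) ?c z v) = du (\<lambda>z. \<Sum>x\<in>I. P x z) ?c z v"
        by (rule du_sum[OF I' c(1) ci, symmetric])
      also have "\<dots> = 0"
        by (rule du_locally_const[OF c ci V', where a = 1]) (use sigma(2)[OF True] Om(5) in \<open>auto simp: sumP\<close>)
      finally show ?thesis by simp
    qed (simp add: fT)
    finally have "\<bar>du \<psi> ?c z v\<bar> \<le> \<bar>\<Sum>x\<in>I. P x z * L x\<bar> + \<bar>\<Sum>x\<in>I. (\<phi> x - (f z - T)) * du (P x) ?c z v\<bar>" by simp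
    also have "\<bar>\<Sum>x\<in>I. P x z * L x\<bar> \<le> (1 + \<delta> / 2) * ?g"
    proof -
      have "\<bar>\<Sum>x\<in>I. P x z * L x\<bar> \<le> (\<Sum>x\<in>I. P x z * ((1 + \<delta> / 2) * ?g))"
        using I L(1) P0 by (intro order_trans[OF sum_abs] sum_mono) (auto simp: abs_mult intro!: mult_left_mono)
      also have "\<dots> = (s z * \<Omega> (s z)) * ((1 + \<delta> / 2) * ?g)" by (simp add: sumP flip: sum_distrib_right)
      also have "\<dots> \<le> 1 * ((1 + \<delta> / 2) * ?g)" using Om(4)[OF s0] d g0 by (intro mult_right_mono) auto
      finally show ?thesis by simp
    qed
    also have "\<bar>\<Sum>x\<in>I. (\<phi> x - (f z - T)) * du (P x) ?c z v\<bar> \<le> \<delta> / 2 * ?g"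
    proof -
      have "\<bar>\<Sum>x\<in>I. (\<phi> x - (f z - T)) * du (P x) ?c z v\<bar> \<le> (\<Sum>x\<in>I. \<eta> * (C x * ?g))"
      proof (intro order_trans[OF sum_abs] sum_mono)
        fix x assume "x \<in> I"
        then have x: "x \<in> K" using I by auto
        have "\<bar>du (P x) ?c z v\<bar> \<le> C x * ?g" using C(2)[OF x z] c unfolding slope_le_def by blast
        then show "\<bar>(\<phi> x - (f z - T)) * du (P x) ?c z v\<bar> \<le> \<eta> * (C x * ?g)"
          unfolding abs_mult using L(2)[OF x] eta by (intro mult_mono) auto
      qed
      also have "\<dots> = (\<eta> * CC) * ?g" by (simp add: CC_def sum_distrib_left sum_distrib_right mult.assoc)
      also have "\<dots> \<le> \<delta> / 2 * ?g" by (rule mult_right_mono[OF eta(3) g0])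
      finally show ?thesis .
    qed
    finally show "\<bar>du \<psi> ?c z v\<bar> \<le> (1 + \<delta>) * ?g" by (simp add: algebra_simps)
  qed
  show thesis by (rule that[OF psi_s close slope])
qed

end

section \<open>Exponential profiles\<close>

text \<open>With \<open>t = p * (z - 1)\<close> the left-hand side is \<open>(1 + t / p) powr p\<close>. It is at most \<open>exp t \<le> exp 1\<close> if
  \<open>t \<le> 1\<close>. For \<open>t \<ge> 1\<close> the difference \<open>t powr p - (1 + t / p) powr p\<close> is nondecreasing and at least
  \<open>1 - exp 1\<close> at \<open>t = 1\<close>.\<close>

lemma exponential_profile_inequality:
  fixes p z :: real
  assumes p: "1 \<le> p" and z: "1 \<le> z"
  shows "z powr p \<le> (p * (z - 1)) powr p + exp 1"
proof -
  define t where "t = p * (z - 1)"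
  have t0: "0 \<le> t" and zt: "z = 1 + t / p" using p z by (auto simp: t_def)
  have small: "(1 + s / p) powr p \<le> exp s" if "0 \<le> s" for s
  proof -
    have "(1 + s / p) powr p \<le> exp (s / p) powr p"
      using exp_ge_add_one_self[of "s / p"] p that by (intro powr_mono2) auto
    also have "\<dots> = exp s" using p by (simp add: powr_def)
    finally show ?thesis .
  qed
  show ?thesis
  proof (cases "t \<le> 1")
    case True
    have "z powr p \<le> exp t" unfolding zt by (rule small[OF t0])
    also have "\<dots> \<le> exp 1" using True by simp
    finally show ?thesis using powr_ge_zero[of "p * (z - 1)" p] by linarith
  next
    case False
    let ?h = "\<lambda>s. s powr p - (1 + s / p) powr p"
    have pp: "(1 + 1 / p) powr (p - 1) \<le> p"
    proof -
      have "ln (1 / p) \<le> 1 / p - 1" using p by (intro ln_le_minus_one) auto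
      then have lp: "1 - 1 / p \<le> ln p" using p by (simp add: ln_div)
      have "(p - 1) * ln (1 + 1 / p) \<le> (p - 1) * (1 / p)"
        using p by (intro mult_left_mono ln_add_one_self_le_self) auto
      also have "\<dots> = 1 - 1 / p" using p by (simp add: field_simps)
      finally have "(p - 1) * ln (1 + 1 / p) \<le> ln p" using lp by simp
      then have "exp ((p - 1) * ln (1 + 1 / p)) \<le> exp (ln p)" by simp
      moreover have "0 < 1 + 1 / p" using p by (simp add: add_pos_pos)
      ultimately show ?thesis using p by (simp add: powr_def)
    qed
    have "?h 1 \<le> ?h t"
    proof (rule DERIV_nonneg_imp_nondecreasing[of 1 t ?h])
      show "1 \<le> t" using False by simp
      fix s :: real assume s: "1 \<le> s" "s \<le> t"
      have pos: "0 < 1 + s / p" using s p by (simp add: add_pos_pos)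
      have der: "(?h has_real_derivative (p * s powr (p - 1) - (1 + s / p) powr (p - 1))) (at s)"
        using s p pos by (auto intro!: derivative_eq_intros)
      have "(1 + s / p) powr (p - 1) \<le> (s * (1 + 1 / p)) powr (p - 1)"
        using s p pos by (intro powr_mono2) (auto simp: field_simps)
      also have "\<dots> = s powr (p - 1) * (1 + 1 / p) powr (p - 1)"
        using s p by (simp add: powr_mult)
      also have "\<dots> \<le> s powr (p - 1) * p" by (intro mult_left_mono pp) simp
      finally show "\<exists>y. (?h has_real_derivative y) (at s) \<and> 0 \<le> y"
        using der by (intro exI[of _ "p * s powr (p - 1) - (1 + s / p) powr (p - 1)"]) (simp add: mult.commute)
    qed
    then have "(1 + t / p) powr p \<le> t powr p + (1 + 1 / p) powr p - 1" by simp
    also have "\<dots> \<le> t powr p + exp 1" using small[of 1] by simp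
    finally show ?thesis unfolding zt using p by (simp add: t_def[symmetric])
  qed
qed

text \<open>The heart of the estimate. For \<open>z = exp (\<mu> * (T - \<psi> x))\<close> the preceding inequality becomes
  \<open>exp (- \<mu> * \<psi> x) powr p \<le> (p * \<phi> x) powr p + a / b\<close>, where \<open>\<phi>\<close> is the profile and \<open>a\<close> the measure
  of \<open>A\<close>; the definition of \<open>L\<close> is made for this. It is used where \<open>\<psi> < T\<close>. The total error is at most
  \<open>a / b * b = a\<close>, and it is compensated on \<open>A\<close>: there the left-hand side is 1, but its integral does
  not contribute to the energy since \<open>\<psi>\<close> is constant.\<close>

lemma (in finite_measure) exponential_profile:
  fixes \<psi> :: "'a \<Rightarrow> real"
  assumes [measurable]: "\<psi> \<in> borel_measurable M" "A \<in> sets M"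
    and psi: "\<And>x. 0 \<le> \<psi> x" "\<And>x. \<psi> x \<le> T" "\<And>x. x \<in> A \<Longrightarrow> \<psi> x = 0"
    and T: "0 < T" and p: "1 \<le> p" and a: "0 < measure M A"
    and b: "measure M {x \<in> space M. \<psi> x < T} \<le> b" and k: "0 \<le> \<kappa>"
  defines "L \<equiv> ln (exp 1 * b / measure M A)"
  defines "\<mu> \<equiv> L / (p * T)"
  shows "(\<integral>\<^sup>+x. ennreal ((if 0 < \<psi> x \<and> \<psi> x < T then \<kappa> * (\<mu> * exp (- \<mu> * \<psi> x)) else 0) powr p) \<partial>M)
    \<le> ennreal ((\<kappa> * L / T) powr p) * (\<integral>\<^sup>+x. ennreal (\<bar>exp (- \<mu> * \<psi> x) - exp (- \<mu> * T)\<bar> powr p) \<partial>M)"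
    and "1 \<le> L"
proof -
  let ?a = "measure M A"
  have "A \<subseteq> {x \<in> space M. \<psi> x < T}" using psi(3) T sets.sets_into_space[of A M] by auto
  then have "?a \<le> measure M {x \<in> space M. \<psi> x < T}" by (intro finite_measure_mono) auto
  then have ab: "?a \<le> b" "0 < b" using b a by auto
  have L: "L = 1 + ln (b / ?a)" using ab a by (simp add: L_def ln_mult ln_div)
  then show L1: "1 \<le> L" using ab a by simp
  have eL: "exp L = exp 1 * b / ?a" unfolding L_def using ab a by simp
  have muT: "\<mu> * T = L / p" using T by (simp add: \<mu>_def)
  have mu: "0 \<le> \<mu>" using L1 T p by (simp add: \<mu>_def)
  define \<phi> where "\<phi> = (\<lambda>x. exp (- \<mu> * \<psi> x) - exp (- \<mu> * T))"
  have phi0: "0 \<le> \<phi> x" for x using psi(2)[of x] mu by (auto simp: \<phi>_def intro: mult_left_mono)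
  have phi1: "\<phi> x \<le> 1" for x
    using psi(1)[of x] mu unfolding \<phi>_def by (smt (verit) exp_ge_zero exp_le_one_iff mult_minus_left mult_nonneg_nonneg)
  define J where "J = (\<lambda>x. if 0 < \<psi> x \<and> \<psi> x < T then exp (- \<mu> * \<psi> x) powr p else 0)"
  have key: "exp (- \<mu> * \<psi> x) powr p \<le> (p * \<phi> x) powr p + ?a / b" for x
  proof -
    let ?z = "exp (L / p - \<mu> * \<psi> x)"
    have "\<mu> * \<psi> x \<le> L / p" using mult_left_mono[OF psi(2)[of x] mu] muT by simp
    then have "1 \<le> ?z" by simp
    from exponential_profile_inequality[OF p this]
    have 1: "?z powr p \<le> (p * (?z - 1)) powr p + exp 1" .
    have zE: "?z = exp (L / p) * exp (- \<mu> * \<psi> x)" by (simp add: exp_diff exp_minus field_simps)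
    have z1: "?z - 1 = exp (L / p) * \<phi> x"
      using muT by (simp add: \<phi>_def zE right_diff_distrib exp_minus)
    have eLp: "exp (L / p) powr p = exp L" using p by (simp add: powr_def)
    have "?z powr p = exp L * exp (- \<mu> * \<psi> x) powr p"
      unfolding zE by (subst powr_mult) (simp_all add: eLp)
    moreover have "(p * (?z - 1)) powr p = exp L * (p * \<phi> x) powr p"
    proof -
      have "(p * (?z - 1)) powr p = (exp (L / p) * (p * \<phi> x)) powr p" by (simp add: z1 ac_simps)
      also have "\<dots> = exp L * (p * \<phi> x) powr p"
        using p phi0[of x] by (subst powr_mult) (simp_all add: eLp)
      finally show ?thesis .
    qed
    moreover have "exp 1 = exp L * (?a / b)" unfolding eL using ab a by simp
    ultimately have "exp L * exp (- \<mu> * \<psi> x) powr p \<le> exp L * ((p * \<phi> x) powr p + ?a / b)"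
      using 1 by (simp add: distrib_left)
    then show ?thesis by simp
  qed
  let ?B = "{x \<in> space M. \<psi> x < T}" and ?Z = "{x \<in> space M. \<psi> x = 0}"
  have pt: "J x \<le> (p * \<phi> x) powr p + ?a / b * indicator ?B x - indicator ?Z x" if "x \<in> space M" for x
  proof (cases "\<psi> x = 0")
    case True
    then show ?thesis using key[of x] that T by (simp add: J_def)
  next
    case False
    then show ?thesis using key[of x] psi(1)[of x] that by (auto simp: J_def)
  qed
  have [measurable]: "\<phi> \<in> borel_measurable M" "J \<in> borel_measurable M" unfolding \<phi>_def J_def by measurable
  have iphi: "integrable M (\<lambda>x. \<phi> x powr p)"
    by (rule integrable_const_bound[of _ 1]) (use phi0 phi1 p in \<open>auto intro!: powr_le1\<close>)
  have iphi': "integrable M (\<lambda>x. (p * \<phi> x) powr p)"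
    using iphi phi0 p by (simp add: powr_mult)
  have J01: "0 \<le> J x" "J x \<le> 1" for x
    using psi(1)[of x] mu p by (auto simp: J_def intro!: powr_le1)
  have iJ: "integrable M J"
    by (rule integrable_const_bound[of _ 1]) (use J01 in auto)
  have "(\<integral>x. J x \<partial>M) \<le> (\<integral>x. (p * \<phi> x) powr p + ?a / b * indicator ?B x - indicator ?Z x \<partial>M)"
  proof (rule integral_mono_AE[OF iJ])
    show "integrable M (\<lambda>x. (p * \<phi> x) powr p + ?a / b * indicator ?B x - indicator ?Z x)"
      by (intro Bochner_Integration.integrable_diff Bochner_Integration.integrable_add iphi' integrable_mult_right integrable_real_indicator)
         (auto simp: less_top[symmetric])
  qed (use pt in auto)
  also have "\<dots> = (\<integral>x. (p * \<phi> x) powr p \<partial>M) + ?a / b * measure M ?B - measure M ?Z"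
    using iphi' by (simp add: less_top[symmetric])
  also have "\<dots> \<le> (\<integral>x. (p * \<phi> x) powr p \<partial>M)"
  proof -
    have "?a / b * measure M ?B \<le> ?a / b * b" using ab a b by (intro mult_left_mono) auto
    also have "\<dots> = ?a" using ab by simp
    also have "?a \<le> measure M ?Z"
      using psi(3) sets.sets_into_space[of A M] by (intro finite_measure_mono) auto
    finally show ?thesis by simp
  qed
  also have "\<dots> = p powr p * (\<integral>x. \<phi> x powr p \<partial>M)" using phi0 p by (simp add: powr_mult)
  finally have main: "(\<integral>x. J x \<partial>M) \<le> p powr p * (\<integral>x. \<phi> x powr p \<partial>M)" .
  let ?k = "(\<kappa> * \<mu>) powr p"
  have "(\<integral>\<^sup>+x. ennreal ((if 0 < \<psi> x \<and> \<psi> x < T then \<kappa> * (\<mu> * exp (- \<mu> * \<psi> x)) else 0) powr p) \<partial>M)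
     = (\<integral>\<^sup>+x. ennreal (?k * J x) \<partial>M)"
    using mu k by (intro nn_integral_cong) (auto simp: J_def powr_mult mult.assoc[symmetric])
  also have "\<dots> = ennreal (\<integral>x. ?k * J x \<partial>M)"
    using iJ J01 by (intro nn_integral_eq_integral) auto
  also have "\<dots> \<le> ennreal (?k * (p powr p * (\<integral>x. \<phi> x powr p \<partial>M)))"
    using main by (intro ennreal_leI) (simp add: mult_left_mono)
  also have "?k * (p powr p * (\<integral>x. \<phi> x powr p \<partial>M)) = (\<kappa> * L / T) powr p * (\<integral>x. \<phi> x powr p \<partial>M)"
  proof -
    have "?k * p powr p = (\<kappa> * \<mu> * p) powr p" using k mu p by (simp add: powr_mult)
    also have "\<kappa> * \<mu> * p = \<kappa> * L / T" using p T by (simp add: \<mu>_def)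
    finally show ?thesis by simp
  qed
  also have "ennreal \<dots> = ennreal ((\<kappa> * L / T) powr p) * (\<integral>\<^sup>+x. ennreal (\<phi> x powr p) \<partial>M)"
    using iphi by (subst nn_integral_eq_integral) (auto simp: ennreal_mult integral_nonneg)
  finally show "(\<integral>\<^sup>+x. ennreal ((if 0 < \<psi> x \<and> \<psi> x < T then \<kappa> * (\<mu> * exp (- \<mu> * \<psi> x)) else 0) powr p) \<partial>M)
    \<le> ennreal ((\<kappa> * L / T) powr p) * (\<integral>\<^sup>+x. ennreal (\<bar>exp (- \<mu> * \<psi> x) - exp (- \<mu> * T)\<bar> powr p) \<partial>M)"
    using phi0 by (simp add: \<phi>_def)
qed

text \<open>A mollification of the function that is 0 up to \<open>2 * e\<close>, then increases with slope 1, and is constant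
  from \<open>T + 2 * e\<close> on. The derivative vanishes where the extreme values are attained. The mollification
  takes place on a bounded interval, whence the restriction by \<open>R\<close>.\<close>

lemma smooth_clamp:
  assumes e: "0 < e" and T: "0 < T" and R: "0 < R"
  obtains \<theta> \<theta>' :: "real \<Rightarrow> real" where "smooth_on_open UNIV \<theta>" "\<And>t. (\<theta> has_real_derivative \<theta>' t) (at t)"
    "\<And>t. \<bar>t\<bar> < R \<Longrightarrow> 0 \<le> \<theta> t" "\<And>t. \<bar>t\<bar> < R \<Longrightarrow> \<theta> t \<le> T"
    "\<And>t. \<bar>t\<bar> < R \<Longrightarrow> t \<le> e \<Longrightarrow> \<theta> t = 0" "\<And>t. \<bar>t\<bar> < R \<Longrightarrow> T + 3 * e \<le> t \<Longrightarrow> \<theta> t = T"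
    "\<And>t. \<bar>t\<bar> < R \<Longrightarrow> \<bar>\<theta>' t\<bar> \<le> (if 0 < \<theta> t \<and> \<theta> t < T then 1 else 0)"
proof -
  define g where "g = (\<lambda>t. max 0 (min T (t - 2 * e)))"
  have "continuous_on (cbox (- (R + e)) (R + e)) g" unfolding g_def by (intro continuous_intros)
  from mollify[OF this e] obtain \<theta> where th: "smooth_on_open UNIV \<theta>"
    "\<And>x u. cube x e \<subseteq> cbox (- (R + e)) (R + e) \<Longrightarrow>
          (\<And>z. z \<in> cube x e \<Longrightarrow> g z \<le> u) \<Longrightarrow> \<theta> x \<le> u"
    "\<And>x u. cube x e \<subseteq> cbox (- (R + e)) (R + e) \<Longrightarrow>
          (\<And>z. z \<in> cube x e \<Longrightarrow> u \<le> g z) \<Longrightarrow> u \<le> \<theta> x"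
    "\<And>x y u. cube x e \<subseteq> cbox (- (R + e)) (R + e) \<Longrightarrow>
          cube y e \<subseteq> cbox (- (R + e)) (R + e) \<Longrightarrow>
          (\<And>w. w \<in> cbox (- e *\<^sub>R One) (e *\<^sub>R One) \<Longrightarrow> g (x + w) - g (y + w) \<le> u) \<Longrightarrow> \<theta> x - \<theta> y \<le> u"
    by blast
  have sub: "cube x e \<subseteq> cbox (- (R + e)) (R + e)" if "\<bar>x\<bar> < R" for x
    using that by auto
  have lo: "0 \<le> \<theta> t" and hi: "\<theta> t \<le> T" if "\<bar>t\<bar> < R" for t
    by (rule th(3)[OF sub[OF that]], simp add: g_def) (rule th(2)[OF sub[OF that]], use T in \<open>simp add: g_def\<close>)
  have z: "\<theta> t = 0" if "\<bar>t\<bar> < R" "t \<le> e" for t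
  proof -
    have "\<theta> t \<le> 0" by (rule th(2)[OF sub[OF that(1)]]) (use that in \<open>auto simp: g_def\<close>)
    then show ?thesis using lo[OF that(1)] by simp
  qed
  have tT: "\<theta> t = T" if "\<bar>t\<bar> < R" "T + 3 * e \<le> t" for t
  proof -
    have "T \<le> \<theta> t" by (rule th(3)[OF sub[OF that(1)]]) (use that T in \<open>auto simp: g_def\<close>)
    then show ?thesis using hi[OF that(1)] by simp
  qed
  have lip: "\<theta> s - \<theta> t \<le> \<bar>s - t\<bar>" if "\<bar>s\<bar> < R" "\<bar>t\<bar> < R" for s t
    by (rule th(4)[OF sub[OF that(1)] sub[OF that(2)]]) (auto simp: g_def)
  define \<theta>' where "\<theta>' = (\<lambda>t. frechet_derivative \<theta> (at t) 1)"
  have der: "(\<theta> has_real_derivative \<theta>' t) (at t)" for t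
  proof -
    have d: "(\<theta> has_derivative frechet_derivative \<theta> (at t)) (at t)" by (rule smooth_on_open_has_derivative[OF th(1) UNIV_I])
    have "frechet_derivative \<theta> (at t) = (*) (\<theta>' t)"
    proof
      show "frechet_derivative \<theta> (at t) h = \<theta>' t * h" for h
        using linear_cmul[OF has_derivative_linear[OF d], of h 1] by (simp add: \<theta>'_def mult.commute)
    qed
    then show ?thesis using d by (simp add: has_field_derivative_def)
  qed
  have bound: "\<bar>\<theta>' t\<bar> \<le> (if 0 < \<theta> t \<and> \<theta> t < T then 1 else 0)" if t: "\<bar>t\<bar> < R" for t
  proof -
    have d: "(\<theta> has_derivative frechet_derivative \<theta> (at t)) (at t)" by (rule smooth_on_open_has_derivative[OF th(1) UNIV_I])
    have "\<bar>\<theta>' t\<bar> \<le> 1"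
      unfolding \<theta>'_def
    proof (rule derivative_bound_of_local_lipschitz[OF d, of "{-R<..<R}"])
      fix h :: real assume h: "h > 0" "t + h *\<^sub>R 1 \<in> {-R<..<R}"
      then have "\<bar>t + h\<bar> < R" by auto
      then show "\<bar>\<theta> (t + h *\<^sub>R 1) - \<theta> t\<bar> \<le> h * 1"
        using lip[of "t + h" t] lip[of t "t + h"] t h by auto
    qed (use t in auto)
    moreover have "\<theta>' t = 0" if "\<theta> t = 0 \<or> \<theta> t = T"
      using that
    proof
      assume "\<theta> t = 0"
      then show ?thesis
        using t lo by (intro DERIV_local_min[OF der, of "R - \<bar>t\<bar>"]) auto
    next
      assume "\<theta> t = T"
      then show ?thesis
        using t hi by (intro DERIV_local_max[OF der, of "R - \<bar>t\<bar>"]) auto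
    qed
    ultimately show ?thesis using lo[OF t] hi[OF t] by auto
  qed
  show thesis by (rule that[OF th(1) der lo hi z tT bound])
qed

section \<open>Separating functions\<close>

lemma separated_neighbourhoods_radius:
  fixes D :: ennreal
  assumes "ennreal D' \<le> D" "2 * T < D'" "0 \<le> T"
  shows "\<not> D \<le> ennreal T + ennreal T"
proof
  assume "D \<le> ennreal T + ennreal T"
  with assms(1) have "ennreal D' \<le> ennreal T + ennreal T" by (rule order_trans)
  also have "\<dots> = ennreal (2 * T)" using assms(3) by (simp flip: ennreal_plus)
  finally show False using assms by (simp add: ennreal_le_iff)
qed

context weighted_manifold
begin

definition dist_from :: "'a set \<Rightarrow> 'a \<Rightarrow> ennreal" where
  "dist_from A x = (INF a\<in>A. rdist M a x)"

text \<open>The truncation makes the distance from \<open>A\<close> a real number in all cases, and constant on the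
  boundary of the manifold if \<open>D\<close> is at most the distance from \<open>A\<close> to the boundary.\<close>

definition trunc_dist :: "real \<Rightarrow> 'a set \<Rightarrow> 'a \<Rightarrow> real" where
  "trunc_dist D A x = enn2real (min (dist_from A x) (ennreal D))"

lemma trunc_dist_bounds:
  assumes "0 \<le> D"
  shows "0 \<le> trunc_dist D A x" "trunc_dist D A x \<le> D" "ennreal (trunc_dist D A x) = min (dist_from A x) (ennreal D)"
proof -
  have fin: "min (dist_from A x) (ennreal D) < top" by (simp add: min_less_iff_disj)
  show "0 \<le> trunc_dist D A x" by (simp add: trunc_dist_def)
  show eq: "ennreal (trunc_dist D A x) = min (dist_from A x) (ennreal D)"
    using fin by (simp add: trunc_dist_def)
  have "ennreal (trunc_dist D A x) \<le> ennreal D" unfolding eq by simp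
  then show "trunc_dist D A x \<le> D" using assms by (simp add: ennreal_le_iff)
qed

lemma trunc_dist_lessD:
  assumes "0 \<le> D" "trunc_dist D A x < T" "T \<le> D"
  obtains a where "a \<in> A" "rdist M a x < ennreal T"
proof -
  have "ennreal (trunc_dist D A x) < ennreal T"
    using assms trunc_dist_bounds(1)[OF assms(1), of A x] by (simp add: ennreal_less_iff)
  then have "min (dist_from A x) (ennreal D) < ennreal T" by (simp add: trunc_dist_bounds(3)[OF assms(1)])
  moreover have "ennreal T \<le> ennreal D" using assms by (simp add: ennreal_leI)
  ultimately have "dist_from A x < ennreal T" by (auto simp: min_less_iff_disj)
  then show thesis using that by (auto simp: dist_from_def INF_less_iff)
qed

lemma trunc_dist_zero: "0 \<le> D \<Longrightarrow> x \<in> A \<Longrightarrow> trunc_dist D A x = 0"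
proof -
  assume "0 \<le> D" "x \<in> A"
  then have "dist_from A x \<le> 0" unfolding dist_from_def by (metis INF_lower rdist_refl)
  then show ?thesis by (simp add: trunc_dist_def)
qed

lemma lipschitz1_trunc_dist:
  assumes D: "0 \<le> D"
  shows "lipschitz1 (trunc_dist D A)"
proof -
  have *: "trunc_dist D A x \<le> trunc_dist D A y + l" if l: "0 \<le> l" "rdist M y x \<le> ennreal l" for x y l
  proof (cases "trunc_dist D A y < D")
    case False
    then show ?thesis using trunc_dist_bounds(2)[OF D, of A x] l by simp
  next
    case True
    show ?thesis
    proof (rule field_le_epsilon)
      fix e :: real assume e: "e > 0"
      let ?T = "min D (trunc_dist D A y + e / 2)"
      have T: "0 \<le> ?T" using D e trunc_dist_bounds(1)[OF D, of A y] by simp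
      obtain a where a: "a \<in> A" "rdist M a y < ennreal ?T"
        by (rule trunc_dist_lessD[OF D, of A y ?T]) (use True e in auto)
      have "ennreal l < ennreal (l + e / 2)" using l e by (simp add: ennreal_less_iff)
      then have "rdist M y x < ennreal (l + e / 2)" using l(2) by (rule le_less_trans[rotated])
      from rdist_triangle_less[OF a(2) this]
      have "rdist M a x \<le> ennreal (?T + (l + e / 2))" using T l e by (simp add: ennreal_plus)
      moreover have "dist_from A x \<le> rdist M a x" unfolding dist_from_def by (rule INF_lower[OF a(1)])
      ultimately have "ennreal (trunc_dist D A x) \<le> ennreal (?T + (l + e / 2))"
        unfolding trunc_dist_bounds(3)[OF D] by (meson min.coboundedI1 order_trans)
      then have "trunc_dist D A x \<le> ?T + (l + e / 2)" using T l e by (simp add: ennreal_le_iff)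
      then show "trunc_dist D A x \<le> trunc_dist D A y + l + e" by linarith
    qed
  qed
  show ?thesis
    unfolding lipschitz1_def
  proof (intro allI impI)
    fix x y l assume l: "0 \<le> l" "rdist M x y \<le> ennreal l"
    have "rdist M y x \<le> ennreal l" using l(2) by (simp add: rdist_sym)
    then show "\<bar>trunc_dist D A x - trunc_dist D A y\<bar> \<le> l" using *[of l y x] *[of l x y] l by simp
  qed
qed

text \<open>The truncated distance from \<open>A\<close> is smoothed and then clamped, so that it is exactly 0 on \<open>A\<close> and
  exactly \<open>T\<close> outside the neighbourhood of radius \<open>T'\<close>. The gap between \<open>T\<close> and \<open>T'\<close> absorbs the error
  \<open>e\<close> of the smoothing and the width \<open>3 * e\<close> lost by the clamping.\<close>

lemma separating_function:
  assumes D: "ennreal D \<le> rsetdist M A (mfd_boundary M)" and T: "0 < T" "T < T'" "T' < D" and d: "0 < \<delta>"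
  obtains \<psi> where "smooth_function M \<psi>" "\<And>x. 0 \<le> \<psi> x" "\<And>x. \<psi> x \<le> T" "\<And>x. x \<in> A \<Longrightarrow> \<psi> x = 0"
    "\<And>x. \<psi> x < T \<Longrightarrow> \<exists>a\<in>A. rdist M a x < ennreal T'"
    "closure {x. \<psi> x < T} \<inter> mfd_boundary M = {}"
    "\<And>x. x \<notin> mfd_boundary M \<Longrightarrow> slope_le \<psi> (if 0 < \<psi> x \<and> \<psi> x < T then 1 + \<delta> else 0) x"
proof -
  have D0: "0 \<le> D" using T by simp
  let ?\<rho> = "trunc_dist D A"
  have lip: "lipschitz1 ?\<rho>" by (rule lipschitz1_trunc_dist[OF D0])
  have crho: "continuous_on UNIV ?\<rho>" by (rule continuous_lipschitz1[OF lip])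
  define f where "f = (\<lambda>x. min (?\<rho> x) T')"
  have lipf: "lipschitz1 f"
    using lip unfolding lipschitz1_def f_def by (smt (verit, best))
  have bd: "?\<rho> x = D" if x: "x \<in> mfd_boundary M" for x
  proof -
    have "rsetdist M A (mfd_boundary M) \<le> dist_from A x"
      unfolding rsetdist_def dist_from_def by (intro INF_mono') (auto intro: INF_lower x)
    then have "ennreal D \<le> dist_from A x" using D by simp
    then have "ennreal (?\<rho> x) = ennreal D" by (simp add: trunc_dist_bounds(3)[OF D0])
    then show ?thesis using D0 trunc_dist_bounds(1)[OF D0] by simp
  qed
  let ?K = "{x. ?\<rho> x \<le> T'}" and ?V = "{x. ?\<rho> x < D}"
  have K: "closed ?K" by (intro closed_Collect_le crho continuous_intros)
  have V: "open ?V" by (intro open_Collect_less crho continuous_intros)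
  have KV: "?K \<subseteq> ?V" "?V \<inter> mfd_boundary M = {}" using T bd by auto
  have fK: "f x = T'" if "x \<notin> ?K" for x using that by (simp add: f_def)
  define e where "e = (T' - T) / 4"
  have e: "0 < e" "T + 3 * e = T' - e" using T by (auto simp: e_def field_simps)
  obtain \<psi>0 where p: "smooth_function M \<psi>0" "\<And>x. \<bar>\<psi>0 x - f x\<bar> \<le> e"
    "\<And>x. x \<notin> mfd_boundary M \<Longrightarrow> slope_le \<psi>0 (1 + \<delta>) x"
    using smooth_lipschitz_approximation[OF lipf K KV(1) V KV(2) fK d e(1)] by blast
  have f0: "0 \<le> f x" "f x \<le> T'" for x using trunc_dist_bounds(1)[OF D0, of A x] T by (auto simp: f_def)
  define R where "R = T' + e + 1"
  have R: "0 < R" using T e by (simp add: R_def)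
  have pR: "\<bar>\<psi>0 x\<bar> < R" for x using p(2)[of x] f0[of x] e by (auto simp: R_def)
  obtain \<theta> \<theta>' where th: "smooth_on_open UNIV \<theta>" "\<And>t. (\<theta> has_real_derivative \<theta>' t) (at t)"
    "\<And>t. \<bar>t\<bar> < R \<Longrightarrow> 0 \<le> \<theta> t" "\<And>t. \<bar>t\<bar> < R \<Longrightarrow> \<theta> t \<le> T"
    "\<And>t. \<bar>t\<bar> < R \<Longrightarrow> t \<le> e \<Longrightarrow> \<theta> t = 0" "\<And>t. \<bar>t\<bar> < R \<Longrightarrow> T + 3 * e \<le> t \<Longrightarrow> \<theta> t = T"
    "\<And>t. \<bar>t\<bar> < R \<Longrightarrow> \<bar>\<theta>' t\<bar> \<le> (if 0 < \<theta> t \<and> \<theta> t < T then 1 else 0)"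
    by (rule smooth_clamp[OF e(1) T(1) R]) blast
  define \<psi> where "\<psi> = (\<lambda>x. \<theta> (\<psi>0 x))"
  have less: "?\<rho> x < T'" if "\<psi> x < T" for x
  proof (rule ccontr)
    assume "\<not> ?\<rho> x < T'"
    then have "f x = T'" by (simp add: f_def)
    then have "T + 3 * e \<le> \<psi>0 x" using p(2)[of x] e by (simp add: abs_le_iff)
    then have "\<psi> x = T" unfolding \<psi>_def by (rule th(6)[OF pR])
    then show False using that by simp
  qed
  show thesis
  proof (rule that[of \<psi>])
    show "smooth_function M \<psi>" unfolding \<psi>_def by (rule smooth_function_compose[OF p(1) th(1)]) simp
    show "0 \<le> \<psi> x" "\<psi> x \<le> T" for x unfolding \<psi>_def using th(3,4)[OF pR] by auto
    show "\<psi> x = 0" if "x \<in> A" for x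
    proof -
      have "f x = 0" using trunc_dist_zero[OF D0 that] T by (simp add: f_def)
      then have "\<psi>0 x \<le> e" using p(2)[of x] by simp
      then show ?thesis unfolding \<psi>_def by (rule th(5)[OF pR])
    qed
    show "\<exists>a\<in>A. rdist M a x < ennreal T'" if "\<psi> x < T" for x
      by (rule trunc_dist_lessD[OF D0 less[OF that]]) (use T in auto)
    have "closure {x. \<psi> x < T} \<subseteq> ?K"
      by (rule closure_minimal[OF _ K]) (use less in \<open>auto intro: less_imp_le\<close>)
    then show "closure {x. \<psi> x < T} \<inter> mfd_boundary M = {}" using KV by blast
    show "slope_le \<psi> (if 0 < \<psi> x \<and> \<psi> x < T then 1 + \<delta> else 0) x" if x: "x \<notin> mfd_boundary M" for x
      unfolding slope_le_def
    proof (intro ballI impI allI)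
      fix c v assume c: "c \<in> atlas M" "x \<in> chart_dom c"
      have ci: "snd c x \<in> chart_int c" by (rule not_boundary[OF c x])
      have "du \<psi> c x v = \<theta>' (\<psi>0 x) * du \<psi>0 c x v"
        unfolding \<psi>_def by (rule du_compose[OF p(1) c ci th(2)])
      then have "\<bar>du \<psi> c x v\<bar> = \<bar>\<theta>' (\<psi>0 x)\<bar> * \<bar>du \<psi>0 c x v\<bar>" by (simp add: abs_mult)
      also have "\<dots> \<le> (if 0 < \<psi> x \<and> \<psi> x < T then 1 else 0) * ((1 + \<delta>) * gnorm M c x v)"
        using th(7)[OF pR[of x]] p(3)[OF x] c unfolding slope_le_def \<psi>_def
        by (intro mult_mono) auto
      also have "\<dots> = (if 0 < \<psi> x \<and> \<psi> x < T then 1 + \<delta> else 0) * gnorm M c x v" by simp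
      finally show "\<bar>du \<psi> c x v\<bar> \<le> (if 0 < \<psi> x \<and> \<psi> x < T then 1 + \<delta> else 0) * gnorm M c x v" .
    qed
  qed
qed

section \<open>Energy estimates\<close>

lemma Lp_energy_le_const:
  assumes p: "1 \<le> p" and C: "AE x in wmeasure M. \<bar>u x\<bar> \<le> C" "0 \<le> C"
  shows "Lp_energy M p u \<le> ennreal (C powr p)"
proof -
  have "Lp_energy M p u \<le> (\<integral>\<^sup>+x. ennreal (C powr p) \<partial>wmeasure M)"
    unfolding Lp_energy_def
  proof (rule nn_integral_mono_AE)
    show "AE x in wmeasure M. ennreal (\<bar>u x\<bar> powr p) \<le> ennreal (C powr p)"
      using C(1) by eventually_elim (use p in \<open>auto intro!: ennreal_leI powr_mono2\<close>)
  qed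
  also have "\<dots> = ennreal (C powr p)"
    using emeasure_wmeasure_UNIV by (simp add: space_wmeasure)
  finally show ?thesis .
qed

lemma zero_test_function: "(\<lambda>x. 0) \<in> test_functions_interior M"
  by (simp add: test_functions_interior_def smooth_function_const)

lemma borel_test_function: "u \<in> test_functions_interior M \<Longrightarrow> u \<in> borel_measurable borel"
  by (rule borel_measurable_continuous_onI[OF continuous_smooth_function[OF test_functions_interiorD(1)]])

text \<open>The gradient of the zero function is a weak gradient chosen arbitrarily, so even here its
  uniqueness almost everywhere enters.\<close>

lemma energy_zero:
  assumes "1 \<le> p"
  shows "Lp_energy M p (\<lambda>x. 0) + Lp_energy M p (grad_norm M (\<lambda>x. 0)) = 0"
proof -
  have "AE x in wmeasure M. 0 \<le> grad_norm M (\<lambda>x. 0) x \<and> grad_norm M (\<lambda>x. 0) x \<le> 0"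
  proof (rule grad_norm_bound[OF zero_test_function, where C = "\<lambda>_. 0"])
    show "\<exists>X. is_weak_gradient M (\<lambda>x. 0) X" using weak_gradient_cgrad[OF zero_test_function] by blast
    show "slope_le (\<lambda>x. 0) 0 x" if "x \<notin> mfd_boundary M" for x
      unfolding slope_le_def using du_const[OF _ _ not_boundary[OF _ _ that], where a = 0] by auto
  qed auto
  then have "Lp_energy M p (grad_norm M (\<lambda>x. 0)) \<le> ennreal (0 powr p)"
    by (intro Lp_energy_le_const[OF assms]) (auto elim: eventually_mono)
  then show ?thesis by (simp add: Lp_energy_def)
qed

text \<open>The approximating sequence is constant.\<close>

lemma test_function_W1p0:
  assumes u: "u \<in> test_functions_interior M" and p: "1 \<le> p"
  shows "u \<in> W1p0 M p"
proof -
  have ex: "\<exists>X. is_weak_gradient M u X" using weak_gradient_cgrad[OF u] by blast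
  obtain C where C: "0 \<le> C" "\<And>z. z \<notin> mfd_boundary M \<Longrightarrow> slope_le u C z" by (rule bounded_slope[OF u]) blast
  have "AE x in wmeasure M. 0 \<le> grad_norm M u x \<and> grad_norm M u x \<le> C"
    by (rule grad_norm_bound[OF u borel_test_function[OF u] _ ex C(2)]) (use C in auto)
  then have "Lp_energy M p (grad_norm M u) \<le> ennreal (C powr p)"
    by (intro Lp_energy_le_const[OF p]) (use C in \<open>auto elim: eventually_mono\<close>)
  then have 1: "Lp_energy M p (grad_norm M u) < \<infinity>" by (simp add: le_less_trans)
  have "compact (range u)"
    using continuous_smooth_function[OF test_functions_interiorD(1)[OF u]] compact_M by (rule compact_continuous_image)
  then obtain B where B: "\<And>x. \<bar>u x\<bar> \<le> B"
    using compact_imp_bounded[of "range u"] unfolding bounded_iff by auto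
  have "0 \<le> B" using B[of undefined] by linarith
  then have "Lp_energy M p u \<le> ennreal (B powr p)" by (intro Lp_energy_le_const[OF p]) (use B in auto)
  then have 2: "Lp_energy M p u < \<infinity>" by (simp add: le_less_trans)
  have "u \<in> W1p M p" unfolding W1p_def using borel_test_function[OF u] ex 1 2 by simp
  moreover have "(\<lambda>i::nat. Lp_energy M p (\<lambda>x. u x - u x) + Lp_energy M p (grad_norm M (\<lambda>x. u x - u x))) \<longlonglongrightarrow> 0"
    using energy_zero[OF p] by simp
  ultimately show ?thesis unfolding W1p0_def using u by (auto intro!: exI[of _ "\<lambda>_. u"])
qed

end

lemma powr_sum_disjoint:
  fixes f :: "'i \<Rightarrow> real"
  assumes "finite I" "\<And>i j. i \<in> I \<Longrightarrow> j \<in> I \<Longrightarrow> i \<noteq> j \<Longrightarrow> f i = 0 \<or> f j = 0"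
  shows "\<bar>\<Sum>i\<in>I. f i\<bar> powr p = (\<Sum>i\<in>I. \<bar>f i\<bar> powr p)"
proof (cases "\<exists>i\<in>I. f i \<noteq> 0")
  case True
  then obtain i where i: "i \<in> I" "f i \<noteq> 0" by blast
  then have z: "f j = 0" if "j \<in> I - {i}" for j using assms(2)[of i j] that by auto
  have "(\<Sum>i\<in>I. f i) = f i" "(\<Sum>i\<in>I. \<bar>f i\<bar> powr p) = \<bar>f i\<bar> powr p"
    using z by (simp_all add: sum.remove[OF assms(1) i(1)])
  then show ?thesis by simp
qed simp

context weighted_manifold
begin

text \<open>Functions with disjoint supports do not interact: the energies and the norms of a linear
  combination are sums over the summands, so its Rayleigh quotient is at most the largest one of
  theirs. The functions \<open>C i\<close> are pointwise bounds of the gradients.\<close>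

lemma dirichlet_poincare_le_disjoint:
  assumes p: "1 \<le> p"
    and u: "\<And>i. i \<in> {1..k} \<Longrightarrow> u i \<in> test_functions_interior M"
    and C: "\<And>i x. i \<in> {1..k} \<Longrightarrow> x \<notin> mfd_boundary M \<Longrightarrow> slope_le (u i) (C i x) x"
      "\<And>i x. 0 \<le> C i x" "\<And>i. i \<in> {1..k} \<Longrightarrow> C i \<in> borel_measurable borel"
    and disj: "\<And>i j x. i \<in> {1..k} \<Longrightarrow> j \<in> {1..k} \<Longrightarrow> i \<noteq> j \<Longrightarrow> u i x = 0 \<and> C i x = 0 \<or> u j x = 0 \<and> C j x = 0"
    and indep: "\<And>i. i \<in> {1..k} \<Longrightarrow> \<not> (AE x in wmeasure M. u i x = 0)"
    and le: "\<And>i. i \<in> {1..k} \<Longrightarrow> Lp_energy M p (C i) \<le> \<kappa> * Lp_energy M p (u i)"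
  shows "dirichlet_poincare M k p \<le> \<kappa>"
proof -
  let ?I = "{1..k}"
  let ?comb = "\<lambda>a :: nat \<Rightarrow> real. \<lambda>x. \<Sum>i=1..k. a i * u i x"
  have um: "u i \<in> borel_measurable (wmeasure M)" if "i \<in> ?I" for i
    using borel_test_function[OF u[OF that]] by (simp add: measurable_cong_sets[OF sets_wmeasure refl])
  have Cm: "C i \<in> borel_measurable (wmeasure M)" if "i \<in> ?I" for i
    using C(3)[OF that] by (simp add: measurable_cong_sets[OF sets_wmeasure refl])
  have ds: "a i * u i x = 0 \<or> a j * u j x = 0" "\<bar>a i\<bar> * C i x = 0 \<or> \<bar>a j\<bar> * C j x = 0"
    if "i \<in> ?I" "j \<in> ?I" "i \<noteq> j" for i j x and a :: "nat \<Rightarrow> real"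
    using disj[OF that, of x] by auto
  have us: "smooth_function M (u i)" if "i \<in> ?I" for i by (rule test_functions_interiorD(1)[OF u[OF that]])
  have comb_s: "smooth_function M (?comb a)" for a
    by (intro smooth_function_sum smooth_function_mult smooth_function_const us)
  have comb_test: "?comb a \<in> test_functions_interior M" for a
  proof -
    have "{x. ?comb a x \<noteq> 0} \<subseteq> (\<Union>i\<in>?I. {x. u i x \<noteq> 0})"
      by (intro subsetI, rule ccontr) simp
    then have "closure {x. ?comb a x \<noteq> 0} \<subseteq> (\<Union>i\<in>?I. closure {x. u i x \<noteq> 0})"
      by (intro closure_minimal closed_UN) (auto intro: subsetD[OF closure_subset])
    moreover have "closure {x. u i x \<noteq> 0} \<inter> mfd_boundary M = {}" if "i \<in> ?I" for i
      using u[OF that] by (simp add: test_functions_interior_def)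
    moreover have "compact (closure {x. ?comb a x \<noteq> 0})"
      using compact_Int_closed[OF compact_M closed_closure] by simp
    ultimately have "closure {x. ?comb a x \<noteq> 0} \<inter> mfd_boundary M = {}" "compact (closure {x. ?comb a x \<noteq> 0})"
      by blast+
    then show ?thesis using comb_s[of a] unfolding test_functions_interior_def by blast
  qed
  have comb_slope: "slope_le (?comb a) (\<Sum>i=1..k. \<bar>a i\<bar> * C i x) x" if x: "x \<notin> mfd_boundary M" for a x
    unfolding slope_le_def
  proof (intro ballI impI allI)
    fix c v assume c: "c \<in> atlas M" "x \<in> chart_dom c"
    have ci: "snd c x \<in> chart_int c" by (rule not_boundary[OF c x])
    have "du (?comb a) c x v = (\<Sum>i\<in>?I. du (\<lambda>x. a i * u i x) c x v)"
      by (rule du_sum[OF smooth_function_mult[OF smooth_function_const us] c(1) ci])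
    also have "\<dots> = (\<Sum>i\<in>?I. a i * du (u i) c x v)"
      using du_mult[OF smooth_function_const us c ci] du_const[OF c ci] by (intro sum.cong) auto
    also have "\<bar>\<dots>\<bar> \<le> (\<Sum>i\<in>?I. \<bar>a i\<bar> * (C i x * gnorm M c x v))"
    proof (intro order_trans[OF sum_abs] sum_mono)
      fix i assume "i \<in> ?I"
      then have "\<bar>du (u i) c x v\<bar> \<le> C i x * gnorm M c x v" using C(1)[OF _ x] c unfolding slope_le_def by blast
      then show "\<bar>a i * du (u i) c x v\<bar> \<le> \<bar>a i\<bar> * (C i x * gnorm M c x v)"
        unfolding abs_mult by (rule mult_left_mono) simp
    qed
    finally show "\<bar>du (?comb a) c x v\<bar> \<le> (\<Sum>i=1..k. \<bar>a i\<bar> * C i x) * gnorm M c x v"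
      by (simp add: sum_distrib_right mult.assoc)
  qed
  have energy_sum: "(\<integral>\<^sup>+x. ennreal (\<bar>\<Sum>i=1..k. a i * g i x\<bar> powr p) \<partial>wmeasure M)
      = (\<Sum>i=1..k. ennreal (\<bar>a i\<bar> powr p) * (\<integral>\<^sup>+x. ennreal (\<bar>g i x\<bar> powr p) \<partial>wmeasure M))"
    if g: "\<And>i. i \<in> ?I \<Longrightarrow> g i \<in> borel_measurable (wmeasure M)"
      and dg: "\<And>i j x. i \<in> ?I \<Longrightarrow> j \<in> ?I \<Longrightarrow> i \<noteq> j \<Longrightarrow> a i * g i x = 0 \<or> a j * g j x = 0"
    for a :: "nat \<Rightarrow> real" and g :: "nat \<Rightarrow> 'a \<Rightarrow> real"
  proof -
    have "(\<integral>\<^sup>+x. ennreal (\<bar>\<Sum>i=1..k. a i * g i x\<bar> powr p) \<partial>wmeasure M)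
      = (\<integral>\<^sup>+x. (\<Sum>i=1..k. ennreal (\<bar>a i\<bar> powr p) * ennreal (\<bar>g i x\<bar> powr p)) \<partial>wmeasure M)"
    proof (rule nn_integral_cong)
      fix x
      have "\<bar>\<Sum>i=1..k. a i * g i x\<bar> powr p = (\<Sum>i=1..k. \<bar>a i * g i x\<bar> powr p)"
        by (rule powr_sum_disjoint) (use dg in auto)
      then show "ennreal (\<bar>\<Sum>i=1..k. a i * g i x\<bar> powr p) = (\<Sum>i=1..k. ennreal (\<bar>a i\<bar> powr p) * ennreal (\<bar>g i x\<bar> powr p))"
        by (simp add: abs_mult powr_mult flip: ennreal_mult)
    qed
    also have "\<dots> = (\<Sum>i=1..k. \<integral>\<^sup>+x. ennreal (\<bar>a i\<bar> powr p) * ennreal (\<bar>g i x\<bar> powr p) \<partial>wmeasure M)"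
    proof (rule nn_integral_sum)
      fix i assume "i \<in> ?I"
      note [measurable] = g[OF this]
      show "(\<lambda>x. ennreal (\<bar>a i\<bar> powr p) * ennreal (\<bar>g i x\<bar> powr p)) \<in> borel_measurable (wmeasure M)" by measurable
    qed
    also have "\<dots> = (\<Sum>i=1..k. ennreal (\<bar>a i\<bar> powr p) * (\<integral>\<^sup>+x. ennreal (\<bar>g i x\<bar> powr p) \<partial>wmeasure M))"
    proof (intro sum.cong refl nn_integral_cmult)
      fix i assume "i \<in> ?I"
      note [measurable] = g[OF this]
      show "(\<lambda>x. ennreal (\<bar>g i x\<bar> powr p)) \<in> borel_measurable (wmeasure M)" by measurable
    qed
    finally show ?thesis .
  qed
  define L where "L = {\<phi> \<in> W1p0 M p. \<exists>a :: nat \<Rightarrow> real. AE x in wmeasure M. \<phi> x = ?comb a x}"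
  have "L \<in> kdim_subspaces (wmeasure M) (W1p0 M p) k"
    unfolding kdim_subspaces_def mem_Collect_eq L_def
  proof (intro exI[of _ u] conjI ballI allI impI refl)
    show "u i \<in> W1p0 M p" if "i \<in> ?I" for i by (rule test_function_W1p0[OF u[OF that] p])
    fix a :: "nat \<Rightarrow> real" and i assume ae: "AE x in wmeasure M. ?comb a x = 0" and i: "i \<in> ?I"
    show "a i = 0"
    proof (rule ccontr)
      assume a: "a i \<noteq> 0"
      have "AE x in wmeasure M. u i x = 0"
        using ae
      proof eventually_elim
        case (elim x)
        show ?case
        proof (rule ccontr)
          assume ui: "u i x \<noteq> 0"
          have z: "a j * u j x = 0" if "j \<in> ?I - {i}" for j
            using disj[of i j x] i that ui by auto
          have "?comb a x = a i * u i x + (\<Sum>j\<in>?I - {i}. a j * u j x)" by (rule sum.remove) (use i in auto)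
          also have "(\<Sum>j\<in>?I - {i}. a j * u j x) = 0" by (rule sum.neutral) (use z in blast)
          finally have "?comb a x = a i * u i x" by simp
          then show False using elim a ui by simp
        qed
      qed
      then show False using indep[OF i] by blast
    qed
  qed
  then have "dirichlet_poincare M k p \<le> (SUP \<phi>\<in>{\<phi> \<in> L. \<not> (AE x in wmeasure M. \<phi> x = 0)}.
          Lp_energy M p (grad_norm M \<phi>) / Lp_energy M p \<phi>)"
    unfolding dirichlet_poincare_def by (rule INF_lower)
  also have "\<dots> \<le> \<kappa>"
  proof (rule SUP_least)
    fix \<phi> assume phi: "\<phi> \<in> {\<phi> \<in> L. \<not> (AE x in wmeasure M. \<phi> x = 0)}"
    then obtain a where a: "AE x in wmeasure M. \<phi> x = ?comb a x" by (auto simp: L_def)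
    have W: "\<phi> \<in> borel_measurable borel" "\<exists>X. is_weak_gradient M \<phi> X"
      using phi by (auto simp: L_def W1p0_def W1p_def)
    have phim: "\<phi> \<in> borel_measurable (wmeasure M)"
      using W(1) by (simp add: measurable_cong_sets[OF sets_wmeasure refl])
    have "Lp_energy M p \<phi> \<noteq> 0"
    proof
      assume "Lp_energy M p \<phi> = 0"
      then have "AE x in wmeasure M. ennreal (\<bar>\<phi> x\<bar> powr p) = 0"
        unfolding Lp_energy_def using phim by (subst (asm) nn_integral_0_iff_AE) auto
      then have "AE x in wmeasure M. \<phi> x = 0" by eventually_elim simp
      then show False using phi by simp
    qed
    then have pos: "0 < Lp_energy M p \<phi>" by (simp add: zero_less_iff_neq_zero)
    have "AE x in wmeasure M. 0 \<le> grad_norm M \<phi> x \<and> grad_norm M \<phi> x \<le> (\<Sum>i=1..k. \<bar>a i\<bar> * C i x)"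
      by (rule grad_norm_bound[OF comb_test W(1) a W(2) comb_slope]) (auto intro!: sum_nonneg mult_nonneg_nonneg C(2))
    then have "Lp_energy M p (grad_norm M \<phi>) \<le> (\<integral>\<^sup>+x. ennreal (\<bar>\<Sum>i=1..k. \<bar>a i\<bar> * C i x\<bar> powr p) \<partial>wmeasure M)"
      unfolding Lp_energy_def
      by (intro nn_integral_mono_AE) (rule eventually_mono, use p in \<open>auto intro!: ennreal_leI powr_mono2\<close>)
    also have "\<dots> = (\<Sum>i=1..k. ennreal (\<bar>\<bar>a i\<bar>\<bar> powr p) * Lp_energy M p (C i))"
      unfolding Lp_energy_def by (rule energy_sum[OF Cm]) (use ds in auto)
    also have "\<dots> \<le> (\<Sum>i=1..k. ennreal (\<bar>a i\<bar> powr p) * (\<kappa> * Lp_energy M p (u i)))"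
      using le by (intro sum_mono) (auto intro!: mult_left_mono)
    also have "\<dots> = \<kappa> * (\<Sum>i=1..k. ennreal (\<bar>a i\<bar> powr p) * Lp_energy M p (u i))"
      by (simp add: sum_distrib_left ac_simps)
    also have "(\<Sum>i=1..k. ennreal (\<bar>a i\<bar> powr p) * Lp_energy M p (u i)) = Lp_energy M p (?comb a)"
      unfolding Lp_energy_def by (rule energy_sum[OF um, symmetric]) (use ds in auto)
    also have "\<dots> = Lp_energy M p \<phi>"
      unfolding Lp_energy_def using a by (intro nn_integral_cong_AE) (auto elim: eventually_mono)
    finally have "Lp_energy M p (grad_norm M \<phi>) \<le> Lp_energy M p \<phi> * \<kappa>" by (simp add: mult.commute)
    then show "Lp_energy M p (grad_norm M \<phi>) / Lp_energy M p \<phi> \<le> \<kappa>"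
      by (rule divide_le_posI_ennreal[OF pos])
  qed
  finally show ?thesis .
qed

end

section \<open>The eigenvalue bound\<close>

context weighted_manifold
begin

lemma finite_measure_wmeasure: "finite_measure (wmeasure M)"
  by (rule finite_measureI) (simp add: space_wmeasure emeasure_wmeasure_UNIV)

lemma measure_wmeasure_UNIV: "measure (wmeasure M) UNIV = 1"
  by (simp add: measure_def emeasure_wmeasure_UNIV)

text \<open>The test functions are exponential profiles of separating functions. Any radius \<open>T'\<close> between \<open>T\<close> and
  \<open>D / 2\<close> makes the neighbourhoods of the sets disjoint from each other, so the neighbourhood of
  \<open>A \<alpha>\<close> has at most the measure \<open>b \<alpha>\<close> that the other sets leave.\<close>

lemma dirichlet_poincare_le:
  assumes p: "1 \<le> p" and A: "\<And>\<alpha>. \<alpha> \<in> {1..k} \<Longrightarrow> A \<alpha> \<in> sets borel"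
    and pos: "\<And>\<alpha>. \<alpha> \<in> {1..k} \<Longrightarrow> measure (wmeasure M) (A \<alpha>) \<noteq> 0"
    and D: "ennreal D \<le> sep_boundary M k A" and T: "0 < T" "2 * T < D" and d: "0 < \<delta>"
    and N: "\<And>\<alpha>. \<alpha> \<in> {1..k} \<Longrightarrow>
      ln (exp 1 * (1 - (\<Sum>\<beta>\<in>{1..k} - {\<alpha>}. measure (wmeasure M) (A \<beta>))) / measure (wmeasure M) (A \<alpha>)) \<le> N"
  shows "dirichlet_poincare M k p \<le> ennreal (((1 + \<delta>) * N / T) powr p)"
    and "1 \<le> k \<Longrightarrow> 1 \<le> N"
proof -
  let ?I = "{1..k}"
  let ?m = "measure (wmeasure M)"
  interpret finite_measure "wmeasure M" by (rule finite_measure_wmeasure)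
  define T' where "T' = (T + D / 2) / 2"
  have T': "T < T'" "2 * T' < D" "0 \<le> T'" "T' < D" using T by (auto simp: T'_def)
  have Db: "ennreal D \<le> rsetdist M (A \<alpha>) (mfd_boundary M)" if "\<alpha> \<in> ?I" for \<alpha>
  proof -
    have "sep_boundary M k A \<le> (INF \<alpha>\<in>?I. rsetdist M (A \<alpha>) (mfd_boundary M))"
      unfolding sep_boundary_def by simp
    also have "\<dots> \<le> rsetdist M (A \<alpha>) (mfd_boundary M)" by (rule INF_lower[OF that])
    finally show ?thesis using D by simp
  qed
  have Ds: "ennreal D \<le> rsetdist M (A \<alpha>) (A \<beta>)" if "\<alpha> \<in> ?I" "\<beta> \<in> ?I" "\<alpha> \<noteq> \<beta>" for \<alpha> \<beta>
  proof -
    have "sep_boundary M k A \<le> (INF \<alpha>\<in>?I. INF \<beta>\<in>?I - {\<alpha>}. rsetdist M (A \<alpha>) (A \<beta>))"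
      unfolding sep_boundary_def by simp
    also have "\<dots> \<le> (INF \<beta>\<in>?I - {\<alpha>}. rsetdist M (A \<alpha>) (A \<beta>))" by (rule INF_lower[OF that(1)])
    also have "\<dots> \<le> rsetdist M (A \<alpha>) (A \<beta>)" by (rule INF_lower) (use that in auto)
    finally show ?thesis using D by simp
  qed
  define good where "good = (\<lambda>\<alpha> \<psi>. smooth_function M \<psi> \<and> (\<forall>x. 0 \<le> \<psi> x) \<and> (\<forall>x. \<psi> x \<le> T) \<and> (\<forall>x\<in>A \<alpha>. \<psi> x = 0) \<and>
    (\<forall>x. \<psi> x < T \<longrightarrow> (\<exists>a\<in>A \<alpha>. rdist M a x < ennreal T')) \<and> closure {x. \<psi> x < T} \<inter> mfd_boundary M = {} \<and>
    (\<forall>x. x \<notin> mfd_boundary M \<longrightarrow> slope_le \<psi> (if 0 < \<psi> x \<and> \<psi> x < T then 1 + \<delta> else 0) x))"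
  have "\<exists>\<psi>. good \<alpha> \<psi>" if "\<alpha> \<in> ?I" for \<alpha>
    by (rule separating_function[OF Db[OF that] T(1) T'(1,4) d])
      (rule exI, unfold good_def, intro conjI allI ballI impI)
  then obtain \<psi> where good: "\<And>\<alpha>. \<alpha> \<in> ?I \<Longrightarrow> good \<alpha> (\<psi> \<alpha>)" by metis
  have psi: "smooth_function M (\<psi> \<alpha>)" "0 \<le> \<psi> \<alpha> x" "\<psi> \<alpha> x \<le> T" "x \<in> A \<alpha> \<Longrightarrow> \<psi> \<alpha> x = 0"
    "\<psi> \<alpha> x < T \<Longrightarrow> \<exists>a\<in>A \<alpha>. rdist M a x < ennreal T'" "closure {x. \<psi> \<alpha> x < T} \<inter> mfd_boundary M = {}"
    "x \<notin> mfd_boundary M \<Longrightarrow> slope_le (\<psi> \<alpha>) (if 0 < \<psi> \<alpha> x \<and> \<psi> \<alpha> x < T then 1 + \<delta> else 0) x"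
    if "\<alpha> \<in> ?I" for \<alpha> x
    using good[OF that] unfolding good_def by blast+
  have disjoint: "\<not> (\<psi> \<alpha> x < T \<and> \<psi> \<beta> x < T)" if i: "\<alpha> \<in> ?I" "\<beta> \<in> ?I" "\<alpha> \<noteq> \<beta>" for \<alpha> \<beta> x
  proof
    assume x: "\<psi> \<alpha> x < T \<and> \<psi> \<beta> x < T"
    obtain a b where ab: "a \<in> A \<alpha>" "rdist M a x < ennreal T'" "b \<in> A \<beta>" "rdist M b x < ennreal T'"
      using psi(5)[OF i(1)] psi(5)[OF i(2)] x by blast
    have "rsetdist M (A \<alpha>) (A \<beta>) \<le> rdist M a b"
      unfolding rsetdist_def by (rule INF_lower2[OF ab(1)], rule INF_lower[OF ab(3)])
    also have "\<dots> \<le> ennreal T' + ennreal T'"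
      by (rule rdist_triangle_less[OF ab(2)]) (use ab(4) in \<open>simp add: rdist_sym\<close>)
    finally show False
      using separated_neighbourhoods_radius[OF Ds[OF i] T'(2,3)] by simp
  qed
  have psim: "\<psi> \<alpha> \<in> borel_measurable borel" if "\<alpha> \<in> ?I" for \<alpha>
    by (rule borel_measurable_continuous_onI[OF continuous_smooth_function[OF psi(1)[OF that]]])
  have psimw: "\<psi> \<alpha> \<in> borel_measurable (wmeasure M)" if "\<alpha> \<in> ?I" for \<alpha>
    using psim[OF that] by (simp add: measurable_cong_sets[OF sets_wmeasure refl])
  have Aw: "A \<alpha> \<in> sets (wmeasure M)" if "\<alpha> \<in> ?I" for \<alpha> using A[OF that] by (simp add: sets_wmeasure)
  define b where "b = (\<lambda>\<alpha>. 1 - (\<Sum>\<beta>\<in>?I - {\<alpha>}. ?m (A \<beta>)))"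
  have b: "?m {x \<in> space (wmeasure M). \<psi> \<alpha> x < T} \<le> b \<alpha>" if i: "\<alpha> \<in> ?I" for \<alpha>
  proof -
    let ?S = "{x \<in> space (wmeasure M). \<psi> \<alpha> x < T}"
    note [measurable] = psimw[OF i]
    have S: "?S \<in> sets (wmeasure M)" by measurable
    have AT: "\<psi> \<beta> x < T" if "\<beta> \<in> ?I" "x \<in> A \<beta>" for \<beta> x using psi(4)[OF that] T by simp
    have "disjoint_family_on A (?I - {\<alpha>})"
      unfolding disjoint_family_on_def using AT disjoint by blast
    then have "(\<Sum>\<beta>\<in>?I - {\<alpha>}. ?m (A \<beta>)) = ?m (\<Union>\<beta>\<in>?I - {\<alpha>}. A \<beta>)"
      by (intro finite_measure_finite_Union[symmetric]) (use Aw in auto)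
    moreover have U: "(\<Union>\<beta>\<in>?I - {\<alpha>}. A \<beta>) \<in> sets (wmeasure M)" using Aw by auto
    moreover have "?S \<inter> (\<Union>\<beta>\<in>?I - {\<alpha>}. A \<beta>) = {}" using AT disjoint i by blast
    then have "?m ?S + ?m (\<Union>\<beta>\<in>?I - {\<alpha>}. A \<beta>) = ?m (?S \<union> (\<Union>\<beta>\<in>?I - {\<alpha>}. A \<beta>))"
      by (intro finite_measure_Union[symmetric] S U)
    moreover have "\<dots> \<le> 1" using bounded_measure measure_wmeasure_UNIV by (metis space_wmeasure)
    ultimately show ?thesis by (simp add: b_def)
  qed
  have a: "0 < ?m (A \<alpha>)" if "\<alpha> \<in> ?I" for \<alpha> using pos[OF that] by (simp add: zero_less_measure_iff)
  define L where "L = (\<lambda>\<alpha>. ln (exp 1 * b \<alpha> / ?m (A \<alpha>)))"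
  define \<mu> where "\<mu> = (\<lambda>\<alpha>. L \<alpha> / (p * T))"
  define u where "u = (\<lambda>\<alpha> x. exp (- \<mu> \<alpha> * \<psi> \<alpha> x) - exp (- \<mu> \<alpha> * T))"
  define C where "C = (\<lambda>\<alpha> x. if 0 < \<psi> \<alpha> x \<and> \<psi> \<alpha> x < T then (1 + \<delta>) * (\<bar>\<mu> \<alpha>\<bar> * exp (- \<mu> \<alpha> * \<psi> \<alpha> x)) else 0)"
  have L1: "1 \<le> L \<alpha>" if i: "\<alpha> \<in> ?I" for \<alpha>
    unfolding L_def
    by (rule exponential_profile(2)[OF psimw[OF i] Aw[OF i] psi(2)[OF i] psi(3)[OF i] psi(4)[OF i] T(1) p a[OF i] b[OF i], of 0]) auto
  have mu: "0 < \<mu> \<alpha>" if "\<alpha> \<in> ?I" for \<alpha> using L1[OF that] p T by (simp add: \<mu>_def)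
  have en: "Lp_energy M p (C \<alpha>) \<le> ennreal (((1 + \<delta>) * N / T) powr p) * Lp_energy M p (u \<alpha>)" if i: "\<alpha> \<in> ?I" for \<alpha>
  proof -
    have d0: "0 \<le> 1 + \<delta>" using d by simp
    have La: "ln (exp 1 * b \<alpha> / ?m (A \<alpha>)) = L \<alpha>" and mua: "L \<alpha> / (p * T) = \<mu> \<alpha>" by (simp_all add: L_def \<mu>_def)
    have "Lp_energy M p (C \<alpha>) = (\<integral>\<^sup>+x. ennreal ((if 0 < \<psi> \<alpha> x \<and> \<psi> \<alpha> x < T then (1 + \<delta>) * (\<mu> \<alpha> * exp (- \<mu> \<alpha> * \<psi> \<alpha> x)) else 0) powr p) \<partial>wmeasure M)"
      unfolding Lp_energy_def using mu[OF i] d by (intro nn_integral_cong) (auto simp: C_def abs_mult)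
    also have "\<dots> \<le> ennreal (((1 + \<delta>) * L \<alpha> / T) powr p) * Lp_energy M p (u \<alpha>)"
      using exponential_profile(1)[OF psimw[OF i] Aw[OF i] psi(2)[OF i] psi(3)[OF i] psi(4)[OF i] T(1) p a[OF i] b[OF i] d0, unfolded La, unfolded mua]
      by (simp add: Lp_energy_def u_def)
    also have "\<dots> \<le> ennreal (((1 + \<delta>) * N / T) powr p) * Lp_energy M p (u \<alpha>)"
    proof (intro mult_right_mono ennreal_leI powr_mono2)
      show "(1 + \<delta>) * L \<alpha> / T \<le> (1 + \<delta>) * N / T"
        using N[OF i] d T by (intro divide_right_mono mult_left_mono) (auto simp: L_def b_def)
    qed (use p d T L1[OF i] in auto)
    finally show ?thesis .
  qed
  show "1 \<le> N" if "1 \<le> k"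
    using L1[of 1] N[of 1] that by (simp add: L_def b_def)
  show "dirichlet_poincare M k p \<le> ennreal (((1 + \<delta>) * N / T) powr p)"
  proof (rule dirichlet_poincare_le_disjoint[OF p, of k u C])
    fix \<alpha> assume i: "\<alpha> \<in> ?I"
    let ?g = "\<lambda>t. exp (- \<mu> \<alpha> * t) - exp (- \<mu> \<alpha> * T)"
    have g: "smooth_on_open UNIV ?g"
      by (intro smooth_on_open_diff smooth_on_open_const smooth_on_open_compose[OF smooth_on_open_exp]
          smooth_on_open_mult smooth_on_open_id) auto
    have us: "smooth_function M (u \<alpha>)"
      unfolding u_def by (rule smooth_function_compose[OF psi(1)[OF i] g]) simp
    have "{x. u \<alpha> x \<noteq> 0} \<subseteq> {x. \<psi> \<alpha> x < T}"
      using psi(3)[OF i] by (auto simp: u_def less_le)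
    then have "closure {x. u \<alpha> x \<noteq> 0} \<inter> mfd_boundary M = {}"
      using psi(6)[OF i] closure_mono by blast
    moreover have "compact (closure {x. u \<alpha> x \<noteq> 0})"
      using compact_Int_closed[OF compact_M closed_closure] by simp
    ultimately show "u \<alpha> \<in> test_functions_interior M" using us by (simp add: test_functions_interior_def)
    show "C \<alpha> \<in> borel_measurable borel"
    proof -
      note [measurable] = psim[OF i]
      show ?thesis unfolding C_def by measurable
    qed
    show "\<not> (AE x in wmeasure M. u \<alpha> x = 0)"
    proof
      assume "AE x in wmeasure M. u \<alpha> x = 0"
      then have "AE x in wmeasure M. x \<notin> A \<alpha>"
      proof eventually_elim
        case (elim x)
        show ?case
        proof
          assume "x \<in> A \<alpha>"
          then have "u \<alpha> x = 1 - exp (- \<mu> \<alpha> * T)" using psi(4)[OF i] by (simp add: u_def)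
          then show False using elim mu[OF i] T by simp
        qed
      qed
      then have "A \<alpha> \<in> null_sets (wmeasure M)" using AE_iff_null_sets[OF Aw[OF i]] by simp
      then show False using pos[OF i] by (simp add: null_sets_def measure_def)
    qed
    show "Lp_energy M p (C \<alpha>) \<le> ennreal (((1 + \<delta>) * N / T) powr p) * Lp_energy M p (u \<alpha>)" by (rule en[OF i])
    show "slope_le (u \<alpha>) (C \<alpha> x) x" if x: "x \<notin> mfd_boundary M" for x
      unfolding slope_le_def
    proof (intro ballI impI allI)
      fix c v assume c: "c \<in> atlas M" "x \<in> chart_dom c"
      have "(?g has_real_derivative (- \<mu> \<alpha>) * exp (- \<mu> \<alpha> * \<psi> \<alpha> x)) (at (\<psi> \<alpha> x))"
        by (auto intro!: derivative_eq_intros)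
      from du_compose[OF psi(1)[OF i] c not_boundary[OF c x] this]
      have "du (u \<alpha>) c x v = (- \<mu> \<alpha>) * exp (- \<mu> \<alpha> * \<psi> \<alpha> x) * du (\<psi> \<alpha>) c x v" by (simp add: u_def)
      then have "\<bar>du (u \<alpha>) c x v\<bar> = (\<bar>\<mu> \<alpha>\<bar> * exp (- \<mu> \<alpha> * \<psi> \<alpha> x)) * \<bar>du (\<psi> \<alpha>) c x v\<bar>"
        by (simp add: abs_mult)
      also have "\<dots> \<le> (\<bar>\<mu> \<alpha>\<bar> * exp (- \<mu> \<alpha> * \<psi> \<alpha> x)) * ((if 0 < \<psi> \<alpha> x \<and> \<psi> \<alpha> x < T then 1 + \<delta> else 0) * gnorm M c x v)"
        using psi(7)[OF i x] c unfolding slope_le_def by (intro mult_left_mono) auto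
      also have "\<dots> = C \<alpha> x * gnorm M c x v" by (simp add: C_def)
      finally show "\<bar>du (u \<alpha>) c x v\<bar> \<le> C \<alpha> x * gnorm M c x v" .
    qed
  next
    show "0 \<le> C \<alpha> x" for \<alpha> x using d by (simp add: C_def)
    fix \<alpha> \<beta> x assume i: "\<alpha> \<in> ?I" "\<beta> \<in> ?I" "\<alpha> \<noteq> \<beta>"
    have "\<psi> \<alpha> x = T \<or> \<psi> \<beta> x = T"
      using disjoint[OF i, of x] psi(3)[OF i(1), of x] psi(3)[OF i(2), of x] by linarith
    then show "u \<alpha> x = 0 \<and> C \<alpha> x = 0 \<or> u \<beta> x = 0 \<and> C \<beta> x = 0"
      by (auto simp: u_def C_def)
  qed
qed

end

theorem theorem1p2:
  fixes M :: "('a::{second_countable_topology,t2_space}, 'n::{finite,wellorder}) weighted_mfd"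
    and k :: nat and p :: real and A :: "nat \<Rightarrow> 'a set"
  assumes "compact_weighted_riemannian_manifold_with_boundary M"
    and "1 \<le> k"
    and "1 \<le> p"
    and "\<And>\<alpha>. \<alpha> \<in> {1..k} \<Longrightarrow> A \<alpha> \<in> sets borel"
  shows "enn2ereal (ennreal_root p (dirichlet_poincare M k p)) \<le> separation_bound M k A"
proof (cases "sep_boundary M k A = 0 \<or> (\<exists>\<alpha>\<in>{1..k}. measure (wmeasure M) (A \<alpha>) = 0)")
  case True
  then show ?thesis by (simp add: separation_bound_def)
next
  case False
  interpret weighted_manifold M by unfold_locales (rule assms(1))
  define L where "L = (\<lambda>\<alpha>. ln (exp 1 * (1 - (\<Sum>\<beta>\<in>{1..k} - {\<alpha>}. measure (wmeasure M) (A \<beta>)))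
                / measure (wmeasure M) (A \<alpha>)))"
  define N where "N = (MAX \<alpha>\<in>{1..k}. L \<alpha>)"
  define \<nu> where "\<nu> = enn2real (dirichlet_poincare M k p) powr (1 / p)"
  have LN: "L \<alpha> \<le> N" if "\<alpha> \<in> {1..k}" for \<alpha> unfolding N_def using that by (intro Max_ge) auto
  let ?s = "sep_boundary M k A"
  have s: "?s \<noteq> 0" using False by simp
  have bound: "dirichlet_poincare M k p \<le> ennreal (((1 + \<delta>) * N / T) powr p)" "1 \<le> N"
    if "ennreal D \<le> ?s" "0 < T" "2 * T < D" "0 < \<delta>" for D T \<delta>
    using dirichlet_poincare_le[OF assms(3,4) _ that, of N] False LN assms(2) unfolding L_def by blast+
  \<comment> \<open>The separation may be infinite, in which case every positive number is a lower bound of it.\<close>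
  obtain D where D: "0 < D" "ennreal D \<le> ?s"
  proof (cases ?s)
    case (real r)
    then show thesis using that[of r] s by (cases "r = 0") auto
  next
    case top
    then show thesis using that[of 1] by simp
  qed
  have N1: "1 \<le> N" by (rule bound(2)[OF D(2), of "D / 3" 1]) (use D in auto)
  have fin: "dirichlet_poincare M k p \<noteq> \<infinity>"
    using bound(1)[OF D(2), of "D / 3" 1] D by (auto simp: top_unique)
  then have root: "enn2ereal (ennreal_root p (dirichlet_poincare M k p)) = ereal \<nu>"
    by (simp add: ennreal_root_def \<nu>_def enn2ereal_ennreal)
  have nu0: "0 \<le> \<nu>" by (simp add: \<nu>_def)
  have nu: "\<nu> \<le> (1 + \<delta>) * N / T" if "ennreal D \<le> ?s" "0 < T" "2 * T < D" "0 < \<delta>" for D T \<delta>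
  proof -
    let ?X = "(1 + \<delta>) * N / T"
    have X: "0 \<le> ?X" using that N1 by simp
    have "enn2real (dirichlet_poincare M k p) \<le> ?X powr p"
      using bound(1)[OF that] by (rule enn2real_leI[rotated]) simp
    then have "\<nu> \<le> (?X powr p) powr (1 / p)"
      unfolding \<nu>_def using assms(3) by (intro powr_mono2) auto
    also have "\<dots> = ?X" using X assms(3) by (simp add: powr_powr del: abs_divide)
    finally show ?thesis .
  qed
  have sb: "separation_bound M k A = 2 / enn2ereal ?s * ereal N"
    using False unfolding separation_bound_def N_def L_def by simp
  show ?thesis
    unfolding root sb
  proof (cases ?s)
    case top
    have "\<nu> \<le> 0"
    proof (rule ccontr)
      assume "\<not> \<nu> \<le> 0"
      \<comment> \<open>With \<open>T = 4 * N / \<nu>\<close> and \<open>\<delta> = 1\<close> the bound is \<open>\<nu> / 2\<close>.\<close>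
      then have "\<nu> \<le> (1 + 1) * N / (4 * N / \<nu>)"
        using N1 top by (intro nu[of "8 * N / \<nu> + 1"]) auto
      then show False using \<open>\<not> \<nu> \<le> 0\<close> N1 by simp
    qed
    then show "ereal \<nu> \<le> 2 / enn2ereal ?s * ereal N" using top nu0 by simp
  next
    case (real r)
    then have r: "0 < r" using s by (cases "r = 0") auto
    have "\<nu> \<le> 2 / r * N"
    proof (rule ccontr)
      assume "\<not> \<nu> \<le> 2 / r * N"
      moreover define q where "q = 2 / r * N"
      ultimately have q: "q < \<nu>" "0 < q" using r N1 by auto
      \<comment> \<open>With \<open>T = r / 2 / (1 + \<delta>)\<close> the bound is \<open>(1 + \<delta>)\<^sup>2 * q\<close>, which is below \<open>\<nu>\<close> for small \<open>\<delta>\<close>.\<close>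
      define \<delta> where "\<delta> = min 1 ((\<nu> / q - 1) / 6)"
      have d: "0 < \<delta>" "\<delta> \<le> 1" "\<delta> \<le> (\<nu> / q - 1) / 6"
        using q unfolding \<delta>_def by (simp, simp, intro min.cobounded2)
      let ?T = "r / 2 / (1 + \<delta>)"
      have "\<nu> \<le> (1 + \<delta>) * N / ?T"
        using real r d by (intro nu[of r]) (auto simp: field_simps)
      also have "\<dots> = (1 + \<delta>) * (1 + \<delta>) * q" using r d by (simp add: q_def)
      also have "\<dots> \<le> (1 + 3 * \<delta>) * q"
      proof (rule mult_right_mono)
        have "\<delta> * \<delta> \<le> \<delta>" using d mult_left_le[of \<delta> \<delta>] by simp
        then show "(1 + \<delta>) * (1 + \<delta>) \<le> 1 + 3 * \<delta>" by (simp add: algebra_simps)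
      qed (use q in simp)
      also have "\<dots> \<le> (1 + (\<nu> / q - 1) / 2) * q" using d q by (intro mult_right_mono) auto
      also have "\<dots> = (q + \<nu>) / 2" using q by (simp add: field_simps)
      also have "\<dots> < \<nu>" using q by simp
      finally show False by simp
    qed
    then show "ereal \<nu> \<le> 2 / enn2ereal ?s * ereal N"
      using real r by (simp add: enn2ereal_ennreal)
  qed
qed

end
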